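(* Let $(\mathcal{B},\|\cdot\|_{\mathcal{B}})$ be the Banach space and $\mathcal{C}_{c,A,L}(\delta)$ the cone defined in the context, both built on the same family of cone-stable curves $\widehat{\mathcal{W}}^s$, and let $\|\cdot\|_*$ be the norm associated with the order induced by $\mathcal{C}_{c,A,L}(\delta)$ with reference element $1$. Assume $q=\frac1p$, $A>4$, $Ac>1+C_s$ and $\gamma\le\frac{1}{p+1}$. Then the norms $\|\cdot\|_{\mathcal{B}}$ and $\|\cdot\|_*$ are equivalent on $\mathcal{B}$; that is, there exists $C\ge1$ such that $C^{-1}\|g\|_{\mathcal{B}}\le\|g\|_*\le C\|g\|_{\mathcal{B}}$ for all $g\in\mathcal{B}$ (where $\|\cdot\|_*$ is extended from $C^1(M)$ to $\mathcal{B}$ by density).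
   Context: **Billiard tables and phase space.** Fix constants $\tau_*,\mathcal{K}_*,E_*>0$. Consider the family of finite horizon dispersing billiard tables on $\mathbb{T}^2$ obtained by removing a fixed number of closed, pairwise disjoint, strictly convex scatterers $B_i$ with $C^3$ boundaries of fixed lengths $\ell_i$, such that distinct scatterers are at distance larger than $\tau_*$, the curvature of each boundary is larger than $\mathcal{K}_*$ and smaller than $\mathcal{K}_*^{-1}$, and the third derivative of each boundary is bounded by $E_*$. All the billiard maps $T$ (from one collision to the next) of these tables act on the same phase space $M=\bigcup_i[0,\ell_i)\times[-\frac\pi2,\frac\pi2]$ with coordinates $(r,\varphi)$, where $r$ is arclength on the boundary and $\varphi$ is the angle between the post-collisional velocity and the normal. Let $\mathcal{F}$ be the set of these maps. Put $C_s:=\sqrt{1+(\mathcal{K}_*^{-1}+\tau_*^{-1})^2}$. **Curves.** Fix $q_0\ge2$ and a large $k_0\in\mathbb{N}$. Homogeneity strips are $H_k=\{(r,\varphi)\in M:(k+1)^{-q_0}\le\frac\pi2-\varphi\le k^{-q_0}\}$ for $k\ge k_0$, the analogous strips $H_{-k}$ near $\varphi=-\frac\pi2$, and the remaining central strip. $\widehat{\mathcal{W}}^s$ is the set of $C^2$ curves in $M$ of length at most a fixed $\delta_0>0$, whose tangent vector at each point lies in the stable cone $\{-\mathcal{K}_*^{-1}-\tau_*^{-1}\le d\varphi/dr\le-\mathcal{K}_*\}$, and whose curvature is bounded by a fixed constant, chosen large enough that for each $T\in\mathcal{F}$ and $W\in\widehat{\mathcal{W}}^s$, $T^{-1}W$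 is (after subdivision) a union of elements of $\widehat{\mathcal{W}}^s$. $\widehat{\mathcal{W}}^s_{\mathbb{H}}$ is the set of those curves lying in a single homogeneity strip. For $W\in\widehat{\mathcal{W}}^s$, $|W|$ is its length, $m_W$ is arclength on $W$ (integrals over $W$ are with respect to $m_W$), $d(\cdot,\cdot)$ is arclength distance on $W$, and $\fint_W\psi:=|W|^{-1}\int_W\psi$. Each $W$ is a graph over an interval $I_W$: $W=\{G_W(r)=(r,\varphi_W(r)):r\in I_W\}$, and $\|G_W'\|=\sqrt{1+(d\varphi_W/dr)^2}$. **Distances.** If $W_1,W_2$ lie in the same homogeneity strip, $d_{\mathcal{W}^s}(W_1,W_2)=|I_{W_1}\triangle I_{W_2}|+|\varphi_{W_1}-\varphi_{W_2}|_{C^1(I_{W_1}\cap I_{W_2})}$; otherwise $d_{\mathcal{W}^s}(W_1,W_2)=\infty$. When this is finite and $\psi_i\in C^0(W_i)$, set $$d_0(\psi_1,\psi_2)=|\psi_1\circ G_{W_1}-\psi_2\circ G_{W_2}|_{C^0(I_{W_1}\cap I_{W_2})},$$ $$d_*(\psi_1,\psi_2)=\big|\psi_1\circ G_{W_1}\,\|G_{W_1}'\|-\psi_2\circ G_{W_2}\,\|G_{W_2}'\|\big|_{C^0(I_{W_1}\cap I_{W_2})}.$$ **Banach space.** $C^\alpha(W)$ carries the norm: sup norm plus $\alpha$-Hölder constant with respect to $d$. Fix $0<\alpha\le\frac1{q_0+1}$, $p>q_0+1$, $\beta\in(\frac1p,\alpha)$, $0<\gamma<\min\{\frac1p,\alpha-\beta\}$,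 $\varepsilon_0>0$, $c_u>0$. For $g\in C^1(M)$, $$\|g\|_s=\sup_{W\in\widehat{\mathcal{W}}^s_{\mathbb{H}}}\ \sup_{\substack{\psi\in C^\beta(W)\\|\psi|_{C^\beta(W)}\le|W|^{-1/p}}}\int_Wg\psi\,dm_W,$$ $$\|g\|_u=\sup_{\varepsilon\le\varepsilon_0}\ \sup_{\substack{W_1,W_2\in\widehat{\mathcal{W}}^s_{\mathbb{H}}\\d_{\mathcal{W}^s}(W_1,W_2)\le\varepsilon}}\ \sup_{\substack{|\psi_i|_{C^\alpha(W_i)}\le1\\d_0(\psi_1,\psi_2)=0}}\varepsilon^{-\gamma}\left|\int_{W_1}g\psi_1-\int_{W_2}g\psi_2\right|,$$ and $\|g\|_{\mathcal{B}}=\|g\|_s+c_u\|g\|_u$. $\mathcal{B}$ is the completion of $C^1(M)$ in $\|\cdot\|_{\mathcal{B}}$. **Cone.** With the same $\alpha,\beta,\gamma$, fix $q\in(0,\frac12)$ with $\gamma\le\min\{\alpha-\beta,q\}$, constants $a,c,A,L>1$, and a (small) length scale $\delta>0$ with $2\delta\le\delta_0$. Let $\mathcal{W}^s_-(\delta)=\{W\in\widehat{\mathcal{W}}^s_{\mathbb{H}}:|W|\le2\delta\}$ and $\mathcal{W}^s(\delta)=\{W\in\widehat{\mathcal{W}}^s_{\mathbb{H}}:|W|\in[\delta,2\delta]\}$. For $\eta\in(0,1]$ let $\mathcal{D}_{a,\eta}(W)=\{\psi\in C^0(W):\psi>0,\ \psi(x)/\psi(y)\le e^{a\,d(x,y)^\eta}\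 \forall x,y\in W\}$. Define $$|||g|||_+=\sup_{\substack{W\in\mathcal{W}^s(\delta)\\\psi\in\mathcal{D}_{a,\beta}(W)}}\frac{|\int_Wg\psi|}{\int_W\psi},\qquad|||g|||_-=\inf_{\substack{W\in\mathcal{W}^s(\delta)\\\psi\in\mathcal{D}_{a,\beta}(W)}}\frac{\int_Wg\psi}{\int_W\psi}.$$ Let $\mathcal{A}$ be the set of real functions on $M$ whose restriction to each such curve is integrable with respect to arclength and for which $|||\cdot|||_+<\infty$. Then $\mathcal{C}_{c,A,L}(\delta)$ is the set of $g\in\mathcal{A}\setminus\{0\}$ such that: (i) $|||g|||_+\le L\,|||g|||_-$; (ii) $\sup_{W\in\mathcal{W}^s_-(\delta)}\sup_{\psi\in\mathcal{D}_{a,\beta}(W)}|W|^{-q}\dfrac{|\int_Wg\psi|}{\fint_W\psi}\le A\,\delta^{1-q}\,|||g|||_-$; (iii) for all $W^1,W^2\in\mathcal{W}^s_-(\delta)$ with $d_{\mathcal{W}^s}(W^1,W^2)\le\delta$ and all $\psi_i\in\mathcal{D}_{a,\alpha}(W^i)$ with $d_*(\psi_1,\psi_2)=0$, $$\left|\frac{\int_{W^1}g\psi_1}{\fint_{W^1}\psi_1}-\frac{\int_{W^2}g\psi_2}{\fint_{W^2}\psi_2}\right|\le d_{\mathcal{W}^s}(W^1,W^2)^\gamma\,\delta^{1-\gamma}\,c\,A\,|||g|||_-.$$ **Order and norm.** Write $f\preceq g$ iff $g-f\in\mathcal{C}_{c,A,L}(\delta)\cup\{0\}$. With the constant function $1$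 as reference element, $\|g\|_*=\inf\{\lambda>0:-\lambda\preceq g\preceq\lambda\}$ for $g\in C^1(M)$. *)

theory Defs
  imports "HOL-Analysis.Analysis"
begin

section \<open>Billiard tables and phase space\<close>

text \<open>The torus is the plane, identified with the complex numbers, modulo the lattice
  \<open>int_lattice\<close>; a scatterer is given by one of its lifts \<open>B i\<close> to the plane, and \<open>\<Gamma> i\<close> is the
  counterclockwise parametrisation of its boundary by arclength.\<close>

definition int_lattice :: "complex set" where
  "int_lattice = {z. Re z \<in> \<int> \<and> Im z \<in> \<int>}"

definition scatterer :: "real \<Rightarrow> real \<Rightarrow> real \<Rightarrow> complex set \<Rightarrow> (real \<Rightarrow> complex) \<Rightarrow> bool" where
  "scatterer K E len B \<Gamma> \<longleftrightarrow>
     compact B \<and> interior B \<noteq> {} \<and>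
     (\<forall>x\<in>B. \<forall>y\<in>B. x \<noteq> y \<longrightarrow> open_segment x y \<subseteq> interior B) \<and>
     len > 0 \<and> (\<forall>s. \<Gamma> (s + len) = \<Gamma> s) \<and> inj_on \<Gamma> {0..<len} \<and> range \<Gamma> = frontier B \<and>
     (\<exists>\<Gamma>1 \<Gamma>2 \<Gamma>3.
        (\<forall>s. (\<Gamma> has_vector_derivative \<Gamma>1 s) (at s) \<and>
             (\<Gamma>1 has_vector_derivative \<Gamma>2 s) (at s) \<and>
             (\<Gamma>2 has_vector_derivative \<Gamma>3 s) (at s) \<and>
             norm (\<Gamma>1 s) = 1 \<and>
             K < Im (cnj (\<Gamma>1 s) * \<Gamma>2 s) \<and> Im (cnj (\<Gamma>1 s) * \<Gamma>2 s) < 1 / K \<and>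
             norm (\<Gamma>3 s) \<le> E) \<and>
        continuous_on UNIV \<Gamma>3)"

definition dispersing_table ::
  "nat \<Rightarrow> (nat \<Rightarrow> real) \<Rightarrow> real \<Rightarrow> real \<Rightarrow> real
     \<Rightarrow> (nat \<Rightarrow> complex set) \<Rightarrow> (nat \<Rightarrow> real \<Rightarrow> complex) \<Rightarrow> bool" where
  "dispersing_table n l \<tau> K E B \<Gamma> \<longleftrightarrow>
     (\<forall>i<n. scatterer K E (l i) (B i) (\<Gamma> i)) \<and>
     (\<forall>i<n. \<forall>w\<in>int_lattice. w \<noteq> 0 \<longrightarrow> (+) w ` B i \<inter> B i = {}) \<and>
     (\<forall>i<n. \<forall>j<n. \<forall>w\<in>int_lattice. i \<noteq> j \<longrightarrow> setdist (B i) ((+) w ` B j) > \<tau>) \<and>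
     (\<exists>R. \<forall>x u. norm u = 1 \<longrightarrow>
        (\<exists>t\<in>{0..R}. \<exists>i<n. \<exists>w\<in>int_lattice. x + t *\<^sub>R u \<in> (+) w ` B i))"

text \<open>A point of the phase space is \<open>(i, r, \<phi>)\<close>, where \<open>i\<close> is the number of the scatterer.\<close>

type_synonym pt = "nat \<times> real \<times> real"

definition phase_space :: "nat \<Rightarrow> (nat \<Rightarrow> real) \<Rightarrow> pt set" where
  "phase_space n l = {(i, r, \<phi>). i < n \<and> r \<in> {0..<l i} \<and> \<phi> \<in> {-(pi/2)..pi/2}}"

text \<open>Since \<open>r\<close> is arclength on a closed curve, a \<open>C\<^sup>1\<close> function on the phase space is, on each
  component, \<open>C\<^sup>1\<close> up to \<open>\<phi> = \<plusminus>\<pi>/2\<close> and continues \<open>l i\<close>-periodically in \<open>r\<close>. Functions on the phase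
  space are total functions whose values outside \<open>phase_space n l\<close> are irrelevant.\<close>

definition C1_fun :: "nat \<Rightarrow> (nat \<Rightarrow> real) \<Rightarrow> (pt \<Rightarrow> real) set" where
  "C1_fun n l = {g. \<forall>i<n. \<exists>(h :: real \<times> real \<Rightarrow> real) (D :: real \<times> real \<Rightarrow> (real \<times> real) \<Rightarrow>\<^sub>L real).
     (\<forall>r \<phi>. h (r + l i, \<phi>) = h (r, \<phi>)) \<and>
     (\<forall>r\<in>{0..<l i}. \<forall>\<phi>\<in>{-(pi/2)..pi/2}. g (i, r, \<phi>) = h (r, \<phi>)) \<and>
     (\<forall>x\<in>UNIV \<times> {-(pi/2)..pi/2}.
        (h has_derivative blinfun_apply (D x)) (at x within UNIV \<times> {-(pi/2)..pi/2})) \<and>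
     continuous_on (UNIV \<times> {-(pi/2)..pi/2}) D}"


section \<open>Stable curves\<close>

text \<open>The curve \<open>Curve i a b \<phi>\<close> is the graph of \<open>\<phi>\<close> over the interval \<open>[a, b]\<close> in the component
  \<open>i\<close>.\<close>

datatype curve = Curve (scat: nat) (lo: real) (hi: real) (height: "real \<Rightarrow> real")

definition base :: "curve \<Rightarrow> real set" where
  "base W = {lo W..hi W}"

definition graph_pt :: "curve \<Rightarrow> real \<Rightarrow> pt" where
  "graph_pt W r = (scat W, r, height W r)"

definition curve_set :: "curve \<Rightarrow> pt set" where
  "curve_set W = graph_pt W ` base W"

definition slope :: "curve \<Rightarrow> real \<Rightarrow> real" where
  "slope W r = vector_derivative (height W) (at r within base W)"

definition speed :: "curve \<Rightarrow> real \<Rightarrow> real" where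
  "speed W r = sqrt (1 + (slope W r)\<^sup>2)"

definition curve_len :: "curve \<Rightarrow> real" where
  "curve_len W = integral (base W) (speed W)"

definition arc_dist :: "curve \<Rightarrow> real \<Rightarrow> real \<Rightarrow> real" where
  "arc_dist W r s = integral {min r s..max r s} (speed W)"

definition curve_int :: "curve \<Rightarrow> (pt \<Rightarrow> real) \<Rightarrow> real" where
  "curve_int W f = integral (base W) (\<lambda>r. f (graph_pt W r) * speed W r)"

definition curve_avg :: "curve \<Rightarrow> (pt \<Rightarrow> real) \<Rightarrow> real" where
  "curve_avg W f = curve_int W f / curve_len W"

text \<open>\<open>stable_curves n l \<tau> K \<delta>0 \<kappa>\<close>: curves of positive length at most \<open>\<delta>0\<close> in the stable cone
  given by \<open>\<tau>\<close> and \<open>K\<close>, with curvature at most \<open>\<kappa>\<close>. A curve meeting the seam \<open>r = 0\<close> of a component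
  in its interior is split there. The bound \<open>\<kappa>\<close> is a free parameter; values for which the family
  is invariant, up to subdivision, under the inverse billiard maps are included.\<close>

definition stable_curves ::
  "nat \<Rightarrow> (nat \<Rightarrow> real) \<Rightarrow> real \<Rightarrow> real \<Rightarrow> real \<Rightarrow> real \<Rightarrow> curve set" where
  "stable_curves n l \<tau> K \<delta>0 \<kappa> = {W.
     lo W < hi W \<and> curve_set W \<subseteq> phase_space n l \<and> curve_len W \<le> \<delta>0 \<and>
     (\<exists>d1 d2.
        (\<forall>r\<in>base W.
           (height W has_real_derivative d1 r) (at r within base W) \<and>
           (d1 has_real_derivative d2 r) (at r within base W) \<and>
           - (1/K) - 1/\<tau> \<le> d1 r \<and> d1 r \<le> - K \<and>
           \<bar>d2 r\<bar> / (1 + (d1 r)\<^sup>2) powr (3/2) \<le> \<kappa>) \<and>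
        continuous_on (base W) d2)}"

definition homogeneity_strips ::
  "nat \<Rightarrow> (nat \<Rightarrow> real) \<Rightarrow> real \<Rightarrow> nat \<Rightarrow> pt set set" where
  "homogeneity_strips n l q0 k0 =
     {{(i, r, \<phi>) \<in> phase_space n l. \<bar>\<phi>\<bar> \<le> pi/2 - real k0 powr (- q0)}} \<union>
     (\<Union>k\<in>{k0..}.
        {{(i, r, \<phi>) \<in> phase_space n l.
            real (k + 1) powr (- q0) \<le> pi/2 - \<phi> \<and> pi/2 - \<phi> \<le> real k powr (- q0)},
         {(i, r, \<phi>) \<in> phase_space n l.
            real (k + 1) powr (- q0) \<le> pi/2 + \<phi> \<and> pi/2 + \<phi> \<le> real k powr (- q0)}})"

definition homogeneous_curves :: "pt set set \<Rightarrow> curve set \<Rightarrow> curve set" where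
  "homogeneous_curves H \<W> = {W \<in> \<W>. \<exists>S\<in>H. curve_set W \<subseteq> S}"


section \<open>Distances\<close>

text \<open>The supremum norm over an empty set is 0.\<close>

definition C0_norm :: "real set \<Rightarrow> (real \<Rightarrow> real) \<Rightarrow> ereal" where
  "C0_norm S f = Sup (insert 0 ((\<lambda>r. ereal \<bar>f r\<bar>) ` S))"

text \<open>The phase space is the disjoint union of its components, so that the base intervals of curves
  in different components are disjoint.\<close>

definition overlap :: "curve \<Rightarrow> curve \<Rightarrow> real set" where
  "overlap W1 W2 = (if scat W1 = scat W2 then base W1 \<inter> base W2 else {})"

definition sym_diff_measure :: "curve \<Rightarrow> curve \<Rightarrow> real" where
  "sym_diff_measure W1 W2 =
     (if scat W1 = scat W2
      then measure lebesgue ((base W1 - base W2) \<union> (base W2 - base W1))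
      else measure lebesgue (base W1) + measure lebesgue (base W2))"

definition dist_Ws :: "pt set set \<Rightarrow> curve \<Rightarrow> curve \<Rightarrow> ereal" where
  "dist_Ws H W1 W2 =
     (if \<exists>S\<in>H. curve_set W1 \<subseteq> S \<and> curve_set W2 \<subseteq> S
      then ereal (sym_diff_measure W1 W2)
           + (C0_norm (overlap W1 W2) (\<lambda>r. height W1 r - height W2 r)
              + C0_norm (overlap W1 W2) (\<lambda>r. slope W1 r - slope W2 r))
      else \<infinity>)"

definition dist_0 :: "curve \<Rightarrow> curve \<Rightarrow> (pt \<Rightarrow> real) \<Rightarrow> (pt \<Rightarrow> real) \<Rightarrow> ereal" where
  "dist_0 W1 W2 \<psi>1 \<psi>2 =
     C0_norm (overlap W1 W2) (\<lambda>r. \<psi>1 (graph_pt W1 r) - \<psi>2 (graph_pt W2 r))"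

definition dist_star :: "curve \<Rightarrow> curve \<Rightarrow> (pt \<Rightarrow> real) \<Rightarrow> (pt \<Rightarrow> real) \<Rightarrow> ereal" where
  "dist_star W1 W2 \<psi>1 \<psi>2 =
     C0_norm (overlap W1 W2)
       (\<lambda>r. \<psi>1 (graph_pt W1 r) * speed W1 r - \<psi>2 (graph_pt W2 r) * speed W2 r)"


section \<open>The Banach space\<close>

definition holder_norm :: "curve \<Rightarrow> real \<Rightarrow> (pt \<Rightarrow> real) \<Rightarrow> ereal" where
  "holder_norm W \<eta> \<psi> =
     (SUP r\<in>base W. ereal \<bar>\<psi> (graph_pt W r)\<bar>) +
     (SUP (r, s)\<in>{(r, s). r \<in> base W \<and> s \<in> base W \<and> r \<noteq> s}.
        ereal (\<bar>\<psi> (graph_pt W r) - \<psi> (graph_pt W s)\<bar> / arc_dist W r s powr \<eta>))"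

text \<open>In the following, \<open>H\<close> is the set of homogeneity strips and \<open>\<W>\<close> a set of curves.\<close>

definition norm_s :: "curve set \<Rightarrow> real \<Rightarrow> real \<Rightarrow> (pt \<Rightarrow> real) \<Rightarrow> ereal" where
  "norm_s \<W> \<beta> p g =
     (SUP W\<in>\<W>. SUP \<psi>\<in>{\<psi>. holder_norm W \<beta> \<psi> \<le> ereal (curve_len W powr (- (1/p)))}.
        ereal (curve_int W (\<lambda>x. g x * \<psi> x)))"

definition norm_u ::
  "pt set set \<Rightarrow> curve set \<Rightarrow> real \<Rightarrow> real \<Rightarrow> real \<Rightarrow> (pt \<Rightarrow> real) \<Rightarrow> ereal" where
  "norm_u H \<W> \<alpha> \<gamma> \<epsilon>0 g =
     (SUP \<epsilon>\<in>{0<..\<epsilon>0}.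
      SUP (W1, W2)\<in>{(W1, W2). W1 \<in> \<W> \<and> W2 \<in> \<W> \<and> dist_Ws H W1 W2 \<le> ereal \<epsilon>}.
      SUP (\<psi>1, \<psi>2)\<in>{(\<psi>1, \<psi>2). holder_norm W1 \<alpha> \<psi>1 \<le> 1 \<and> holder_norm W2 \<alpha> \<psi>2 \<le> 1 \<and>
                                dist_0 W1 W2 \<psi>1 \<psi>2 = 0}.
        ereal (\<epsilon> powr (- \<gamma>) *
          \<bar>curve_int W1 (\<lambda>x. g x * \<psi>1 x) - curve_int W2 (\<lambda>x. g x * \<psi>2 x)\<bar>))"

definition norm_B ::
  "pt set set \<Rightarrow> curve set \<Rightarrow> real \<Rightarrow> real \<Rightarrow> real \<Rightarrow> real \<Rightarrow> real \<Rightarrow> real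
     \<Rightarrow> (pt \<Rightarrow> real) \<Rightarrow> ereal" where
  "norm_B H \<W> \<alpha> \<beta> \<gamma> p \<epsilon>0 cu g = norm_s \<W> \<beta> p g + ereal cu * norm_u H \<W> \<alpha> \<gamma> \<epsilon>0 g"

text \<open>\<open>X\<close>, a closed subspace of a Banach space, together with \<open>\<iota>\<close>, is a completion of the space \<open>V\<close> of
  functions with respect to the norm \<open>N\<close>.\<close>

definition is_completion ::
  "(pt \<Rightarrow> real) set \<Rightarrow> ((pt \<Rightarrow> real) \<Rightarrow> ereal) \<Rightarrow> ((pt \<Rightarrow> real) \<Rightarrow> 'b::banach) \<Rightarrow> 'b set \<Rightarrow> bool" where
  "is_completion V N \<iota> X \<longleftrightarrow>
     (\<forall>f\<in>V. \<forall>g\<in>V. \<iota> (\<lambda>x. f x + g x) = \<iota> f + \<iota> g) \<and>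
     (\<forall>c. \<forall>g\<in>V. \<iota> (\<lambda>x. c * g x) = c *\<^sub>R \<iota> g) \<and>
     (\<forall>g\<in>V. ereal (norm (\<iota> g)) = N g) \<and>
     X = closure (\<iota> ` V)"


section \<open>The cone, its order and its norm\<close>

definition short_curves :: "curve set \<Rightarrow> real \<Rightarrow> curve set" where
  "short_curves \<W> \<delta> = {W \<in> \<W>. curve_len W \<le> 2 * \<delta>}"

definition scale_curves :: "curve set \<Rightarrow> real \<Rightarrow> curve set" where
  "scale_curves \<W> \<delta> = {W \<in> \<W>. \<delta> \<le> curve_len W \<and> curve_len W \<le> 2 * \<delta>}"

definition test_densities :: "real \<Rightarrow> real \<Rightarrow> curve \<Rightarrow> (pt \<Rightarrow> real) set" where
  "test_densities a \<eta> W = {\<psi>. continuous_on (curve_set W) \<psi> \<and> (\<forall>x\<in>curve_set W. \<psi> x > 0) \<and>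
     (\<forall>r\<in>base W. \<forall>s\<in>base W.
        \<psi> (graph_pt W r) / \<psi> (graph_pt W s) \<le> exp (a * arc_dist W r s powr \<eta>))}"

definition triple_plus :: "curve set \<Rightarrow> real \<Rightarrow> real \<Rightarrow> real \<Rightarrow> (pt \<Rightarrow> real) \<Rightarrow> ereal" where
  "triple_plus \<W> a \<beta> \<delta> g =
     (SUP W\<in>scale_curves \<W> \<delta>. SUP \<psi>\<in>test_densities a \<beta> W.
        ereal (\<bar>curve_int W (\<lambda>x. g x * \<psi> x)\<bar> / curve_int W \<psi>))"

definition triple_minus :: "curve set \<Rightarrow> real \<Rightarrow> real \<Rightarrow> real \<Rightarrow> (pt \<Rightarrow> real) \<Rightarrow> ereal" where
  "triple_minus \<W> a \<beta> \<delta> g =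
     (INF W\<in>scale_curves \<W> \<delta>. INF \<psi>\<in>test_densities a \<beta> W.
        ereal (curve_int W (\<lambda>x. g x * \<psi> x) / curve_int W \<psi>))"

definition cone_domain :: "curve set \<Rightarrow> real \<Rightarrow> real \<Rightarrow> real \<Rightarrow> (pt \<Rightarrow> real) set" where
  "cone_domain \<W> a \<beta> \<delta> = {g.
     (\<forall>W\<in>short_curves \<W> \<delta>.
        (\<lambda>r. g (graph_pt W r) * speed W r) absolutely_integrable_on base W) \<and>
     triple_plus \<W> a \<beta> \<delta> g < \<infinity>}"

text \<open>\<open>M\<close> is the phase space; the condition \<open>\<exists>x\<in>M. g x \<noteq> 0\<close> says that \<open>g\<close> is not the zero function on
  \<open>M\<close>.\<close>

definition billiard_cone ::
  "pt set \<Rightarrow> pt set set \<Rightarrow> curve set \<Rightarrow> real \<Rightarrow> real \<Rightarrow> real \<Rightarrow> real \<Rightarrow> real \<Rightarrow> real \<Rightarrow> real \<Rightarrow> real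
     \<Rightarrow> real \<Rightarrow> (pt \<Rightarrow> real) set" where
  "billiard_cone M H \<W> \<alpha> \<beta> \<gamma> q a c A L \<delta> = {g \<in> cone_domain \<W> a \<beta> \<delta>.
     (\<exists>x\<in>M. g x \<noteq> 0) \<and>
     triple_plus \<W> a \<beta> \<delta> g \<le> ereal L * triple_minus \<W> a \<beta> \<delta> g \<and>
     (SUP W\<in>short_curves \<W> \<delta>. SUP \<psi>\<in>test_densities a \<beta> W.
        ereal (curve_len W powr (- q) * (\<bar>curve_int W (\<lambda>x. g x * \<psi> x)\<bar> / curve_avg W \<psi>)))
       \<le> ereal (A * \<delta> powr (1 - q)) * triple_minus \<W> a \<beta> \<delta> g \<and>
     (\<forall>W1\<in>short_curves \<W> \<delta>. \<forall>W2\<in>short_curves \<W> \<delta>. dist_Ws H W1 W2 \<le> ereal \<delta> \<longrightarrow>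
        (\<forall>\<psi>1\<in>test_densities a \<alpha> W1. \<forall>\<psi>2\<in>test_densities a \<alpha> W2. dist_star W1 W2 \<psi>1 \<psi>2 = 0 \<longrightarrow>
           ereal \<bar>curve_int W1 (\<lambda>x. g x * \<psi>1 x) / curve_avg W1 \<psi>1
                  - curve_int W2 (\<lambda>x. g x * \<psi>2 x) / curve_avg W2 \<psi>2\<bar>
             \<le> ereal (real_of_ereal (dist_Ws H W1 W2) powr \<gamma> * \<delta> powr (1 - \<gamma>) * c * A)
                * triple_minus \<W> a \<beta> \<delta> g))}"

definition cone_le :: "pt set \<Rightarrow> (pt \<Rightarrow> real) set \<Rightarrow> (pt \<Rightarrow> real) \<Rightarrow> (pt \<Rightarrow> real) \<Rightarrow> bool" where
  "cone_le M \<C> f g \<longleftrightarrow> (\<lambda>x. g x - f x) \<in> \<C> \<or> (\<forall>x\<in>M. g x - f x = 0)"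

definition norm_star :: "pt set \<Rightarrow> (pt \<Rightarrow> real) set \<Rightarrow> (pt \<Rightarrow> real) \<Rightarrow> ereal" where
  "norm_star M \<C> g =
     Inf {ereal t | t. t > 0 \<and> cone_le M \<C> (\<lambda>_. - t) g \<and> cone_le M \<C> g (\<lambda>_. t)}"

end

theory Submission
  imports Defs
begin

text \<open>
  Both norms measure a function \<open>g\<close> by its integrals along short stable curves, and they are compared
  through a common intermediate description. On a segment of a curve above a base interval
  \<open>{x..y}\<close>, test functions are functions \<open>u\<close> of the base coordinate. The stable bound says that
  \<open>\<bar>\<integral> g u\<bar> \<le> b B (y - x)\<^bsup>1/p\<^esup>\<close> when \<open>u\<close> has \<open>\<beta>\<close>-Hoelder norm \<open>B\<close>; the unstable bound says that
  the integrals of \<open>g u\<close> over two curves above the same interval at distance \<open>\<epsilon>\<close> differ by at most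
  \<open>b B \<epsilon>\<^bsup>\<gamma>\<^esup>\<close> when \<open>u\<close> has \<open>\<alpha>\<close>-Hoelder norm \<open>B\<close>. The anisotropic norm of \<open>g\<close> is, up to constants, the
  best such \<open>b\<close> (\<open>norm_B_imp_bounds\<close>, \<open>bounds_imp_norm_B\<close>): the parts of two neighbouring curves
  that do not lie above the common base have length at most of order \<open>\<epsilon>\<close>, so that by the stable
  bound they contribute a multiple of \<open>\<epsilon>\<^bsup>1/p\<^esup>\<close>, which is at most of order \<open>\<epsilon>\<^bsup>\<gamma>\<^esup>\<close> because \<open>\<gamma> < 1/p\<close>.

  If \<open>g\<close> satisfies both bounds with constant \<open>b\<close>, then \<open>t + g\<close> lies in the cone for all \<open>t \<ge> C b\<close>
  (\<open>bounds_imp_cone_at\<close>). The constant function satisfies the three cone conditions with room to spare: its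
  averages are all equal, \<open>L > 1\<close>, \<open>2\<^bsup>1 - q\<^esup> < A\<close>, and the lengths of curves at distance \<open>d\<close> differ by
  at most \<open>(1 + C\<^sub>s) d\<close>, while \<open>1 + C\<^sub>s < A c\<close>. It remains to see that \<open>g\<close> contributes \<open>O(b)\<close> to each
  condition. For the third one, two densities are matched together with the arclength elements, whereas
  the unstable bound compares equal test functions. The correction by the ratio of the arclength
  elements is \<open>O(\<epsilon>)\<close> in the sup norm and \<open>O(1)\<close> in the Lipschitz norm, hence
  \<open>O(\<epsilon>\<^bsup>1 - \<beta>\<^esup>)\<close> in the \<open>\<beta>\<close>-Hoelder norm, and \<open>\<gamma> < 1 - \<beta>\<close>; the normalising averages agree up
  to a factor \<open>1 + O(\<epsilon> / length)\<close>, which the stable bound absorbs.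

  Conversely let \<open>t + g\<close> and \<open>t - g\<close> lie in the cone (\<open>cone_at_imp_bounds\<close>). Their infima
  \<open>|||\<cdot>|||\<^sub>-\<close> add up to at most \<open>2 t\<close>, so that the cone conditions for both functions have right-hand
  sides of order \<open>t\<close>. A Hoelder test function becomes a density after adding a multiple of its norm,
  and \<open>g\<close> is half the difference of \<open>t + g\<close> and \<open>t - g\<close>; this gives both bounds for \<open>g\<close> with
  constant \<open>C t\<close> on curves of length at most \<open>2 \<delta>\<close>, and by repeated bisection on all curves.

  Together the two implications say that the order norm is equivalent to the anisotropic norm on
  functions of class \<open>C\<^sup>1\<close> (\<open>norm_star_equivalent\<close>). As the cone is closed under addition, the order
  norm satisfies the triangle inequality; being bounded by a multiple of the anisotropic norm it is
  Lipschitz, so that it extends to the completion together with the two inequalities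
  (\<open>extend_equivalent_norm\<close>).\<close>

section \<open>Hoelder functions of the base variable\<close>

text \<open>A single constant bounds the sup norm and the Hoelder constant. Up to a factor 2 this is the usual
  norm, and products, restrictions and changes of the exponent are tracked by one number.\<close>

definition holder_on :: "real set \<Rightarrow> real \<Rightarrow> real \<Rightarrow> (real \<Rightarrow> real) \<Rightarrow> bool" where
  "holder_on X \<eta> B u \<longleftrightarrow>
     (\<forall>r\<in>X. \<bar>u r\<bar> \<le> B) \<and> (\<forall>r\<in>X. \<forall>s\<in>X. \<bar>u r - u s\<bar> \<le> B * \<bar>r - s\<bar> powr \<eta>)"

lemma holder_onI:
  assumes "\<And>r. r \<in> X \<Longrightarrow> \<bar>u r\<bar> \<le> B"
    and "\<And>r s. r \<in> X \<Longrightarrow> s \<in> X \<Longrightarrow> \<bar>u r - u s\<bar> \<le> B * \<bar>r - s\<bar> powr \<eta>"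
  shows "holder_on X \<eta> B u"
  using assms by (auto simp: holder_on_def)

lemma holder_onD:
  assumes "holder_on X \<eta> B u"
  shows holder_on_bound: "r \<in> X \<Longrightarrow> \<bar>u r\<bar> \<le> B"
    and holder_on_diff: "r \<in> X \<Longrightarrow> s \<in> X \<Longrightarrow> \<bar>u r - u s\<bar> \<le> B * \<bar>r - s\<bar> powr \<eta>"
  using assms by (auto simp: holder_on_def)

lemma holder_on_nonneg:
  assumes "holder_on X \<eta> B u" "X \<noteq> {}"
  shows "0 \<le> B"
proof -
  obtain r where "r \<in> X" using assms(2) by blast
  from holder_on_bound[OF assms(1) this] show ?thesis by linarith
qed

lemma holder_on_subset: "holder_on X \<eta> B u \<Longrightarrow> Y \<subseteq> X \<Longrightarrow> holder_on Y \<eta> B u"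
  by (auto simp: holder_on_def)

lemma holder_on_scale:
  assumes "holder_on X \<eta> B u"
  shows "holder_on X \<eta> (\<bar>k\<bar> * B) (\<lambda>r. k * u r)"
proof (rule holder_onI)
  fix r s assume rs: "r \<in> X" "s \<in> X"
  have "\<bar>k * u r - k * u s\<bar> = \<bar>k\<bar> * \<bar>u r - u s\<bar>"
    by (simp add: abs_mult flip: right_diff_distrib)
  also have "\<dots> \<le> \<bar>k\<bar> * (B * \<bar>r - s\<bar> powr \<eta>)"
    using holder_on_diff[OF assms rs] by (intro mult_left_mono) auto
  finally show "\<bar>k * u r - k * u s\<bar> \<le> \<bar>k\<bar> * B * \<bar>r - s\<bar> powr \<eta>" by simp
next
  fix r assume "r \<in> X"
  then show "\<bar>k * u r\<bar> \<le> \<bar>k\<bar> * B"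
    using holder_on_bound[OF assms] by (auto simp: abs_mult intro!: mult_left_mono)
qed

lemma holder_on_add_const:
  assumes "holder_on X \<eta> B u" "k \<ge> 0"
  shows "holder_on X \<eta> (B + k) (\<lambda>r. u r + k)"
proof (rule holder_onI)
  fix r s assume rs: "r \<in> X" "s \<in> X"
  have "\<bar>u r + k - (u s + k)\<bar> \<le> B * \<bar>r - s\<bar> powr \<eta>"
    using holder_on_diff[OF assms(1) rs] by simp
  also have "\<dots> \<le> (B + k) * \<bar>r - s\<bar> powr \<eta>" using assms by (intro mult_right_mono) auto
  finally show "\<bar>u r + k - (u s + k)\<bar> \<le> (B + k) * \<bar>r - s\<bar> powr \<eta>" .
next
  fix r assume "r \<in> X"
  then show "\<bar>u r + k\<bar> \<le> B + k" using holder_on_bound[OF assms(1)] assms(2) by force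
qed

lemma holder_on_mult:
  assumes u: "holder_on X \<eta> B1 u" and v: "holder_on X \<eta> B2 v"
  shows "holder_on X \<eta> (2 * B1 * B2) (\<lambda>r. u r * v r)"
proof (cases "X = {}")
  case False
  then have B: "0 \<le> B1" "0 \<le> B2" using u v by (auto intro: holder_on_nonneg)
  show ?thesis
  proof (rule holder_onI)
    fix r s assume rs: "r \<in> X" "s \<in> X"
    have "\<bar>u r * v r - u s * v s\<bar> = \<bar>u r * (v r - v s) + v s * (u r - u s)\<bar>"
      by (simp add: algebra_simps)
    also have "\<dots> \<le> \<bar>u r\<bar> * \<bar>v r - v s\<bar> + \<bar>v s\<bar> * \<bar>u r - u s\<bar>"
      by (metis abs_mult abs_triangle_ineq)
    also have "\<dots> \<le> B1 * (B2 * \<bar>r - s\<bar> powr \<eta>) + B2 * (B1 * \<bar>r - s\<bar> powr \<eta>)"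
      using rs B by (intro add_mono mult_mono holder_on_diff[OF u] holder_on_diff[OF v]
          holder_on_bound[OF u] holder_on_bound[OF v]) auto
    finally show "\<bar>u r * v r - u s * v s\<bar> \<le> 2 * B1 * B2 * \<bar>r - s\<bar> powr \<eta>" by simp
  next
    fix r assume r: "r \<in> X"
    have "\<bar>u r * v r\<bar> \<le> B1 * B2"
      unfolding abs_mult using r B by (intro mult_mono holder_on_bound[OF u] holder_on_bound[OF v]) auto
    then show "\<bar>u r * v r\<bar> \<le> 2 * B1 * B2" using B mult_nonneg_nonneg[OF B] by linarith
  qed
qed (auto simp: holder_on_def)

lemma powr_add_split:
  fixes x :: real
  assumes "0 \<le> x" "0 < \<beta>"
  shows "x powr \<eta> = x powr \<beta> * x powr (\<eta> - \<beta>)"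
  using assms by (cases "x = 0") (auto simp flip: powr_add)

lemma powr_le_of_le_one_exponent:
  fixes x D :: real
  assumes "0 \<le> x" "x \<le> D" "1 \<le> D" "0 \<le> \<eta>" "\<eta> \<le> 1"
  shows "x powr \<eta> \<le> D"
proof -
  have "x powr \<eta> \<le> D powr \<eta>" using assms by (intro powr_mono2) auto
  also have "\<dots> \<le> D powr 1" using assms by (intro powr_mono) auto
  finally show ?thesis using assms by simp
qed

lemma holder_on_lower_exponent:
  assumes u: "holder_on X \<eta> B u" and "0 < \<beta>" "\<beta> \<le> \<eta>" "\<eta> \<le> 1" "1 \<le> D"
    and diam: "\<And>r s. r \<in> X \<Longrightarrow> s \<in> X \<Longrightarrow> \<bar>r - s\<bar> \<le> D"
  shows "holder_on X \<beta> (B * D) u"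
proof (cases "X = {}")
  case False
  then have B: "0 \<le> B" using u by (auto intro: holder_on_nonneg)
  show ?thesis
  proof (rule holder_onI)
    fix r s assume rs: "r \<in> X" "s \<in> X"
    have "\<bar>u r - u s\<bar> \<le> B * (\<bar>r - s\<bar> powr \<beta> * \<bar>r - s\<bar> powr (\<eta> - \<beta>))"
      using holder_on_diff[OF u rs] powr_add_split[of "\<bar>r - s\<bar>" \<beta> \<eta>] \<open>0 < \<beta>\<close> by simp
    also have "\<dots> \<le> B * (\<bar>r - s\<bar> powr \<beta> * D)"
      using assms B diam[OF rs]
      by (intro mult_left_mono powr_le_of_le_one_exponent) auto
    finally show "\<bar>u r - u s\<bar> \<le> B * D * \<bar>r - s\<bar> powr \<beta>" by (simp add: mult_ac)
  next
    fix r assume r: "r \<in> X"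
    show "\<bar>u r\<bar> \<le> B * D"
      using holder_on_bound[OF u r] mult_left_mono[OF \<open>1 \<le> D\<close> B] by linarith
  qed
qed (auto simp: holder_on_def)

lemma holder_on_imp_continuous_on:
  assumes u: "holder_on X \<eta> B u" and "0 < \<eta>"
  shows "continuous_on X u"
  unfolding continuous_on_def
proof
  fix s assume s: "s \<in> X"
  have "((\<lambda>r. B * \<bar>r - s\<bar> powr \<eta>) \<longlongrightarrow> B * \<bar>s - s\<bar> powr \<eta>) (at s within X)"
    using \<open>0 < \<eta>\<close> by (intro tendsto_intros) auto
  then have "((\<lambda>r. B * \<bar>r - s\<bar> powr \<eta>) \<longlongrightarrow> 0) (at s within X)" by simp
  moreover have "\<forall>\<^sub>F r in at s within X. norm (u r - u s) \<le> B * \<bar>r - s\<bar> powr \<eta>"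
    using holder_on_diff[OF u _ s] by (auto simp: eventually_at intro!: exI[of _ 1])
  ultimately have "((\<lambda>r. u r - u s) \<longlongrightarrow> 0) (at s within X)"
    by (rule Lim_null_comparison[rotated])
  then show "(u \<longlongrightarrow> u s) (at s within X)" by (simp add: LIM_zero_iff)
qed

text \<open>The increments are bounded by the smaller one of \<open>\<epsilon>\<close> and \<open>\<bar>r - s\<bar>\<close>, up to a factor, and the smaller
  of two numbers is at most any weighted geometric mean of them. In this way \<open>C\<^sup>1\<close>-closeness of curves
  makes a Hoelder norm small, at the cost of the power \<open>1 - \<beta>\<close>.\<close>

lemma holder_on_interpolate:
  assumes bound: "\<And>r. r \<in> X \<Longrightarrow> \<bar>u r\<bar> \<le> \<epsilon>"
    and lip: "\<And>r s. r \<in> X \<Longrightarrow> s \<in> X \<Longrightarrow> \<bar>u r - u s\<bar> \<le> 2 * \<Lambda> * \<bar>r - s\<bar>"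
    and "0 < \<epsilon>" "\<epsilon> \<le> 1" "1 \<le> \<Lambda>" "0 < \<beta>" "\<beta> \<le> 1"
  shows "holder_on X \<beta> (2 * \<Lambda> * \<epsilon> powr (1 - \<beta>)) u"
proof (rule holder_onI)
  fix r assume r: "r \<in> X"
  have "\<epsilon> = \<epsilon> powr 1" using assms by simp
  also have "\<dots> \<le> \<epsilon> powr (1 - \<beta>)" using assms by (intro powr_mono') auto
  finally have "\<epsilon> \<le> 1 * \<epsilon> powr (1 - \<beta>)" by simp
  also have "\<dots> \<le> 2 * \<Lambda> * \<epsilon> powr (1 - \<beta>)" using assms by (intro mult_right_mono) auto
  finally show "\<bar>u r\<bar> \<le> 2 * \<Lambda> * \<epsilon> powr (1 - \<beta>)" using bound[OF r] by simp
next
  fix r s assume rs: "r \<in> X" "s \<in> X"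
  define x where "x = \<bar>r - s\<bar>"
  have x: "0 \<le> x" by (simp add: x_def)
  have min: "\<bar>u r - u s\<bar> \<le> 2 * \<Lambda> * min \<epsilon> x"
  proof (cases "\<epsilon> \<le> x")
    case True
    have "\<bar>u r - u s\<bar> \<le> 2 * \<epsilon>" using bound[OF rs(1)] bound[OF rs(2)] by simp
    also have "\<dots> \<le> 2 * \<Lambda> * \<epsilon>" using assms by simp
    finally show ?thesis using True by simp
  qed (use lip[OF rs] in \<open>simp add: x_def\<close>)
  have m: "0 \<le> min \<epsilon> x" using x assms by simp
  have "min \<epsilon> x = min \<epsilon> x powr (1 - \<beta>) * min \<epsilon> x powr \<beta>"
    using powr_add_split[OF m \<open>0 < \<beta>\<close>, of 1] m by (simp add: mult.commute)
  also have "\<dots> \<le> \<epsilon> powr (1 - \<beta>) * x powr \<beta>"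
    using assms m x by (intro mult_mono powr_mono2) auto
  finally have "2 * \<Lambda> * min \<epsilon> x \<le> 2 * \<Lambda> * (\<epsilon> powr (1 - \<beta>) * x powr \<beta>)"
    using assms by (intro mult_left_mono) auto
  then show "\<bar>u r - u s\<bar> \<le> 2 * \<Lambda> * \<epsilon> powr (1 - \<beta>) * \<bar>r - s\<bar> powr \<beta>"
    using min by (simp add: x_def mult_ac)
qed

lemma lipschitz_imp_holder_on:
  assumes bound: "\<And>r. r \<in> X \<Longrightarrow> \<bar>u r\<bar> \<le> \<Lambda>"
    and lip: "\<And>r s. r \<in> X \<Longrightarrow> s \<in> X \<Longrightarrow> \<bar>u r - u s\<bar> \<le> \<Lambda> * \<bar>r - s\<bar>"
    and diam: "\<And>r s. r \<in> X \<Longrightarrow> s \<in> X \<Longrightarrow> \<bar>r - s\<bar> \<le> 1"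
    and "0 < \<beta>" "\<beta> \<le> 1" 
  shows "holder_on X \<beta> \<Lambda> u"
proof -
  have "holder_on X 1 \<Lambda> u" using bound lip by (intro holder_onI) auto
  then show ?thesis using holder_on_lower_exponent[of X 1 \<Lambda> u \<beta> 1] assms by simp
qed

lemma powr_subunit_mono:
  fixes x :: real
  assumes "0 \<le> x" "x \<le> 1" "0 < \<beta>" "\<beta> \<le> \<eta>"
  shows "x powr \<eta> \<le> x powr \<beta>"
  using assms by (cases "x = 0") (auto intro: powr_mono')

section \<open>Stable curves as graphs\<close>

definition sub_curve :: "curve \<Rightarrow> real \<Rightarrow> real \<Rightarrow> curve" where
  "sub_curve W x y = Curve (scat W) x y (height W)"

lemma sub_curve_simps [simp]:
  "scat (sub_curve W x y) = scat W" "lo (sub_curve W x y) = x" "hi (sub_curve W x y) = y"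
  "height (sub_curve W x y) = height W" "graph_pt (sub_curve W x y) r = graph_pt W r"
  "base (sub_curve W x y) = {x..y}"
  by (auto simp: sub_curve_def graph_pt_def base_def)

text \<open>The lift depends on the base coordinate only, so that one function \<open>u\<close> is a test function on all
  curves above its domain at once.\<close>

definition lift :: "(real \<Rightarrow> real) \<Rightarrow> pt \<Rightarrow> real" where
  "lift u = (\<lambda>x. u (fst (snd x)))"

lemma lift_graph_pt [simp]: "lift u (graph_pt W r) = u r"
  by (simp add: lift_def graph_pt_def)

definition seg_int :: "curve \<Rightarrow> real \<Rightarrow> real \<Rightarrow> (pt \<Rightarrow> real) \<Rightarrow> (real \<Rightarrow> real) \<Rightarrow> real" where
  "seg_int W x y g u = integral {x..y} (\<lambda>r. g (graph_pt W r) * u r * speed W r)"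

lemma curve_int_eq_seg_int:
  "curve_int W (\<lambda>x. g x * \<psi> x) = seg_int W (lo W) (hi W) g (\<lambda>r. \<psi> (graph_pt W r))"
  by (simp add: curve_int_def seg_int_def base_def)

lemma curve_int_eq_seg_int_one:
  "curve_int W \<psi> = seg_int W (lo W) (hi W) (\<lambda>_. 1) (\<lambda>r. \<psi> (graph_pt W r))"
  by (simp add: curve_int_def seg_int_def base_def)

lemma sqrt_one_plus_square_lipschitz:
  fixes x y :: real
  shows "\<bar>sqrt (1 + x\<^sup>2) - sqrt (1 + y\<^sup>2)\<bar> \<le> \<bar>x - y\<bar>"
proof -
  define p q where "p = sqrt (1 + x\<^sup>2)" and "q = sqrt (1 + y\<^sup>2)"
  have pos: "0 < p" "0 < q" by (auto simp: p_def q_def add_pos_nonneg)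
  have p: "\<bar>x\<bar> \<le> p" unfolding p_def by (rule real_le_rsqrt) simp
  have q: "\<bar>y\<bar> \<le> q" unfolding q_def by (rule real_le_rsqrt) simp
  have "(p - q) * (p + q) = p\<^sup>2 - q\<^sup>2" by (simp add: power2_eq_square algebra_simps)
  also have "\<dots> = (x - y) * (x + y)"
    by (simp add: p_def q_def add_nonneg_nonneg power2_eq_square algebra_simps)
  finally have "\<bar>p - q\<bar> * (p + q) = \<bar>x - y\<bar> * \<bar>x + y\<bar>"
    using pos abs_mult[of "p - q" "p + q"] abs_mult[of "x - y" "x + y"] by simp
  also have "\<dots> \<le> \<bar>x - y\<bar> * (p + q)" using p q by (intro mult_left_mono) auto
  finally have "\<bar>p - q\<bar> \<le> \<bar>x - y\<bar>" using pos by (simp add: mult_le_cancel_right)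
  then show ?thesis by (simp add: p_def q_def)
qed

lemma speed_ge_one: "1 \<le> speed W r"
  by (simp add: speed_def)

lemma slope_sub_curve:
  assumes "(height W has_real_derivative d) (at r within base W)"
    and "lo W \<le> x" "x < y" "y \<le> hi W" "r \<in> {x..y}"
  shows "slope (sub_curve W x y) r = d"
proof -
  have "(height W has_real_derivative d) (at r within {x..y})"
    using assms by (auto intro: DERIV_subset simp: base_def)
  then have "(height W has_vector_derivative d) (at r within {x..y})"
    by (simp add: has_real_derivative_iff_has_vector_derivative)
  then show ?thesis
    using vector_derivative_within_closed_interval[of x y r "height W" d] assms(3,5)
    by (simp add: slope_def)
qed

text \<open>The constant \<open>D\<close> comes from the stable cone and \<open>\<Lambda>\<close> from the curvature bound. Closedness under
  restriction is what allows curves to be cut into pieces.\<close>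

locale curve_family =
  fixes H :: "pt set set" and \<W> :: "curve set" and D \<Lambda> :: real
  assumes lo_less_hi: "W \<in> \<W> \<Longrightarrow> lo W < hi W"
    and height_deriv: "W \<in> \<W> \<Longrightarrow> r \<in> base W \<Longrightarrow>
      (height W has_real_derivative slope W r) (at r within base W)"
    and slope_bound: "W \<in> \<W> \<Longrightarrow> r \<in> base W \<Longrightarrow> \<bar>slope W r\<bar> \<le> D"
    and slope_lipschitz: "W \<in> \<W> \<Longrightarrow> r \<in> base W \<Longrightarrow> s \<in> base W \<Longrightarrow>
      \<bar>slope W r - slope W s\<bar> \<le> \<Lambda> * \<bar>r - s\<bar>"
    and in_strip: "W \<in> \<W> \<Longrightarrow> \<exists>S\<in>H. curve_set W \<subseteq> S"
    and sub_curve_mem: "W \<in> \<W> \<Longrightarrow> lo W \<le> x \<Longrightarrow> x < y \<Longrightarrow> y \<le> hi W \<Longrightarrow> sub_curve W x y \<in> \<W>"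
    and \<Lambda>_ge_one: "1 \<le> \<Lambda>"
begin

text \<open>The constant \<open>C\<^sub>s\<close>, which bounds the arclength element and so compares arclength with base length.\<close>

definition \<sigma> :: real where "\<sigma> = sqrt (1 + D\<^sup>2)"

lemma \<sigma>_ge_one: "1 \<le> \<sigma>"
  by (simp add: \<sigma>_def)

lemma speed_le: "W \<in> \<W> \<Longrightarrow> r \<in> base W \<Longrightarrow> speed W r \<le> \<sigma>"
  using abs_le_square_iff[of "slope W r" D] slope_bound[of W r]
  by (simp add: \<sigma>_def speed_def)

lemma speed_lipschitz:
  assumes "W \<in> \<W>" "r \<in> base W" "s \<in> base W"
  shows "\<bar>speed W r - speed W s\<bar> \<le> \<Lambda> * \<bar>r - s\<bar>"
  using sqrt_one_plus_square_lipschitz[of "slope W r" "slope W s"] slope_lipschitz[OF assms]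
  unfolding speed_def by linarith

lemma speed_continuous_on: "W \<in> \<W> \<Longrightarrow> continuous_on (base W) (speed W)"
  by (rule lipschitz_on_continuous_on[of \<Lambda>])
     (use \<Lambda>_ge_one in \<open>auto simp: lipschitz_on_def dist_real_def intro: speed_lipschitz\<close>)

lemma graph_pt_continuous_on: "W \<in> \<W> \<Longrightarrow> continuous_on (base W) (graph_pt W)"
  unfolding graph_pt_def
  by (intro continuous_intros) (auto intro: DERIV_continuous_on height_deriv)

lemma speed_sub_curve:
  assumes "W \<in> \<W>" "lo W \<le> x" "x < y" "y \<le> hi W" "r \<in> {x..y}"
  shows "slope (sub_curve W x y) r = slope W r" "speed (sub_curve W x y) r = speed W r"
  using slope_sub_curve[OF height_deriv assms(2-5)] assms by (auto simp: speed_def base_def)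

lemma speed_integral_bounds:
  assumes "W \<in> \<W>" "lo W \<le> x" "x \<le> y" "y \<le> hi W"
  shows "y - x \<le> integral {x..y} (speed W)" "integral {x..y} (speed W) \<le> \<sigma> * (y - x)"
proof -
  have sub: "{x..y} \<subseteq> base W" using assms by (auto simp: base_def)
  have int: "speed W integrable_on {x..y}"
    using continuous_on_subset[OF speed_continuous_on[OF assms(1)] sub]
    by (rule integrable_continuous_real)
  have "integral {x..y} (\<lambda>_. 1) \<le> integral {x..y} (speed W)"
    by (intro integral_le int) (auto simp: speed_ge_one)
  then show "y - x \<le> integral {x..y} (speed W)" using assms by simp
  have "integral {x..y} (speed W) \<le> integral {x..y} (\<lambda>_. \<sigma>)"
    using sub by (intro integral_le int) (auto intro!: speed_le[OF assms(1)])
  then show "integral {x..y} (speed W) \<le> \<sigma> * (y - x)" using assms by (simp add: mult.commute)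
qed

lemma curve_len_bounds:
  assumes "W \<in> \<W>"
  shows "hi W - lo W \<le> curve_len W" "curve_len W \<le> \<sigma> * (hi W - lo W)" "0 < curve_len W"
  using speed_integral_bounds[of W "lo W" "hi W"] lo_less_hi[OF assms] assms
  by (auto simp: curve_len_def base_def)

lemma arc_dist_bounds:
  assumes "W \<in> \<W>" "r \<in> base W" "s \<in> base W"
  shows "\<bar>r - s\<bar> \<le> arc_dist W r s" "arc_dist W r s \<le> \<sigma> * \<bar>r - s\<bar>"
  using speed_integral_bounds[OF assms(1), of "min r s" "max r s"] assms(2,3)
  by (auto simp: arc_dist_def base_def min_def max_def abs_if)

text \<open>This class contains the functions of class \<open>C\<^sup>1\<close> and the constants, and is closed under the additions
  of constants that occur in the order.\<close>

definition curve_continuous :: "(pt \<Rightarrow> real) \<Rightarrow> bool" where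
  "curve_continuous g \<longleftrightarrow> (\<forall>W\<in>\<W>. continuous_on (base W) (\<lambda>r. g (graph_pt W r)))"

lemma curve_continuous_const [simp, intro]: "curve_continuous (\<lambda>_. k)"
  by (simp add: curve_continuous_def)

lemma curve_continuous_add [intro]:
  "curve_continuous f \<Longrightarrow> curve_continuous g \<Longrightarrow> curve_continuous (\<lambda>x. f x + g x)"
  by (auto simp: curve_continuous_def intro: continuous_on_add)

lemma curve_continuous_cmult [intro]:
  "curve_continuous g \<Longrightarrow> curve_continuous (\<lambda>x. k * g x)"
  by (auto simp: curve_continuous_def intro: continuous_on_mult)

definition segment :: "curve \<Rightarrow> real \<Rightarrow> real \<Rightarrow> bool" where
  "segment W x y \<longleftrightarrow> W \<in> \<W> \<and> lo W \<le> x \<and> x \<le> y \<and> y \<le> hi W"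

lemma segmentD:
  assumes "segment W x y"
  shows "W \<in> \<W>" "lo W \<le> x" "x \<le> y" "y \<le> hi W" "{x..y} \<subseteq> base W"
  using assms by (auto simp: segment_def base_def)

lemma segment_whole: "W \<in> \<W> \<Longrightarrow> segment W (lo W) (hi W)"
  using lo_less_hi by (force simp: segment_def)

lemma seg_integrand_continuous:
  assumes "segment W x y" "curve_continuous g" "continuous_on {x..y} u"
  shows "continuous_on {x..y} (\<lambda>r. g (graph_pt W r) * u r * speed W r)"
proof -
  note seg = segmentD[OF assms(1)]
  have "continuous_on {x..y} (\<lambda>r. g (graph_pt W r))"
    using assms(2) seg by (auto simp: curve_continuous_def intro: continuous_on_subset)
  then show ?thesis
    using assms(3) seg speed_continuous_on by (auto intro!: continuous_intros intro: continuous_on_subset)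
qed

lemma seg_integrable:
  assumes "segment W x y" "curve_continuous g" "continuous_on {x..y} u"
  shows "(\<lambda>r. g (graph_pt W r) * u r * speed W r) integrable_on {x..y}"
  using seg_integrand_continuous[OF assms] by (rule integrable_continuous_real)

lemma seg_int_add:
  assumes "segment W x y" "curve_continuous g" "continuous_on {x..y} u" "continuous_on {x..y} v"
  shows "seg_int W x y g (\<lambda>r. u r + v r) = seg_int W x y g u + seg_int W x y g v"
  using integral_add[OF seg_integrable[OF assms(1,2,3)] seg_integrable[OF assms(1,2,4)]]
  by (simp add: seg_int_def algebra_simps)

lemma seg_int_diff:
  assumes "segment W x y" "curve_continuous g" "continuous_on {x..y} u" "continuous_on {x..y} v"
  shows "seg_int W x y g (\<lambda>r. u r - v r) = seg_int W x y g u - seg_int W x y g v"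
  using integral_diff[OF seg_integrable[OF assms(1,2,3)] seg_integrable[OF assms(1,2,4)]]
  by (simp add: seg_int_def algebra_simps)

lemma seg_int_add_left:
  assumes "segment W x y" "curve_continuous f" "curve_continuous g" "continuous_on {x..y} u"
  shows "seg_int W x y (\<lambda>z. f z + g z) u = seg_int W x y f u + seg_int W x y g u"
  using integral_add[OF seg_integrable[OF assms(1,2,4)] seg_integrable[OF assms(1,3,4)]]
  by (simp add: seg_int_def algebra_simps)

lemma seg_int_cmult: "seg_int W x y g (\<lambda>r. k * u r) = k * seg_int W x y g u"
  unfolding seg_int_def by (simp only: mult.left_commute[of _ k] mult.assoc integral_mult_right)

lemma seg_int_cmult_left: "seg_int W x y (\<lambda>z. k * g z) u = k * seg_int W x y g u"
  unfolding seg_int_def by (simp only: mult.assoc integral_mult_right)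

lemma seg_int_cong:
  assumes "\<And>r. r \<in> {x..y} \<Longrightarrow> u r = v r"
  shows "seg_int W x y g u = seg_int W x y g v"
  using assms unfolding seg_int_def by (intro integral_cong) auto

lemma seg_int_trivial [simp]: "seg_int W x x g u = 0"
  by (simp add: seg_int_def)

lemma seg_int_split:
  assumes "segment W x y" "curve_continuous g" "continuous_on {x..y} u" "x \<le> z" "z \<le> y"
  shows "seg_int W x y g u = seg_int W x z g u + seg_int W z y g u"
  unfolding seg_int_def using Henstock_Kurzweil_Integration.integral_combine[OF assms(4,5) seg_integrable[OF assms(1-3)]] by simp

lemma seg_int_sub_curve:
  assumes "W \<in> \<W>" "lo W \<le> x" "x < y" "y \<le> hi W" "x \<le> x'" "y' \<le> y"
  shows "seg_int (sub_curve W x y) x' y' g u = seg_int W x' y' g u"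
  unfolding seg_int_def using assms
  by (intro integral_cong) (auto simp: speed_sub_curve)

lemma seg_int_one_mono:
  assumes "segment W x y" "continuous_on {x..y} u" "continuous_on {x..y} v"
    and "\<And>r. r \<in> {x..y} \<Longrightarrow> u r \<le> v r"
  shows "seg_int W x y (\<lambda>_. 1) u \<le> seg_int W x y (\<lambda>_. 1) v"
  unfolding seg_int_def
proof (intro integral_le)
  fix r assume "r \<in> {x..y}"
  then show "1 * u r * speed W r \<le> 1 * v r * speed W r"
    using assms(4) speed_ge_one[of W r] by (simp add: mult_right_mono)
qed (use seg_integrable[OF assms(1), of "\<lambda>_. 1"] assms in auto)

lemma seg_int_one_const:
  assumes "segment W x y" "0 \<le> k"
  shows "k * (y - x) \<le> seg_int W x y (\<lambda>_. 1) (\<lambda>_. k)"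
    "seg_int W x y (\<lambda>_. 1) (\<lambda>_. k) \<le> k * (\<sigma> * (y - x))"
  using speed_integral_bounds[of W x y] segmentD[OF assms(1)] assms(2)
  by (auto simp: seg_int_def intro!: mult_left_mono)

lemma seg_int_one_const_whole: "seg_int W (lo W) (hi W) (\<lambda>_. 1) (\<lambda>_. k) = k * curve_len W"
  by (simp add: seg_int_def curve_len_def base_def)

end

section \<open>Test densities\<close>

lemma exp_minus_one_le: "exp z - 1 \<le> z * exp (z::real)"
proof -
  have "(1 - z) * exp z \<le> exp (- z) * exp z"
    using exp_ge_add_one_self[of "- z"] by (intro mult_right_mono) auto
  then show ?thesis by (simp add: algebra_simps flip: exp_add)
qed

text \<open>The shifted function is at least \<open>(k - 1) B\<close>, so that its increments are small relative to its
  values. This turns Hoelder test functions into densities.\<close>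

lemma shifted_holder_ratio:
  assumes u: "holder_on X \<eta> B u" and "0 < B" "1 < k" "r \<in> X" "s \<in> X"
  shows "u r + k * B \<le> (u s + k * B) * exp (\<bar>r - s\<bar> powr \<eta> / (k - 1))"
proof -
  define x where "x = \<bar>r - s\<bar> powr \<eta>"
  have x: "0 \<le> x" by (simp add: x_def)
  have low: "(k - 1) * B \<le> u s + k * B"
    using holder_on_bound[OF u \<open>s \<in> X\<close>] by (simp add: algebra_simps)
  have nonneg: "0 \<le> u s + k * B"
    using low mult_pos_pos[of "k - 1" B] assms(2,3) by linarith
  have "u r + k * B \<le> (u s + k * B) + B * x"
    using holder_on_diff[OF u assms(4,5)] by (simp add: x_def)
  also have "B * x = ((k - 1) * B) * (x / (k - 1))" using assms by simp
  also have "\<dots> \<le> (u s + k * B) * (x / (k - 1))"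
    using low x assms by (intro mult_right_mono) auto
  also have "(u s + k * B) + \<dots> = (u s + k * B) * (1 + x / (k - 1))" by (simp add: algebra_simps)
  also have "\<dots> \<le> (u s + k * B) * exp (x / (k - 1))"
    using nonneg by (intro mult_left_mono exp_ge_add_one_self)
  finally show ?thesis by (simp add: x_def)
qed

context curve_family
begin

lemma test_densities_liftI:
  assumes "W \<in> \<W>" "continuous_on (base W) u" "\<And>r. r \<in> base W \<Longrightarrow> 0 < u r" "0 \<le> a" "0 \<le> \<eta>"
    and ratio: "\<And>r s. r \<in> base W \<Longrightarrow> s \<in> base W \<Longrightarrow> u r \<le> u s * exp (a * \<bar>r - s\<bar> powr \<eta>)"
  shows "lift u \<in> test_densities a \<eta> W"
  unfolding test_densities_def mem_Collect_eq
proof (intro conjI ballI)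
  show "continuous_on (curve_set W) (lift u)"
    unfolding lift_def
    by (rule continuous_on_compose2[OF assms(2)])
       (auto intro!: continuous_intros simp: curve_set_def graph_pt_def)
next
  fix z assume "z \<in> curve_set W"
  then show "0 < lift u z" using assms(3) by (auto simp: curve_set_def)
next
  fix r s assume rs: "r \<in> base W" "s \<in> base W"
  have "u r \<le> u s * exp (a * \<bar>r - s\<bar> powr \<eta>)" using rs by (rule ratio)
  also have "\<dots> \<le> u s * exp (a * arc_dist W r s powr \<eta>)"
    using arc_dist_bounds(1)[OF assms(1) rs] assms(3)[OF rs(2)] assms(4,5)
    by (intro mult_left_mono powr_mono2 iffD2[OF exp_le_cancel_iff]) auto
  finally show "lift u (graph_pt W r) / lift u (graph_pt W s) \<le> exp (a * arc_dist W r s powr \<eta>)"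
    using assms(3)[OF rs(2)] by (simp add: field_simps)
qed

lemma test_densitiesD:
  assumes "W \<in> \<W>" "\<psi> \<in> test_densities a \<eta> W"
  shows "continuous_on (base W) (\<lambda>r. \<psi> (graph_pt W r))"
    and "r \<in> base W \<Longrightarrow> 0 < \<psi> (graph_pt W r)"
    and "r \<in> base W \<Longrightarrow> s \<in> base W \<Longrightarrow>
      \<psi> (graph_pt W r) \<le> \<psi> (graph_pt W s) * exp (a * arc_dist W r s powr \<eta>)"
proof -
  show "continuous_on (base W) (\<lambda>r. \<psi> (graph_pt W r))"
    using assms(2) graph_pt_continuous_on[OF assms(1)]
    by (auto simp: test_densities_def curve_set_def intro: continuous_on_compose2)
  have pos: "0 < \<psi> (graph_pt W r)" if "r \<in> base W" for r
    using assms(2) that by (auto simp: test_densities_def curve_set_def)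
  then show "r \<in> base W \<Longrightarrow> 0 < \<psi> (graph_pt W r)" .
  assume rs: "r \<in> base W" "s \<in> base W"
  then have "\<psi> (graph_pt W r) / \<psi> (graph_pt W s) \<le> exp (a * arc_dist W r s powr \<eta>)"
    using assms(2) by (auto simp: test_densities_def)
  then show "\<psi> (graph_pt W r) \<le> \<psi> (graph_pt W s) * exp (a * arc_dist W r s powr \<eta>)"
    using pos[OF rs(2)] by (simp add: field_simps)
qed

lemma arc_dist_le_curve_len:
  assumes "W \<in> \<W>" "r \<in> base W" "s \<in> base W"
  shows "0 \<le> arc_dist W r s" "arc_dist W r s \<le> curve_len W"
proof -
  show "0 \<le> arc_dist W r s" using arc_dist_bounds(1)[OF assms] by simp
  have sub: "{min r s..max r s} \<subseteq> base W" using assms by (auto simp: base_def)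
  have int: "speed W integrable_on base W"
    unfolding base_def
    using speed_continuous_on[OF assms(1)] by (intro integrable_continuous_real) (simp add: base_def)
  show "arc_dist W r s \<le> curve_len W"
    unfolding arc_dist_def curve_len_def
    using sub int speed_ge_one[of W] order_trans[OF zero_le_one]
    by (intro integral_subset_le) (auto intro: integrable_on_subinterval)
qed

lemma test_densities_lower_exponent:
  assumes "W \<in> \<W>" "curve_len W \<le> 1" "0 < \<beta>" "\<beta> \<le> \<eta>" "0 \<le> a" "\<psi> \<in> test_densities a \<eta> W"
  shows "\<psi> \<in> test_densities a \<beta> W"
proof -
  have "\<psi> (graph_pt W r) / \<psi> (graph_pt W s) \<le> exp (a * arc_dist W r s powr \<beta>)"
    if rs: "r \<in> base W" "s \<in> base W" for r s
  proof -
    have "\<psi> (graph_pt W r) / \<psi> (graph_pt W s) \<le> exp (a * arc_dist W r s powr \<eta>)"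
      using assms(6) rs by (auto simp: test_densities_def)
    also have "\<dots> \<le> exp (a * arc_dist W r s powr \<beta>)"
      using arc_dist_le_curve_len[OF assms(1) rs] assms
      by (auto intro!: mult_left_mono powr_subunit_mono)
    finally show ?thesis .
  qed
  then show ?thesis using assms(6) by (auto simp: test_densities_def)
qed

lemma const_test_density:
  assumes "W \<in> \<W>" "0 < k" "0 \<le> a" "0 \<le> \<eta>"
  shows "(\<lambda>_. k) \<in> test_densities a \<eta> W"
  using assms by (auto simp: test_densities_def)

definition density_const :: "real \<Rightarrow> real" where
  "density_const a = a * exp (2 * a) * \<sigma>"

lemma density_const_ge:
  assumes "1 \<le> a"
  shows "exp a \<le> density_const a" "1 \<le> density_const a" "\<sigma> * exp (2 * a) \<le> density_const a"
proof -
  have "1 * exp a * 1 \<le> a * exp (2 * a) * \<sigma>"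
    using assms \<sigma>_ge_one by (intro mult_mono) auto
  then show 1: "exp a \<le> density_const a" by (simp add: density_const_def)
  have "1 \<le> exp a" using assms by simp
  then show "1 \<le> density_const a" using 1 by linarith
  have "1 * (\<sigma> * exp (2 * a)) \<le> a * (\<sigma> * exp (2 * a))"
    using assms \<sigma>_ge_one by (intro mult_right_mono) auto
  then show "\<sigma> * exp (2 * a) \<le> density_const a" by (simp add: density_const_def mult_ac)
qed

text \<open>On a curve of length at most 1 the logarithm of a density oscillates by at most \<open>a\<close>, so that all its
  values are comparable with its average. The Hoelder bound for the logarithm then gives one for the
  density itself, since \<open>exp z - 1 \<le> z exp z\<close>.\<close>

lemma density_compare_average:
  assumes W: "W \<in> \<W>" "curve_len W \<le> 1" and "1 \<le> a" "0 < \<eta>" "\<eta> \<le> 1"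
    and \<psi>: "\<psi> \<in> test_densities a \<eta> W"
  defines "v \<equiv> curve_avg W \<psi>"
  shows "0 < v"
    and "r \<in> base W \<Longrightarrow> \<psi> (graph_pt W r) \<le> exp a * v"
    and "r \<in> base W \<Longrightarrow> v \<le> exp a * \<psi> (graph_pt W r)"
    and "holder_on (base W) \<eta> (density_const a * v) (\<lambda>r. \<psi> (graph_pt W r))"
proof -
  define u where "u = (\<lambda>r. \<psi> (graph_pt W r))"
  note lo_hi = lo_less_hi[OF W(1)]
  note len = curve_len_bounds[OF W(1)]
  have cont: "continuous_on (base W) u" and pos: "\<And>r. r \<in> base W \<Longrightarrow> 0 < u r"
    using test_densitiesD(1,2)[OF W(1) \<psi>] by (auto simp: u_def)
  have ne: "base W \<noteq> {}" "compact (base W)" using lo_hi by (auto simp: base_def)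
  have avg: "v * curve_len W = seg_int W (lo W) (hi W) (\<lambda>_. 1) u"
    using len by (simp add: v_def curve_avg_def curve_int_eq_seg_int_one u_def)
  have small: "a * arc_dist W r s powr \<eta> \<le> a" if "r \<in> base W" "s \<in> base W" for r s
  proof -
    have "arc_dist W r s powr \<eta> \<le> 1"
      using arc_dist_le_curve_len[OF W(1) that] W assms(3-5) by (intro powr_le1) auto
    then show ?thesis using mult_left_mono[of "arc_dist W r s powr \<eta>" 1 a] assms(3) by simp
  qed
  have ratio: "u r \<le> u s * exp a" if rs: "r \<in> base W" "s \<in> base W" for r s
  proof -
    have "u r \<le> u s * exp (a * arc_dist W r s powr \<eta>)"
      unfolding u_def using rs by (rule test_densitiesD(3)[OF W(1) \<psi>])
    also have "\<dots> \<le> u s * exp a" using small[OF rs] pos[OF rs(2)] by (intro mult_left_mono) auto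
    finally show ?thesis .
  qed
  obtain y where y: "y \<in> base W" "\<And>r. r \<in> base W \<Longrightarrow> u y \<le> u r"
    using continuous_attains_inf[OF ne(2,1) cont] by blast
  obtain z where z: "z \<in> base W" "\<And>r. r \<in> base W \<Longrightarrow> u r \<le> u z"
    using continuous_attains_sup[OF ne(2,1) cont] by blast
  have cont': "continuous_on {lo W..hi W} u" using cont by (simp add: base_def)
  have "seg_int W (lo W) (hi W) (\<lambda>_. 1) (\<lambda>_. u y) \<le> v * curve_len W"
    unfolding avg
    using y by (intro seg_int_one_mono segment_whole W cont' continuous_on_const) (auto simp: base_def)
  then have yv: "u y \<le> v" using len by (simp add: seg_int_one_const_whole)
  have "v * curve_len W \<le> seg_int W (lo W) (hi W) (\<lambda>_. 1) (\<lambda>_. u z)"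
    unfolding avg
    using z by (intro seg_int_one_mono segment_whole W cont' continuous_on_const) (auto simp: base_def)
  then have zv: "v \<le> u z" using len by (simp add: seg_int_one_const_whole)
  show v: "0 < v" using yv pos[OF y(1)] by simp
  have up: "u r \<le> exp a * v" if "r \<in> base W" for r
  proof -
    have "u y * exp a \<le> v * exp a" using yv by (intro mult_right_mono) auto
    then show ?thesis using ratio[OF that y(1)] unfolding mult.commute[of "exp a"] by linarith
  qed
  then show "r \<in> base W \<Longrightarrow> \<psi> (graph_pt W r) \<le> exp a * v" by (simp add: u_def)
  have low: "v \<le> exp a * u r" if "r \<in> base W" for r
    using ratio[OF z(1) that] zv by (simp add: mult.commute)
  then show "r \<in> base W \<Longrightarrow> v \<le> exp a * \<psi> (graph_pt W r)" by (simp add: u_def)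
  have one: "u r - u s \<le> density_const a * v * \<bar>r - s\<bar> powr \<eta>"
    if rs: "r \<in> base W" "s \<in> base W" for r s
  proof -
    define t where "t = a * arc_dist W r s powr \<eta>"
    have t0: "0 \<le> t" using assms(3) by (simp add: t_def)
    have "arc_dist W r s powr \<eta> \<le> (\<sigma> * \<bar>r - s\<bar>) powr \<eta>"
      using arc_dist_bounds(2)[OF W(1) rs] arc_dist_le_curve_len[OF W(1) rs] assms(4)
      by (intro powr_mono2) auto
    also have "\<dots> = \<sigma> powr \<eta> * \<bar>r - s\<bar> powr \<eta>" using \<sigma>_ge_one by (simp add: powr_mult)
    also have "\<dots> \<le> \<sigma> * \<bar>r - s\<bar> powr \<eta>"
      using assms(4,5) \<sigma>_ge_one by (intro mult_right_mono powr_le_of_le_one_exponent) auto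
    finally have t: "t \<le> a * (\<sigma> * \<bar>r - s\<bar> powr \<eta>)"
      unfolding t_def using assms(3) by (intro mult_left_mono) auto
    have "u r - u s \<le> u s * (exp t - 1)"
      using test_densitiesD(3)[OF W(1) \<psi> rs] by (simp add: u_def t_def algebra_simps)
    also have "\<dots> \<le> (exp a * v) * (t * exp t)"
      using up[OF rs(2)] pos[OF rs(2)] v t0 exp_minus_one_le by (intro mult_mono) auto
    also have "\<dots> \<le> (exp a * v) * ((a * (\<sigma> * \<bar>r - s\<bar> powr \<eta>)) * exp a)"
      using small[OF rs] t t0 v assms(3) \<sigma>_ge_one
      by (intro mult_left_mono mult_mono) (auto simp: t_def)
    also have "\<dots> = density_const a * v * \<bar>r - s\<bar> powr \<eta>"
      unfolding density_const_def exp_double power2_eq_square by (simp add: mult_ac)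
    finally show ?thesis .
  qed
  show "holder_on (base W) \<eta> (density_const a * v) (\<lambda>r. \<psi> (graph_pt W r))"
    unfolding u_def[symmetric]
  proof (rule holder_onI)
    fix r assume r: "r \<in> base W"
    have "u r \<le> exp a * v" using r by (rule up)
    also have "\<dots> \<le> density_const a * v"
      using density_const_ge(1)[OF assms(3)] v by (intro mult_right_mono) auto
    finally show "\<bar>u r\<bar> \<le> density_const a * v" using pos[OF r] by simp
  next
    fix r s assume rs: "r \<in> base W" "s \<in> base W"
    show "\<bar>u r - u s\<bar> \<le> density_const a * v * \<bar>r - s\<bar> powr \<eta>"
      using one[OF rs] one[OF rs(2,1)] by (simp add: abs_le_iff abs_minus_commute)
  qed
qed

section \<open>Neighbouring curves\<close>

text \<open>Closeness of the parts of two curves above a common interval. In contrast to the distance of the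
  curves it has no contribution from the bases and is inherited by subintervals.\<close>

definition near :: "real \<Rightarrow> curve \<Rightarrow> curve \<Rightarrow> real \<Rightarrow> real \<Rightarrow> bool" where
  "near \<epsilon> W1 W2 x y \<longleftrightarrow>
     segment W1 x y \<and> segment W2 x y \<and> x < y \<and> scat W1 = scat W2 \<and>
     (\<exists>S\<in>H. curve_set W1 \<subseteq> S \<and> curve_set W2 \<subseteq> S) \<and>
     (\<exists>e1 e2. e1 + e2 \<le> \<epsilon> \<and>
        (\<forall>r\<in>{x..y}. \<bar>height W1 r - height W2 r\<bar> \<le> e1 \<and> \<bar>slope W1 r - slope W2 r\<bar> \<le> e2))"

lemma near_shrink: "near \<epsilon> W1 W2 x y \<Longrightarrow> x \<le> x' \<Longrightarrow> x' < y' \<Longrightarrow> y' \<le> y \<Longrightarrow> near \<epsilon> W1 W2 x' y'"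
proof -
  assume near: "near \<epsilon> W1 W2 x y" and x: "x \<le> x'" "x' < y'" "y' \<le> y"
  have "segment W1 x' y'" "segment W2 x' y'"
    using near x by (auto simp: near_def segment_def)
  moreover have "{x'..y'} \<subseteq> {x..y}" using x by auto
  ultimately show ?thesis using near x unfolding near_def by blast
qed

lemma near_speed:
  assumes "near \<epsilon> W1 W2 x y" "r \<in> {x..y}"
  shows "\<bar>speed W1 r - speed W2 r\<bar> \<le> \<epsilon>"
proof -
  obtain e1 e2 where e: "e1 + e2 \<le> \<epsilon>"
    "\<bar>height W1 r - height W2 r\<bar> \<le> e1" "\<bar>slope W1 r - slope W2 r\<bar> \<le> e2"
    using assms by (auto simp: near_def)
  have "\<bar>speed W1 r - speed W2 r\<bar> \<le> \<bar>slope W1 r - slope W2 r\<bar>"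
    unfolding speed_def by (rule sqrt_one_plus_square_lipschitz)
  then show ?thesis using e by linarith
qed

text \<open>Two neighbouring curves have different arclength elements. The relative difference is small
  in the sup norm, but only bounded in the Lipschitz norm, as curves have bounded curvature.\<close>

lemma near_speed_ratio_holder:
  assumes near: "near \<epsilon> W1 W2 x y" and "y - x \<le> 1" "0 < \<epsilon>" "\<epsilon> \<le> 1" "0 < \<beta>" "\<beta> \<le> 1"
  shows "holder_on {x..y} \<beta> (4 * \<Lambda>\<^sup>2 * \<epsilon> powr (1 - \<beta>)) (\<lambda>r. 1 - speed W1 r / speed W2 r)"
proof -
  have seg: "segment W1 x y" "segment W2 x y" using near by (auto simp: near_def)
  have base: "W1 \<in> \<W>" "W2 \<in> \<W>" "\<And>r. r \<in> {x..y} \<Longrightarrow> r \<in> base W1" "\<And>r. r \<in> {x..y} \<Longrightarrow> r \<in> base W2"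
    using segmentD[OF seg(1)] segmentD[OF seg(2)] by auto
  have "holder_on {x..y} \<beta> (2 * \<Lambda> * \<epsilon> powr (1 - \<beta>)) (\<lambda>r. speed W2 r - speed W1 r)"
  proof (rule holder_on_interpolate)
    fix r assume "r \<in> {x..y}"
    then show "\<bar>speed W2 r - speed W1 r\<bar> \<le> \<epsilon>" using near_speed[OF near] by (simp add: abs_minus_commute)
  next
    fix r s assume rs: "r \<in> {x..y}" "s \<in> {x..y}"
    show "\<bar>speed W2 r - speed W1 r - (speed W2 s - speed W1 s)\<bar> \<le> 2 * \<Lambda> * \<bar>r - s\<bar>"
      using speed_lipschitz[OF base(1) base(3) base(3), OF rs]
        speed_lipschitz[OF base(2) base(4) base(4), OF rs] by linarith
  qed (use assms \<Lambda>_ge_one in auto)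
  moreover have "holder_on {x..y} \<beta> \<Lambda> (\<lambda>r. 1 / speed W2 r)"
  proof (rule lipschitz_imp_holder_on)
    fix r assume "r \<in> {x..y}"
    have "0 \<le> 1 / speed W2 r" "1 / speed W2 r \<le> 1"
      using speed_ge_one[of W2 r] by (auto simp: field_simps)
    then show "\<bar>1 / speed W2 r\<bar> \<le> \<Lambda>" using \<Lambda>_ge_one by linarith
  next
    fix r s assume rs: "r \<in> {x..y}" "s \<in> {x..y}"
    have pos: "1 \<le> speed W2 r * speed W2 s"
      using mult_mono[OF speed_ge_one[of W2 r] speed_ge_one[of W2 s]] speed_ge_one[of W2 r] by simp
    have "\<bar>1 / speed W2 r - 1 / speed W2 s\<bar> = \<bar>speed W2 r - speed W2 s\<bar> / (speed W2 r * speed W2 s)"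
      using speed_ge_one[of W2 r] speed_ge_one[of W2 s] pos
      by (simp add: diff_frac_eq abs_divide abs_mult abs_minus_commute)
    also have "\<dots> \<le> \<bar>speed W2 r - speed W2 s\<bar> / 1"
      using pos by (intro divide_left_mono) auto
    also have "\<dots> \<le> \<Lambda> * \<bar>r - s\<bar>" using speed_lipschitz[OF base(2) base(4) base(4), OF rs] by simp
    finally show "\<bar>1 / speed W2 r - 1 / speed W2 s\<bar> \<le> \<Lambda> * \<bar>r - s\<bar>" .
  qed (use assms in auto)
  ultimately have "holder_on {x..y} \<beta> (2 * (2 * \<Lambda> * \<epsilon> powr (1 - \<beta>)) * \<Lambda>)
      (\<lambda>r. (speed W2 r - speed W1 r) * (1 / speed W2 r))"
    by (rule holder_on_mult)
  moreover have "(speed W2 r - speed W1 r) * (1 / speed W2 r) = 1 - speed W1 r / speed W2 r" for r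
    using speed_ge_one[of W2 r] by (simp add: field_simps)
  ultimately show ?thesis by (simp add: power2_eq_square mult_ac)
qed

lemma C0_norm_le_iff: "C0_norm S f \<le> ereal e \<longleftrightarrow> 0 \<le> e \<and> (\<forall>r\<in>S. \<bar>f r\<bar> \<le> e)"
  by (auto simp: C0_norm_def Sup_le_iff)

lemma C0_norm_nonneg: "0 \<le> C0_norm S f"
  unfolding C0_norm_def by (rule Sup_upper) simp

lemma dist_Ws_le_iff:
  "dist_Ws H W1 W2 \<le> ereal \<epsilon> \<longleftrightarrow>
     (\<exists>S\<in>H. curve_set W1 \<subseteq> S \<and> curve_set W2 \<subseteq> S) \<and>
     (\<exists>e1 e2. 0 \<le> e1 \<and> 0 \<le> e2 \<and> sym_diff_measure W1 W2 + e1 + e2 \<le> \<epsilon> \<and>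
        (\<forall>r\<in>overlap W1 W2. \<bar>height W1 r - height W2 r\<bar> \<le> e1 \<and> \<bar>slope W1 r - slope W2 r\<bar> \<le> e2))"
    (is "_ = (?strip \<and> ?close)")
proof (cases ?strip)
  case True
  define c1 where "c1 = C0_norm (overlap W1 W2) (\<lambda>r. height W1 r - height W2 r)"
  define c2 where "c2 = C0_norm (overlap W1 W2) (\<lambda>r. slope W1 r - slope W2 r)"
  have d: "dist_Ws H W1 W2 = ereal (sym_diff_measure W1 W2) + (c1 + c2)"
    using True by (simp add: dist_Ws_def c1_def c2_def)
  have c: "0 \<le> c1" "0 \<le> c2" by (auto simp: c1_def c2_def C0_norm_nonneg)
  have "dist_Ws H W1 W2 \<le> ereal \<epsilon> \<longleftrightarrow>
    (\<exists>e1 e2. sym_diff_measure W1 W2 + e1 + e2 \<le> \<epsilon> \<and> c1 \<le> ereal e1 \<and> c2 \<le> ereal e2)"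
  proof
    assume le: "dist_Ws H W1 W2 \<le> ereal \<epsilon>"
    obtain e1 e2 where "c1 = ereal e1" "c2 = ereal e2"
      using c le unfolding d by (cases c1; cases c2) auto
    then show "\<exists>e1 e2. sym_diff_measure W1 W2 + e1 + e2 \<le> \<epsilon> \<and> c1 \<le> ereal e1 \<and> c2 \<le> ereal e2"
      using le unfolding d by (intro exI[of _ e1] exI[of _ e2]) (simp add: add.assoc)
  next
    assume "\<exists>e1 e2. sym_diff_measure W1 W2 + e1 + e2 \<le> \<epsilon> \<and> c1 \<le> ereal e1 \<and> c2 \<le> ereal e2"
    then obtain e1 e2 where e: "sym_diff_measure W1 W2 + e1 + e2 \<le> \<epsilon>" "c1 \<le> ereal e1" "c2 \<le> ereal e2"
      by blast
    have "dist_Ws H W1 W2 \<le> ereal (sym_diff_measure W1 W2) + (ereal e1 + ereal e2)"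
      unfolding d using e(2,3) by (intro add_mono) auto
    also have "\<dots> \<le> ereal \<epsilon>" using e(1) by simp
    finally show "dist_Ws H W1 W2 \<le> ereal \<epsilon>" .
  qed
  also have "\<dots> \<longleftrightarrow> ?close" unfolding c1_def c2_def C0_norm_le_iff by blast
  finally show ?thesis using True by simp
next
  case False
  then show ?thesis unfolding dist_Ws_def by (simp only: if_False simp_thms) simp
qed

lemma measure_base: "lo W \<le> hi W \<Longrightarrow> measure lebesgue (base W) = hi W - lo W"
  by (simp add: base_def)

lemma sym_diff_measure_eq:
  assumes "lo W1 \<le> hi W1" "lo W2 \<le> hi W2"
  shows "sym_diff_measure W1 W2 =
    (if scat W1 = scat W2 \<and> max (lo W1) (lo W2) \<le> min (hi W1) (hi W2)
     then \<bar>lo W1 - lo W2\<bar> + \<bar>hi W1 - hi W2\<bar> else (hi W1 - lo W1) + (hi W2 - lo W2))"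
proof (cases "scat W1 = scat W2")
  case True
  define I where "I = {max (lo W1) (lo W2)..min (hi W1) (hi W2)}"
  have I: "base W1 \<inter> base W2 = I" by (auto simp: base_def I_def)
  have [measurable, simp]: "base W \<in> lmeasurable" for W by (simp add: base_def)
  have [measurable, simp]: "I \<in> lmeasurable" by (simp add: I_def)
  have "sym_diff_measure W1 W2 = measure lebesgue ((base W1 - I) \<union> (base W2 - I))"
    using True I by (auto simp: sym_diff_measure_def intro!: arg_cong[of _ _ "measure lebesgue"])
  also have "\<dots> = measure lebesgue (base W1 - I) + measure lebesgue (base W2 - I)"
    using I by (intro measure_Un_AE AE_I2 fmeasurable.Diff) auto
  also have "\<dots> = (measure lebesgue (base W1) - measure lebesgue I) +
      (measure lebesgue (base W2) - measure lebesgue I)"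
    using I by (subst (1 2) measurable_measure_Diff) auto
  finally have *: "sym_diff_measure W1 W2 = (hi W1 - lo W1) + (hi W2 - lo W2) - 2 * measure lebesgue I"
    using assms by (simp add: measure_base)
  show ?thesis
    using True assms by (auto simp: * I_def min_def max_def)
qed (use assms in \<open>auto simp: sym_diff_measure_def measure_base\<close>)

end

section \<open>The anisotropic norm on segments with a common base\<close>

context curve_family
begin

lemma dist_Ws_sub_curve:
  assumes near: "near \<epsilon> W1 W2 x y"
  shows "dist_Ws H (sub_curve W1 x y) (sub_curve W2 x y) \<le> ereal \<epsilon>"
proof -
  have seg: "segment W1 x y" "segment W2 x y" and xy: "x < y" and scat: "scat W1 = scat W2"
    using near by (auto simp: near_def)
  obtain S where S: "S \<in> H" "curve_set W1 \<subseteq> S" "curve_set W2 \<subseteq> S" using near by (auto simp: near_def)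
  obtain e1 e2 where e: "e1 + e2 \<le> \<epsilon>"
    "\<And>r. r \<in> {x..y} \<Longrightarrow> \<bar>height W1 r - height W2 r\<bar> \<le> e1"
    "\<And>r. r \<in> {x..y} \<Longrightarrow> \<bar>slope W1 r - slope W2 r\<bar> \<le> e2"
    using near unfolding near_def by blast
  have sl: "slope (sub_curve W1 x y) r = slope W1 r" "slope (sub_curve W2 x y) r = slope W2 r"
    if "r \<in> {x..y}" for r
    using speed_sub_curve(1)[OF _ _ xy _ that] segmentD[OF seg(1)] segmentD[OF seg(2)] by auto
  have 0: "0 \<le> e1" "0 \<le> e2"
    using e(2)[of x] e(3)[of x] xy by auto
  have sub: "curve_set (sub_curve W1 x y) \<subseteq> S" "curve_set (sub_curve W2 x y) \<subseteq> S"
    using S segmentD(5)[OF seg(1)] segmentD(5)[OF seg(2)]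
    unfolding curve_set_def sub_curve_simps by (metis image_mono order_trans)+
  have "sym_diff_measure (sub_curve W1 x y) (sub_curve W2 x y) + e1 + e2 \<le> \<epsilon>"
    using e(1) xy scat by (subst sym_diff_measure_eq) auto
  moreover have "\<forall>r\<in>overlap (sub_curve W1 x y) (sub_curve W2 x y).
      \<bar>height (sub_curve W1 x y) r - height (sub_curve W2 x y) r\<bar> \<le> e1 \<and>
      \<bar>slope (sub_curve W1 x y) r - slope (sub_curve W2 x y) r\<bar> \<le> e2"
    using e sl by (auto simp: overlap_def)
  ultimately show ?thesis unfolding dist_Ws_le_iff using 0 S(1) sub by blast
qed

text \<open>If the bases overlap in an interval, their symmetric difference consists of the gaps between
  their endpoints. Otherwise the bases meet in at most one point, and the symmetric difference has the
  length of both together.\<close>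

lemma dist_Ws_cases:
  assumes W: "W1 \<in> \<W>" "W2 \<in> \<W>" and dist: "dist_Ws H W1 W2 \<le> ereal \<epsilon>"
  obtains (overlapping) x y where "near \<epsilon> W1 W2 x y" "overlap W1 W2 = {x..y}"
      "lo W1 \<le> x" "x - lo W1 \<le> \<epsilon>" "y \<le> hi W1" "hi W1 - y \<le> \<epsilon>"
      "lo W2 \<le> x" "x - lo W2 \<le> \<epsilon>" "y \<le> hi W2" "hi W2 - y \<le> \<epsilon>"
      "(hi W1 - lo W1) - (y - x) \<le> \<epsilon>" "(hi W2 - lo W2) - (y - x) \<le> \<epsilon>"
    | (short) "hi W1 - lo W1 \<le> \<epsilon>" "hi W2 - lo W2 \<le> \<epsilon>"
proof -
  define x y where "x = max (lo W1) (lo W2)" and "y = min (hi W1) (hi W2)"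
  note lohi = lo_less_hi[OF W(1)] lo_less_hi[OF W(2)]
  obtain e1 e2 where strip: "\<exists>S\<in>H. curve_set W1 \<subseteq> S \<and> curve_set W2 \<subseteq> S"
    and e: "0 \<le> e1" "0 \<le> e2" "sym_diff_measure W1 W2 + e1 + e2 \<le> \<epsilon>"
      "\<And>r. r \<in> overlap W1 W2 \<Longrightarrow> \<bar>height W1 r - height W2 r\<bar> \<le> e1 \<and> \<bar>slope W1 r - slope W2 r\<bar> \<le> e2"
    using dist unfolding dist_Ws_le_iff by blast
  note sd = sym_diff_measure_eq[OF less_imp_le[OF lohi(1)] less_imp_le[OF lohi(2)], folded x_def y_def]
  show thesis
  proof (cases "scat W1 = scat W2 \<and> x < y")
    case True
    then have o: "overlap W1 W2 = {x..y}" by (auto simp: overlap_def base_def x_def y_def)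
    have sd': "\<bar>lo W1 - lo W2\<bar> + \<bar>hi W1 - hi W2\<bar> + e1 + e2 \<le> \<epsilon>" using e(3) sd True by simp
    have seg: "segment W1 x y" "segment W2 x y"
      using W True by (auto simp: segment_def x_def y_def)
    have ee: "e1 + e2 \<le> \<epsilon>" using sd' by linarith
    have n: "near \<epsilon> W1 W2 x y"
      unfolding near_def using True strip seg ee e(4) unfolding o by blast
    show thesis
      by (rule overlapping[OF n o]) (use sd' e(1,2) in \<open>auto simp: x_def y_def max_def min_def\<close>)
  next
    case False
    then have "sym_diff_measure W1 W2 = (hi W1 - lo W1) + (hi W2 - lo W2)"
      unfolding sd using lohi by (auto simp: x_def y_def max_def min_def split: if_splits)
    then show thesis using short e lohi by linarith
  qed
qed

lemma sup_nonneg_ereal: "x \<in> X \<Longrightarrow> 0 \<le> f x \<Longrightarrow> (0::ereal) \<le> (SUP x\<in>X. f x)"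
  by (rule SUP_upper2)

lemma holder_norm_le_imp_holder_on:
  assumes W: "W \<in> \<W>" and "0 < \<eta>" "\<eta> \<le> 1" and le: "holder_norm W \<eta> \<psi> \<le> ereal B"
  shows "holder_on (base W) \<eta> (\<sigma> * B) (\<lambda>r. \<psi> (graph_pt W r))"
proof -
  define P where "P = {(r, s). r \<in> base W \<and> s \<in> base W \<and> r \<noteq> s}"
  define N1 where "N1 = (SUP r\<in>base W. ereal \<bar>\<psi> (graph_pt W r)\<bar>)"
  define N2 where "N2 = (SUP (r, s)\<in>P. ereal (\<bar>\<psi> (graph_pt W r) - \<psi> (graph_pt W s)\<bar> / arc_dist W r s powr \<eta>))"
  have N: "N1 + N2 \<le> ereal B" using le by (simp add: holder_norm_def N1_def N2_def P_def)
  have mem: "lo W \<in> base W" "(lo W, hi W) \<in> P"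
    using lo_less_hi[OF W] by (auto simp: base_def P_def)
  have "0 \<le> N1" "0 \<le> N2"
    unfolding N1_def N2_def by (rule sup_nonneg_ereal[OF mem(1)] sup_nonneg_ereal[OF mem(2)], simp)+
  then have "N1 \<le> N1 + N2" "N2 \<le> N1 + N2"
    using add_left_mono[of 0 N2 N1] add_right_mono[of 0 N1 N2] by simp_all
  then have le': "N1 \<le> ereal B" "N2 \<le> ereal B"
    using N by (auto intro: order_trans)
  have b1: "\<bar>\<psi> (graph_pt W r)\<bar> \<le> B" if "r \<in> base W" for r
    using le'(1) that by (simp add: N1_def SUP_le_iff)
  then have B: "0 \<le> B" using mem(1) by force
  have sB: "B \<le> \<sigma> * B" using \<sigma>_ge_one B mult_right_mono[of 1 \<sigma> B] by simp
  show ?thesis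
  proof (rule holder_onI)
    fix r assume "r \<in> base W"
    then show "\<bar>\<psi> (graph_pt W r)\<bar> \<le> \<sigma> * B" using b1 sB by force
  next
    fix r s assume rs: "r \<in> base W" "s \<in> base W"
    show "\<bar>\<psi> (graph_pt W r) - \<psi> (graph_pt W s)\<bar> \<le> \<sigma> * B * \<bar>r - s\<bar> powr \<eta>"
    proof (cases "r = s")
      case False
      then have "(r, s) \<in> P" using rs by (simp add: P_def)
      then have "\<bar>\<psi> (graph_pt W r) - \<psi> (graph_pt W s)\<bar> / arc_dist W r s powr \<eta> \<le> B"
        using le'(2) unfolding N2_def SUP_le_iff by fastforce
      moreover have d: "0 < arc_dist W r s" using arc_dist_bounds(1)[OF W rs] False by simp
      ultimately have "\<bar>\<psi> (graph_pt W r) - \<psi> (graph_pt W s)\<bar> \<le> B * arc_dist W r s powr \<eta>"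
        by (simp add: field_simps)
      also have "\<dots> \<le> B * (\<sigma> * \<bar>r - s\<bar>) powr \<eta>"
        using arc_dist_bounds(2)[OF W rs] d B assms(2) by (intro mult_left_mono powr_mono2) auto
      also have "\<dots> = B * (\<sigma> powr \<eta> * \<bar>r - s\<bar> powr \<eta>)" using \<sigma>_ge_one by (simp add: powr_mult)
      also have "\<dots> \<le> B * (\<sigma> * \<bar>r - s\<bar> powr \<eta>)"
        using assms B \<sigma>_ge_one by (intro mult_left_mono mult_right_mono powr_le_of_le_one_exponent) auto
      finally show ?thesis by (simp add: mult_ac)
    qed (use B \<sigma>_ge_one in auto)
  qed
qed

lemma holder_on_imp_holder_norm_le:
  assumes W: "W \<in> \<W>" and "0 < \<eta>" and u: "holder_on (base W) \<eta> B u"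
  shows "holder_norm W \<eta> (lift u) \<le> ereal (2 * B)"
proof -
  have B: "0 \<le> B" using holder_on_nonneg[OF u] lo_less_hi[OF W] by (auto simp: base_def)
  have "(SUP r\<in>base W. ereal \<bar>lift u (graph_pt W r)\<bar>) \<le> ereal B"
    using holder_on_bound[OF u] by (intro SUP_least) auto
  moreover have "(SUP (r, s)\<in>{(r, s). r \<in> base W \<and> s \<in> base W \<and> r \<noteq> s}.
        ereal (\<bar>lift u (graph_pt W r) - lift u (graph_pt W s)\<bar> / arc_dist W r s powr \<eta>)) \<le> ereal B"
  proof (intro SUP_least, clarify)
    fix r s assume rs: "r \<in> base W" "s \<in> base W" "r \<noteq> s"
    have "\<bar>u r - u s\<bar> \<le> B * \<bar>r - s\<bar> powr \<eta>" using holder_on_diff[OF u rs(1,2)] .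
    also have "\<dots> \<le> B * arc_dist W r s powr \<eta>"
      using arc_dist_bounds(1)[OF W rs(1,2)] B assms(2) by (intro mult_left_mono powr_mono2) auto
    finally show "ereal (\<bar>lift u (graph_pt W r) - lift u (graph_pt W s)\<bar> / arc_dist W r s powr \<eta>) \<le> ereal B"
      using arc_dist_bounds(1)[OF W rs(1,2)] rs(3) by (simp add: field_simps)
  qed
  ultimately have "holder_norm W \<eta> (lift u) \<le> ereal B + ereal B"
    unfolding holder_norm_def by (rule add_mono)
  then show ?thesis by simp
qed

lemma curve_len_sub_curve_bounds:
  assumes "segment W x y" "x < y"
  shows "sub_curve W x y \<in> \<W>" "y - x \<le> curve_len (sub_curve W x y)"
    "curve_len (sub_curve W x y) \<le> \<sigma> * (y - x)" "0 < curve_len (sub_curve W x y)"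
proof -
  show V: "sub_curve W x y \<in> \<W>" using segmentD[OF assms(1)] assms(2) by (intro sub_curve_mem) auto
  show "y - x \<le> curve_len (sub_curve W x y)"
    "curve_len (sub_curve W x y) \<le> \<sigma> * (y - x)" "0 < curve_len (sub_curve W x y)"
    using curve_len_bounds[OF V] by simp_all
qed

lemma curve_int_sub_curve:
  assumes "segment W x y" "x < y"
  shows "curve_int (sub_curve W x y) (\<lambda>z. g z * lift u z) = seg_int W x y g u"
  using seg_int_sub_curve[of W x y x y g u] segmentD[OF assms(1)] assms(2)
  by (simp add: curve_int_eq_seg_int)

end

lemma scaled_powr_le:
  fixes s x \<eta> :: real
  assumes "1 \<le> s" "0 \<le> x" "0 \<le> \<eta>" "\<eta> \<le> 1"
  shows "(s * x) powr \<eta> \<le> s * x powr \<eta>"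
  using assms by (simp add: powr_mult mult_right_mono powr_le_of_le_one_exponent)

locale norm_setting = curve_family H \<W> D \<Lambda>
  for H :: "pt set set" and \<W> :: "curve set" and D \<Lambda> :: real +
  fixes R \<alpha> \<beta> \<gamma> p \<epsilon>0 cu :: real
  assumes nonempty: "\<W> \<noteq> {}"
    and R: "1 \<le> R" "W \<in> \<W> \<Longrightarrow> hi W - lo W \<le> R"
    and exponents: "0 < \<beta>" "\<beta> < \<alpha>" "\<alpha> \<le> 1" "1 < p" "0 < \<gamma>" "\<gamma> < 1 / p" "\<gamma> < \<alpha> - \<beta>"
    and \<epsilon>0_pos: "0 < \<epsilon>0" and cu_pos: "0 < cu"
begin

text \<open>The two parts of the anisotropic norm, in terms of functions of the base coordinate. The unstable part
  compares the same function on two curves above the same interval, so that no mismatch of bases or of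
  test functions enters.\<close>

definition stable_bound :: "real \<Rightarrow> (pt \<Rightarrow> real) \<Rightarrow> bool" where
  "stable_bound b g \<longleftrightarrow> (\<forall>W x y B u. segment W x y \<longrightarrow> holder_on {x..y} \<beta> B u \<longrightarrow>
     \<bar>seg_int W x y g u\<bar> \<le> b * B * (y - x) powr (1/p))"

definition unstable_bound :: "real \<Rightarrow> (pt \<Rightarrow> real) \<Rightarrow> bool" where
  "unstable_bound b g \<longleftrightarrow> (\<forall>\<epsilon> W1 W2 x y B u. 0 < \<epsilon> \<longrightarrow> \<epsilon> \<le> \<epsilon>0 \<longrightarrow> near \<epsilon> W1 W2 x y \<longrightarrow>
     holder_on {x..y} \<alpha> B u \<longrightarrow>
     \<bar>seg_int W1 x y g u - seg_int W2 x y g u\<bar> \<le> b * B * \<epsilon> powr \<gamma>)"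

lemma stable_boundD:
  "stable_bound b g \<Longrightarrow> segment W x y \<Longrightarrow> holder_on {x..y} \<beta> B u \<Longrightarrow>
     \<bar>seg_int W x y g u\<bar> \<le> b * B * (y - x) powr (1/p)"
  by (auto simp: stable_bound_def)

lemma unstable_boundD:
  "unstable_bound b g \<Longrightarrow> 0 < \<epsilon> \<Longrightarrow> \<epsilon> \<le> \<epsilon>0 \<Longrightarrow> near \<epsilon> W1 W2 x y \<Longrightarrow> holder_on {x..y} \<alpha> B u \<Longrightarrow>
     \<bar>seg_int W1 x y g u - seg_int W2 x y g u\<bar> \<le> b * B * \<epsilon> powr \<gamma>"
  by (auto simp: unstable_bound_def)

lemma p_inverse: "0 < 1 / p" "1 / p < 1"
  using exponents by auto

lemma seg_int_zero:
  assumes "\<And>r. r \<in> {x..y} \<Longrightarrow> u r = 0"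
  shows "seg_int W x y g u = 0"
  using seg_int_cong[of x y u "\<lambda>_. 0"] assms by (simp add: seg_int_def)

lemma norm_s_imp_stable_bound:
  assumes le: "norm_s \<W> \<beta> p g \<le> ereal b"
  shows "stable_bound (2 * \<sigma> * b) g"
  unfolding stable_bound_def
proof (intro allI impI)
  fix W x y B u assume seg: "segment W x y" and u: "holder_on {x..y} \<beta> B u"
  have B0: "0 \<le> B" using holder_on_nonneg[OF u] segmentD[OF seg] by auto
  show "\<bar>seg_int W x y g u\<bar> \<le> 2 * \<sigma> * b * B * (y - x) powr (1/p)"
  proof (cases "x = y \<or> B = 0")
    case True
    then have "seg_int W x y g u = 0"
    proof
      assume "B = 0"
      then have "u r = 0" if "r \<in> {x..y}" for r using holder_on_bound[OF u that] by simp
      then show ?thesis by (rule seg_int_zero)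
    qed simp
    then show ?thesis using True by auto
  next
    case False
    then have xy: "x < y" and B: "0 < B" using segmentD[OF seg] B0 by auto
    define V where "V = sub_curve W x y"
    note V = curve_len_sub_curve_bounds[OF seg xy, folded V_def]
    define k where "k = curve_len V powr (- (1/p)) / (2 * B)"
    have k: "0 < k" using V B by (simp add: k_def)
    have test: "j * seg_int W x y g u \<le> b" if "\<bar>j\<bar> = k" for j
    proof -
      have "holder_norm V \<beta> (lift (\<lambda>r. j * u r)) \<le> ereal (2 * (\<bar>j\<bar> * B))"
        using holder_on_scale[OF u, of j] exponents V(1)
        by (intro holder_on_imp_holder_norm_le) (auto simp: V_def)
      then have "holder_norm V \<beta> (lift (\<lambda>r. j * u r)) \<le> ereal (curve_len V powr (- (1/p)))"
        using that B by (simp add: k_def)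
      then have "ereal (curve_int V (\<lambda>z. g z * lift (\<lambda>r. j * u r) z)) \<le> ereal b"
        using le V(1) unfolding norm_s_def SUP_le_iff by blast
      then show ?thesis by (simp add: V_def curve_int_sub_curve[OF seg xy] seg_int_cmult)
    qed
    have kb: "k * \<bar>seg_int W x y g u\<bar> \<le> b"
      using test[of k] test[of "- k"] k by (auto simp: abs_if)
    have b0: "0 \<le> b" using order_trans[OF _ kb, of 0] k by simp
    have "\<bar>seg_int W x y g u\<bar> = k * \<bar>seg_int W x y g u\<bar> * (2 * B * curve_len V powr (1/p))"
      using B V by (simp add: k_def powr_minus field_simps)
    also have "\<dots> \<le> b * (2 * B * curve_len V powr (1/p))"
      using kb B by (intro mult_right_mono) auto
    also have "\<dots> \<le> b * (2 * B * (\<sigma> * (y - x) powr (1/p)))"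
    proof -
      have "curve_len V powr (1/p) \<le> (\<sigma> * (y - x)) powr (1/p)"
        using V p_inverse by (intro powr_mono2) auto
      also have "\<dots> \<le> \<sigma> * (y - x) powr (1/p)"
        using p_inverse \<sigma>_ge_one xy by (intro scaled_powr_le) auto
      finally show ?thesis using b0 B by (intro mult_left_mono) auto
    qed
    finally show ?thesis by (simp add: mult_ac)
  qed
qed

lemma norm_u_le_iff:
  "norm_u H \<W> \<alpha> \<gamma> \<epsilon>0 g \<le> ereal b \<longleftrightarrow> (\<forall>\<epsilon> W1 W2 \<psi>1 \<psi>2. 0 < \<epsilon> \<longrightarrow> \<epsilon> \<le> \<epsilon>0 \<longrightarrow> W1 \<in> \<W> \<longrightarrow> W2 \<in> \<W> \<longrightarrow>
     dist_Ws H W1 W2 \<le> ereal \<epsilon> \<longrightarrow> holder_norm W1 \<alpha> \<psi>1 \<le> 1 \<longrightarrow> holder_norm W2 \<alpha> \<psi>2 \<le> 1 \<longrightarrow>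
     dist_0 W1 W2 \<psi>1 \<psi>2 = 0 \<longrightarrow>
     \<epsilon> powr (- \<gamma>) * \<bar>curve_int W1 (\<lambda>x. g x * \<psi>1 x) - curve_int W2 (\<lambda>x. g x * \<psi>2 x)\<bar> \<le> b)"
    (is "_ \<longleftrightarrow> (\<forall>\<epsilon> W1 W2 \<psi>1 \<psi>2. _ \<longrightarrow> _ \<longrightarrow> _ \<longrightarrow> _ \<longrightarrow> _ \<longrightarrow> _ \<longrightarrow> _ \<longrightarrow> _ \<longrightarrow> ?le \<epsilon> W1 W2 \<psi>1 \<psi>2)")
proof -
  have "norm_u H \<W> \<alpha> \<gamma> \<epsilon>0 g \<le> ereal b \<longleftrightarrow> (\<forall>\<epsilon>\<in>{0<..\<epsilon>0}.
      \<forall>W\<in>{(W1, W2). W1 \<in> \<W> \<and> W2 \<in> \<W> \<and> dist_Ws H W1 W2 \<le> ereal \<epsilon>}.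
      \<forall>\<psi>\<in>{(\<psi>1, \<psi>2). holder_norm (fst W) \<alpha> \<psi>1 \<le> 1 \<and> holder_norm (snd W) \<alpha> \<psi>2 \<le> 1 \<and>
                dist_0 (fst W) (snd W) \<psi>1 \<psi>2 = 0}.
      ?le \<epsilon> (fst W) (snd W) (fst \<psi>) (snd \<psi>))"
    by (simp add: norm_u_def SUP_le_iff case_prod_unfold)
  then show ?thesis by (simp add: split_paired_all imp_conjL Ball_def)
qed

lemma divide_out_le:
  fixes e B X b :: real
  assumes "0 < e" "0 < B" "inverse e * (1 / (2 * B) * X) \<le> b"
  shows "X \<le> 2 * b * B * e"
  using assms by (simp add: field_simps)

lemma norm_u_imp_unstable_bound:
  assumes le: "norm_u H \<W> \<alpha> \<gamma> \<epsilon>0 g \<le> ereal b"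
  shows "unstable_bound (2 * b) g"
  unfolding unstable_bound_def
proof (intro allI impI)
  fix \<epsilon> W1 W2 x y B u
  assume \<epsilon>: "0 < \<epsilon>" "\<epsilon> \<le> \<epsilon>0" and near: "near \<epsilon> W1 W2 x y" and u: "holder_on {x..y} \<alpha> B u"
  have seg: "segment W1 x y" "segment W2 x y" and xy: "x < y" using near by (auto simp: near_def)
  have B0: "0 \<le> B" using holder_on_nonneg[OF u] xy by auto
  show "\<bar>seg_int W1 x y g u - seg_int W2 x y g u\<bar> \<le> 2 * b * B * \<epsilon> powr \<gamma>"
  proof (cases "B = 0")
    case True
    then have "u r = 0" if "r \<in> {x..y}" for r using holder_on_bound[OF u that] by simp
    then have "seg_int W x y g u = 0" for W by (rule seg_int_zero)
    then show ?thesis using True by simp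
  next
    case False
    then have B: "0 < B" using B0 by simp
    define V1 V2 where "V1 = sub_curve W1 x y" and "V2 = sub_curve W2 x y"
    have V: "V1 \<in> \<W>" "V2 \<in> \<W>"
      using curve_len_sub_curve_bounds[OF seg(1) xy] curve_len_sub_curve_bounds[OF seg(2) xy]
      by (auto simp: V1_def V2_def)
    define k where "k = 1 / (2 * B)"
    have k: "0 < k" using B by (simp add: k_def)
    define \<psi> where "\<psi> = lift (\<lambda>r. k * u r)"
    have "holder_norm V1 \<alpha> \<psi> \<le> ereal (2 * (\<bar>k\<bar> * B))" "holder_norm V2 \<alpha> \<psi> \<le> ereal (2 * (\<bar>k\<bar> * B))"
      unfolding \<psi>_def using holder_on_scale[OF u, of k] exponents V
      by (intro holder_on_imp_holder_norm_le; simp add: V1_def V2_def)+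
    then have hn: "holder_norm V1 \<alpha> \<psi> \<le> 1" "holder_norm V2 \<alpha> \<psi> \<le> 1"
      using B by (simp_all add: k_def one_ereal_def)
    have d0: "dist_0 V1 V2 \<psi> \<psi> = 0"
      using C0_norm_nonneg
      by (intro antisym) (auto simp: dist_0_def \<psi>_def zero_ereal_def C0_norm_le_iff)
    have d: "dist_Ws H V1 V2 \<le> ereal \<epsilon>" unfolding V1_def V2_def using near by (rule dist_Ws_sub_curve)
    have "\<epsilon> powr (- \<gamma>) * \<bar>curve_int V1 (\<lambda>x. g x * \<psi> x) - curve_int V2 (\<lambda>x. g x * \<psi> x)\<bar> \<le> b"
      using le V hn d0 d \<epsilon> unfolding norm_u_le_iff by blast
    then have "\<epsilon> powr (- \<gamma>) * \<bar>k * seg_int W1 x y g u - k * seg_int W2 x y g u\<bar> \<le> b"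
      by (simp add: V1_def V2_def \<psi>_def curve_int_sub_curve[OF seg(1) xy]
          curve_int_sub_curve[OF seg(2) xy] seg_int_cmult)
    then have "\<epsilon> powr (- \<gamma>) * (k * \<bar>seg_int W1 x y g u - seg_int W2 x y g u\<bar>) \<le> b"
      using k by (simp add: abs_mult flip: right_diff_distrib)
    then show ?thesis using \<epsilon> B by (intro divide_out_le) (auto simp: k_def powr_minus)
  qed
qed

text \<open>The stable bound makes the integrals over the short pieces at both ends small.\<close>

lemma seg_int_remainder:
  assumes g: "curve_continuous g" and b: "stable_bound b g" and W: "W \<in> \<W>"
    and xy: "lo W \<le> x" "x \<le> y" "y \<le> hi W" and u: "holder_on (base W) \<beta> B u"
  shows "\<bar>seg_int W (lo W) (hi W) g u - seg_int W x y g u\<bar>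
    \<le> b * B * ((x - lo W) powr (1/p) + (hi W - y) powr (1/p))"
proof -
  have cont: "continuous_on {lo W..hi W} u"
    using holder_on_imp_continuous_on[OF u] exponents by (simp add: base_def)
  have seg: "segment W (lo W) (hi W)" "segment W (lo W) x" "segment W x (hi W)" "segment W y (hi W)"
    using W xy by (auto simp: segment_def)
  have "seg_int W (lo W) (hi W) g u = seg_int W (lo W) x g u + seg_int W x (hi W) g u"
    using seg_int_split[OF seg(1) g cont] xy by simp
  also have "seg_int W x (hi W) g u = seg_int W x y g u + seg_int W y (hi W) g u"
    using xy by (intro seg_int_split[OF seg(3) g] continuous_on_subset[OF cont]) auto
  finally have eq: "seg_int W (lo W) (hi W) g u - seg_int W x y g u =
      seg_int W (lo W) x g u + seg_int W y (hi W) g u" by simp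
  have "\<bar>seg_int W (lo W) x g u\<bar> \<le> b * B * (x - lo W) powr (1/p)"
    using xy by (intro stable_boundD[OF b seg(2)] holder_on_subset[OF u]) (auto simp: base_def)
  moreover have "\<bar>seg_int W y (hi W) g u\<bar> \<le> b * B * (hi W - y) powr (1/p)"
    using xy by (intro stable_boundD[OF b seg(4)] holder_on_subset[OF u]) (auto simp: base_def)
  ultimately show ?thesis unfolding eq by (simp add: distrib_left)
qed

lemma stable_bound_imp_norm_s:
  assumes b: "stable_bound b g" "0 \<le> b"
  shows "norm_s \<W> \<beta> p g \<le> ereal (\<sigma> * b)"
  unfolding norm_s_def
proof (intro SUP_least, clarify)
  fix W \<psi> assume W: "W \<in> \<W>" and \<psi>: "holder_norm W \<beta> \<psi> \<le> ereal (curve_len W powr (- (1/p)))"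
  note len = curve_len_bounds[OF W]
  have "\<bar>curve_int W (\<lambda>x. g x * \<psi> x)\<bar> \<le> b * (\<sigma> * curve_len W powr (- (1/p))) * (hi W - lo W) powr (1/p)"
    unfolding curve_int_eq_seg_int
    using holder_norm_le_imp_holder_on[OF W _ _ \<psi>] exponents
    by (intro stable_boundD[OF b(1) segment_whole[OF W]]) (auto simp: base_def)
  also have "\<dots> \<le> b * (\<sigma> * curve_len W powr (- (1/p))) * curve_len W powr (1/p)"
    using b \<sigma>_ge_one len lo_less_hi[OF W] p_inverse by (intro mult_left_mono powr_mono2) auto
  also have "\<dots> = \<sigma> * b" using len by (simp add: powr_minus field_simps)
  finally show "ereal (curve_int W (\<lambda>x. g x * \<psi> x)) \<le> ereal (\<sigma> * b)" by simp
qed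

lemma powr_inverse_p_le:
  assumes "0 \<le> x" "x \<le> \<epsilon>" "\<epsilon> \<le> E" "1 \<le> E"
  shows "x powr (1/p) \<le> E * \<epsilon> powr \<gamma>"
proof -
  have "x powr (1/p) \<le> \<epsilon> powr (1/p)" using assms p_inverse by (intro powr_mono2) auto
  also have "\<dots> = \<epsilon> powr \<gamma> * \<epsilon> powr (1/p - \<gamma>)"
    using powr_add_split[of \<epsilon> \<gamma> "1/p"] assms exponents by simp
  also have "\<dots> \<le> \<epsilon> powr \<gamma> * E"
  proof -
    have "0 \<le> 1/p - \<gamma>" "1/p - \<gamma> \<le> 1" using exponents(5,6) p_inverse(2) by linarith+
    then show ?thesis using assms by (intro mult_left_mono powr_le_of_le_one_exponent) auto
  qed
  finally show ?thesis by (simp add: mult.commute)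
qed

text \<open>If the bases overlap, the two test functions coincide above the common part, and the unstable bound
  applies there. What remains are at most four end pieces, or two whole curves if the bases do not overlap, of
  base length at most \<open>\<epsilon>\<close>; each of them contributes \<open>\<epsilon>\<^bsup>1/p\<^esup>\<close> by the stable bound.\<close>

lemma bounds_imp_norm_u:
  assumes g: "curve_continuous g" and b: "stable_bound b g" "unstable_bound b g" "0 \<le> b"
  shows "norm_u H \<W> \<alpha> \<gamma> \<epsilon>0 g \<le> ereal (5 * \<sigma> * R * max 1 \<epsilon>0 * b)"
  unfolding norm_u_le_iff
proof (intro allI impI)
  fix \<epsilon> W1 W2 \<psi>1 \<psi>2
  assume \<epsilon>': "0 < \<epsilon>" "\<epsilon> \<le> \<epsilon>0" and W: "W1 \<in> \<W>" "W2 \<in> \<W>" and dist: "dist_Ws H W1 W2 \<le> ereal \<epsilon>"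
    and \<psi>: "holder_norm W1 \<alpha> \<psi>1 \<le> 1" "holder_norm W2 \<alpha> \<psi>2 \<le> 1" and d0: "dist_0 W1 W2 \<psi>1 \<psi>2 = 0"
  define E where "E = max 1 \<epsilon>0"
  define u1 u2 where "u1 = (\<lambda>r. \<psi>1 (graph_pt W1 r))" and "u2 = (\<lambda>r. \<psi>2 (graph_pt W2 r))"
  have \<epsilon>: "0 < \<epsilon>" "\<epsilon> \<le> \<epsilon>0" "\<epsilon> \<le> E" "1 \<le> E" using \<epsilon>' by (auto simp: E_def)
  note lohi = lo_less_hi[OF W(1)] lo_less_hi[OF W(2)]
  have ha: "holder_on (base W1) \<alpha> \<sigma> u1" "holder_on (base W2) \<alpha> \<sigma> u2"
    using holder_norm_le_imp_holder_on[of W1 \<alpha> \<psi>1 1] holder_norm_le_imp_holder_on[of W2 \<alpha> \<psi>2 1]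
      W \<psi> exponents by (auto simp: u1_def u2_def one_ereal_def)
  have hb: "holder_on (base W) \<beta> (\<sigma> * R) u" if "W \<in> \<W>" "holder_on (base W) \<alpha> \<sigma> u" for W u
    using R(1) R(2)[OF that(1)] exponents
    by (intro holder_on_lower_exponent[OF that(2)]) (auto simp: base_def)
  note hb1 = hb[OF W(1) ha(1)] and hb2 = hb[OF W(2) ha(2)]
  define \<mu> where "\<mu> = b * (\<sigma> * R) * E * \<epsilon> powr \<gamma>"
  have rem: "b * (\<sigma> * R) * x powr (1/p) \<le> \<mu>" if "0 \<le> x" "x \<le> \<epsilon>" for x
  proof -
    have "b * (\<sigma> * R) * x powr (1/p) \<le> b * (\<sigma> * R) * (E * \<epsilon> powr \<gamma>)"
      using powr_inverse_p_le[of x \<epsilon> E] that \<epsilon> b(3) \<sigma>_ge_one R(1) by (intro mult_left_mono) auto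
    then show ?thesis by (simp add: \<mu>_def mult_ac)
  qed
  have \<mu>0: "0 \<le> \<mu>" using rem[of 0] \<epsilon>(1) by simp
  define I1 I2 where "I1 = seg_int W1 (lo W1) (hi W1) g u1" and "I2 = seg_int W2 (lo W2) (hi W2) g u2"
  have "\<bar>I1 - I2\<bar> \<le> 5 * \<mu>"
    using W dist
  proof (cases rule: dist_Ws_cases)
    case short
    have "\<bar>I1\<bar> \<le> b * (\<sigma> * R) * (hi W1 - lo W1) powr (1/p)"
      unfolding I1_def using hb1 by (intro stable_boundD[OF b(1)] segment_whole W) (simp add: base_def)
    moreover have "\<bar>I2\<bar> \<le> b * (\<sigma> * R) * (hi W2 - lo W2) powr (1/p)"
      unfolding I2_def using hb2 by (intro stable_boundD[OF b(1)] segment_whole W) (simp add: base_def)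
    ultimately show ?thesis
      using rem[of "hi W1 - lo W1"] rem[of "hi W2 - lo W2"] short lohi \<mu>0 by linarith
  next
    case (overlapping x y)
    have xy: "x < y" using overlapping(1) by (simp add: near_def)
    have u12: "u1 r = u2 r" if "r \<in> {x..y}" for r
    proof -
      have "C0_norm {x..y} (\<lambda>r. u1 r - u2 r) \<le> ereal 0"
        using d0 by (simp add: dist_0_def overlapping(2) u1_def u2_def zero_ereal_def)
      then show ?thesis using that by (auto simp: C0_norm_le_iff)
    qed
    have "\<bar>I1 - seg_int W1 x y g u1\<bar> \<le> b * (\<sigma> * R) * ((x - lo W1) powr (1/p) + (hi W1 - y) powr (1/p))"
      unfolding I1_def using overlapping xy by (intro seg_int_remainder g b W hb1) auto
    then have 1: "\<bar>I1 - seg_int W1 x y g u1\<bar> \<le> 2 * \<mu>"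
      using rem[of "x - lo W1"] rem[of "hi W1 - y"] overlapping by (simp add: distrib_left)
    have "\<bar>I2 - seg_int W2 x y g u2\<bar> \<le> b * (\<sigma> * R) * ((x - lo W2) powr (1/p) + (hi W2 - y) powr (1/p))"
      unfolding I2_def using overlapping xy by (intro seg_int_remainder g b W hb2) auto
    then have 2: "\<bar>I2 - seg_int W2 x y g u2\<bar> \<le> 2 * \<mu>"
      using rem[of "x - lo W2"] rem[of "hi W2 - y"] overlapping by (simp add: distrib_left)
    have 3: "seg_int W2 x y g u2 = seg_int W2 x y g u1"
      using u12 by (intro seg_int_cong) simp
    have "\<bar>seg_int W1 x y g u1 - seg_int W2 x y g u1\<bar> \<le> b * \<sigma> * \<epsilon> powr \<gamma>"
      using overlapping
      by (intro unstable_boundD[OF b(2)] \<epsilon> holder_on_subset[OF ha(1)]) (auto simp: base_def)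
    also have "\<dots> \<le> \<mu>"
    proof -
      have "b * \<sigma> * \<epsilon> powr \<gamma> * 1 \<le> b * \<sigma> * \<epsilon> powr \<gamma> * (R * E)"
        using b(3) \<sigma>_ge_one mult_mono[OF R(1) \<epsilon>(4)] R(1) by (intro mult_left_mono) auto
      then show ?thesis by (simp add: \<mu>_def mult_ac)
    qed
    finally show ?thesis using 1 2 unfolding 3 by linarith
  qed
  then have "\<epsilon> powr (- \<gamma>) * \<bar>I1 - I2\<bar> \<le> \<epsilon> powr (- \<gamma>) * (5 * \<mu>)" by (intro mult_left_mono) auto
  also have "\<dots> = 5 * \<sigma> * R * max 1 \<epsilon>0 * b" using \<epsilon> by (simp add: \<mu>_def E_def powr_minus field_simps)
  finally show "\<epsilon> powr (- \<gamma>) * \<bar>curve_int W1 (\<lambda>x. g x * \<psi>1 x) - curve_int W2 (\<lambda>x. g x * \<psi>2 x)\<bar>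
      \<le> 5 * \<sigma> * R * max 1 \<epsilon>0 * b"
    by (simp add: curve_int_eq_seg_int I1_def I2_def u1_def u2_def)
qed

lemma norms_nonneg: "0 \<le> norm_s \<W> \<beta> p g" "0 \<le> norm_u H \<W> \<alpha> \<gamma> \<epsilon>0 g"
proof -
  obtain W where W: "W \<in> \<W>" using nonempty by blast
  have z: "lift (\<lambda>_. 0) = (\<lambda>_. 0)" by (simp add: lift_def)
  have h: "holder_norm W \<eta> (\<lambda>_. 0) \<le> 0" if "0 < \<eta>" for \<eta>
    using holder_on_imp_holder_norm_le[OF W that, of 0 "\<lambda>_. 0"] z
    by (simp add: holder_on_def zero_ereal_def)
  have int: "curve_int W (\<lambda>x. g x * 0) = 0" by (simp add: curve_int_def)
  have "(\<lambda>_. 0) \<in> {\<psi>. holder_norm W \<beta> \<psi> \<le> ereal (curve_len W powr (- (1/p)))}"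
    using h[of \<beta>] exponents(1) by (auto intro: order_trans)
  then have "ereal (curve_int W (\<lambda>x. g x * 0)) \<le> norm_s \<W> \<beta> p g"
    unfolding norm_s_def by (intro SUP_upper2[OF W] SUP_upper)
  then show "0 \<le> norm_s \<W> \<beta> p g" unfolding int by (simp add: zero_ereal_def)
  have d: "dist_Ws H W W \<le> ereal \<epsilon>0"
    unfolding dist_Ws_le_iff using in_strip[OF W] \<epsilon>0_pos lo_less_hi[OF W]
    by (auto intro!: exI[of _ 0] simp: sym_diff_measure_eq)
  have d0: "dist_0 W W (\<lambda>_. 0) (\<lambda>_. 0) = 0"
    using C0_norm_nonneg by (intro antisym) (auto simp: dist_0_def zero_ereal_def C0_norm_le_iff)
  have h1: "holder_norm W \<alpha> (\<lambda>_. 0) \<le> 1"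
    using h[of \<alpha>] exponents(1,2) by (auto intro: order_trans)
  show "0 \<le> norm_u H \<W> \<alpha> \<gamma> \<epsilon>0 g"
    unfolding norm_u_def
    by (rule SUP_upper2[of \<epsilon>0], use \<epsilon>0_pos in simp,
        rule SUP_upper2[of "(W, W)"], use W d in simp, unfold prod.case,
        rule SUP_upper2[of "(\<lambda>_. 0, \<lambda>_. 0)"], use h1 d0 in simp, simp)
qed

lemma norm_B_imp_bounds:
  assumes le: "norm_B H \<W> \<alpha> \<beta> \<gamma> p \<epsilon>0 cu g \<le> ereal b"
  shows "stable_bound (2 * \<sigma> * b) g" "unstable_bound (2 * (b / cu)) g"
proof -
  have s: "norm_s \<W> \<beta> p g \<le> ereal b"
  proof -
    have "0 \<le> ereal cu * norm_u H \<W> \<alpha> \<gamma> \<epsilon>0 g" using norms_nonneg(2)[of g] cu_pos by simp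
    then have "norm_s \<W> \<beta> p g + 0 \<le> norm_B H \<W> \<alpha> \<beta> \<gamma> p \<epsilon>0 cu g"
      unfolding norm_B_def by (rule add_left_mono)
    then show ?thesis using le by simp
  qed
  have "ereal cu * norm_u H \<W> \<alpha> \<gamma> \<epsilon>0 g \<le> ereal b"
  proof -
    have "0 + ereal cu * norm_u H \<W> \<alpha> \<gamma> \<epsilon>0 g \<le> norm_B H \<W> \<alpha> \<beta> \<gamma> p \<epsilon>0 cu g"
      unfolding norm_B_def using norms_nonneg(1)[of g] by (rule add_right_mono)
    then show ?thesis using le by simp
  qed
  then have u: "norm_u H \<W> \<alpha> \<gamma> \<epsilon>0 g \<le> ereal (b / cu)"
    using cu_pos norms_nonneg(2)[of g]
    by (cases "norm_u H \<W> \<alpha> \<gamma> \<epsilon>0 g") (simp_all add: field_simps)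
  show "stable_bound (2 * \<sigma> * b) g" "unstable_bound (2 * (b / cu)) g"
    using norm_s_imp_stable_bound[OF s] norm_u_imp_unstable_bound[OF u] by auto
qed

lemma bounds_imp_norm_B:
  assumes "curve_continuous g" "stable_bound b g" "unstable_bound b g" "0 \<le> b"
  shows "norm_B H \<W> \<alpha> \<beta> \<gamma> p \<epsilon>0 cu g \<le> ereal ((\<sigma> + cu * (5 * \<sigma> * R * max 1 \<epsilon>0)) * b)"
proof -
  have "norm_B H \<W> \<alpha> \<beta> \<gamma> p \<epsilon>0 cu g \<le> ereal (\<sigma> * b) + ereal cu * ereal (5 * \<sigma> * R * max 1 \<epsilon>0 * b)"
    unfolding norm_B_def using cu_pos
    by (intro add_mono stable_bound_imp_norm_s ereal_mult_left_mono bounds_imp_norm_u assms) auto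
  then show ?thesis by (simp add: algebra_simps)
qed

end

section \<open>The cone conditions with a real witness\<close>

locale cone_setting = norm_setting H \<W> D \<Lambda> R \<alpha> \<beta> \<gamma> p \<epsilon>0 cu
  for H :: "pt set set" and \<W> :: "curve set" and D \<Lambda> R \<alpha> \<beta> \<gamma> p \<epsilon>0 cu :: real +
  fixes M :: "pt set" and a c A L \<delta> :: real
  assumes constants: "1 < a" "2 < A" "1 < L" "1 + \<sigma> < A * c" "0 < \<delta>"
    and \<delta>_small: "2 * \<delta> \<le> 1" "\<delta> < \<epsilon>0" "4 * \<Lambda> * (2 * \<delta>) powr (1 - \<alpha>) \<le> 1"
    and scale_nonempty: "scale_curves \<W> \<delta> \<noteq> {}"
    and curves_in_M: "W \<in> \<W> \<Longrightarrow> curve_set W \<subseteq> M"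
begin

text \<open>The cone conditions with a number \<open>m\<close> in the role of \<open>|||f|||\<^sub>-\<close>. Here \<open>m\<close> is at
  most \<open>|||f|||\<^sub>-\<close>, and the right-hand sides are increasing in \<open>m\<close>, so that the conditions with any such \<open>m\<close>
  imply the original ones; in this form they are inequalities between real numbers and evidently
  additive.\<close>

definition cone_at :: "real \<Rightarrow> (pt \<Rightarrow> real) \<Rightarrow> bool" where
  "cone_at m f \<longleftrightarrow> 0 \<le> m \<and>
     (\<forall>W\<in>scale_curves \<W> \<delta>. \<forall>\<psi>\<in>test_densities a \<beta> W.
        m \<le> curve_int W (\<lambda>x. f x * \<psi> x) / curve_int W \<psi> \<and>
        \<bar>curve_int W (\<lambda>x. f x * \<psi> x)\<bar> / curve_int W \<psi> \<le> L * m) \<and>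
     (\<forall>W\<in>short_curves \<W> \<delta>. \<forall>\<psi>\<in>test_densities a \<beta> W.
        curve_len W powr (- (1/p)) * (\<bar>curve_int W (\<lambda>x. f x * \<psi> x)\<bar> / curve_avg W \<psi>)
          \<le> A * \<delta> powr (1 - 1/p) * m) \<and>
     (\<forall>W1\<in>short_curves \<W> \<delta>. \<forall>W2\<in>short_curves \<W> \<delta>. dist_Ws H W1 W2 \<le> ereal \<delta> \<longrightarrow>
        (\<forall>\<psi>1\<in>test_densities a \<alpha> W1. \<forall>\<psi>2\<in>test_densities a \<alpha> W2. dist_star W1 W2 \<psi>1 \<psi>2 = 0 \<longrightarrow>
           \<bar>curve_int W1 (\<lambda>x. f x * \<psi>1 x) / curve_avg W1 \<psi>1
              - curve_int W2 (\<lambda>x. f x * \<psi>2 x) / curve_avg W2 \<psi>2\<bar>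
           \<le> real_of_ereal (dist_Ws H W1 W2) powr \<gamma> * \<delta> powr (1 - \<gamma>) * c * A * m))"

lemma short_curvesD:
  assumes "W \<in> short_curves \<W> \<delta>"
  shows "W \<in> \<W>" "curve_len W \<le> 2 * \<delta>" "curve_len W \<le> 1"
  using assms \<delta>_small by (auto simp: short_curves_def)

lemma scale_imp_short: "W \<in> scale_curves \<W> \<delta> \<Longrightarrow> W \<in> short_curves \<W> \<delta>"
  by (simp add: scale_curves_def short_curves_def)

lemma density_integral_pos:
  assumes "W \<in> short_curves \<W> \<delta>" "\<psi> \<in> test_densities a \<eta> W" "0 < \<eta>" "\<eta> \<le> 1"
  shows "0 < curve_avg W \<psi>" "0 < curve_int W \<psi>" "curve_int W \<psi> = curve_avg W \<psi> * curve_len W"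
proof -
  note W = short_curvesD[OF assms(1)]
  show 1: "0 < curve_avg W \<psi>"
    using density_compare_average(1)[OF W(1,3) _ assms(3,4,2)] constants by simp
  show 2: "curve_int W \<psi> = curve_avg W \<psi> * curve_len W"
    using curve_len_bounds[OF W(1)] by (simp add: curve_avg_def)
  show "0 < curve_int W \<psi>" unfolding 2 using 1 curve_len_bounds[OF W(1)] by simp
qed

lemma \<beta>_range: "0 < \<beta>" "\<beta> \<le> 1" "0 < \<alpha>" "\<alpha> \<le> 1" "\<beta> \<le> \<alpha>"
  using exponents by auto

lemma cone_atD:
  assumes "cone_at m f"
  shows "0 \<le> m"
    and "W \<in> scale_curves \<W> \<delta> \<Longrightarrow> \<psi> \<in> test_densities a \<beta> W \<Longrightarrow>
        m \<le> curve_int W (\<lambda>x. f x * \<psi> x) / curve_int W \<psi>"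
    and "W \<in> scale_curves \<W> \<delta> \<Longrightarrow> \<psi> \<in> test_densities a \<beta> W \<Longrightarrow>
        \<bar>curve_int W (\<lambda>x. f x * \<psi> x)\<bar> / curve_int W \<psi> \<le> L * m"
    and "W \<in> short_curves \<W> \<delta> \<Longrightarrow> \<psi> \<in> test_densities a \<beta> W \<Longrightarrow>
        curve_len W powr (- (1/p)) * (\<bar>curve_int W (\<lambda>x. f x * \<psi> x)\<bar> / curve_avg W \<psi>)
          \<le> A * \<delta> powr (1 - 1/p) * m"
    and "W1 \<in> short_curves \<W> \<delta> \<Longrightarrow> W2 \<in> short_curves \<W> \<delta> \<Longrightarrow> dist_Ws H W1 W2 \<le> ereal \<delta> \<Longrightarrow>
        \<psi>1 \<in> test_densities a \<alpha> W1 \<Longrightarrow> \<psi>2 \<in> test_densities a \<alpha> W2 \<Longrightarrow> dist_star W1 W2 \<psi>1 \<psi>2 = 0 \<Longrightarrow>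
        \<bar>curve_int W1 (\<lambda>x. f x * \<psi>1 x) / curve_avg W1 \<psi>1
              - curve_int W2 (\<lambda>x. f x * \<psi>2 x) / curve_avg W2 \<psi>2\<bar>
           \<le> real_of_ereal (dist_Ws H W1 W2) powr \<gamma> * \<delta> powr (1 - \<gamma>) * c * A * m"
  using assms unfolding cone_at_def by blast+

abbreviation the_cone :: "(pt \<Rightarrow> real) set" where
  "the_cone \<equiv> billiard_cone M H \<W> \<alpha> \<beta> \<gamma> (1/p) a c A L \<delta>"

lemma curve_int_zero:
  assumes "W \<in> \<W>" "\<forall>x\<in>M. f x = 0"
  shows "curve_int W (\<lambda>x. f x * \<psi> x) = 0"
proof -
  have "f (graph_pt W r) = 0" if "r \<in> base W" for r
    using curves_in_M[OF assms(1)] assms(2) that by (auto simp: curve_set_def)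
  then have "curve_int W (\<lambda>x. f x * \<psi> x) = integral (base W) (\<lambda>r. 0)"
    unfolding curve_int_def by (intro integral_cong) simp
  then show ?thesis by simp
qed

text \<open>The witness is \<open>|||f|||\<^sub>-\<close>, which is finite because there are curves of length between \<open>\<delta>\<close> and
  \<open>2 \<delta>\<close>, and nonnegative because \<open>|||f|||\<^sub>+\<close> is.\<close>

lemma cone_imp_cone_at:
  assumes "f \<in> the_cone \<or> (\<forall>x\<in>M. f x = 0)"
  shows "\<exists>m. cone_at m f"
  using assms
proof
  assume 0: "\<forall>x\<in>M. f x = 0"
  have "W \<in> \<W>" if "W \<in> short_curves \<W> \<delta>" for W using short_curvesD[OF that] by simp
  moreover have "W \<in> \<W>" if "W \<in> scale_curves \<W> \<delta>" for W
    using short_curvesD[OF scale_imp_short[OF that]] by simp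
  ultimately have "cone_at 0 f" unfolding cone_at_def by (simp add: curve_int_zero[OF _ 0])
  then show ?thesis ..
next
  assume f: "f \<in> the_cone"
  define Tp Tm where "Tp = triple_plus \<W> a \<beta> \<delta> f" and "Tm = triple_minus \<W> a \<beta> \<delta> f"
  obtain W0 where W0: "W0 \<in> scale_curves \<W> \<delta>" using scale_nonempty by blast
  have one: "(\<lambda>_. 1) \<in> test_densities a \<beta> W0"
    using const_test_density[of W0 1 a \<beta>] short_curvesD[OF scale_imp_short[OF W0]] constants \<beta>_range
    by simp
  have pos: "0 < curve_int W0 (\<lambda>_. 1)"
    using density_integral_pos[OF scale_imp_short[OF W0] one] \<beta>_range by simp
  have T: "ereal (\<bar>curve_int W0 (\<lambda>x. f x * 1)\<bar> / curve_int W0 (\<lambda>_. 1)) \<le> Tp"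
    unfolding Tp_def triple_plus_def using W0 one by (intro SUP_upper2[OF W0] SUP_upper)
  have Tp0: "0 \<le> Tp" using pos by (intro order_trans[OF _ T]) simp
  have Tm_le: "Tm \<le> ereal (curve_int W0 (\<lambda>x. f x * 1) / curve_int W0 (\<lambda>_. 1))"
    unfolding Tm_def triple_minus_def using W0 one by (intro INF_lower2[OF W0] INF_lower)
  have LTm: "Tp \<le> ereal L * Tm" using f by (simp add: billiard_cone_def Tp_def Tm_def)
  have "0 \<le> ereal L * Tm" using Tp0 LTm by (rule order_trans)
  then have "0 \<le> Tm" using constants by (cases Tm) (auto simp: zero_le_mult_iff)
  then obtain m where m: "Tm = ereal m" "0 \<le> m" using Tm_le by (cases Tm) auto
  have "cone_at m f"
    unfolding cone_at_def
  proof (intro conjI ballI impI)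
    show "0 \<le> m" by fact
  next
    fix W \<psi> assume W: "W \<in> scale_curves \<W> \<delta>" and \<psi>: "\<psi> \<in> test_densities a \<beta> W"
    have "Tm \<le> ereal (curve_int W (\<lambda>x. f x * \<psi> x) / curve_int W \<psi>)"
      unfolding Tm_def triple_minus_def using W \<psi> by (intro INF_lower2[OF W] INF_lower)
    then show "m \<le> curve_int W (\<lambda>x. f x * \<psi> x) / curve_int W \<psi>" by (simp add: m)
    have "ereal (\<bar>curve_int W (\<lambda>x. f x * \<psi> x)\<bar> / curve_int W \<psi>) \<le> Tp"
      unfolding Tp_def triple_plus_def using W \<psi> by (intro SUP_upper2[OF W] SUP_upper)
    also note LTm
    finally show "\<bar>curve_int W (\<lambda>x. f x * \<psi> x)\<bar> / curve_int W \<psi> \<le> L * m" by (simp add: m)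
  next
    fix W \<psi> assume W: "W \<in> short_curves \<W> \<delta>" and \<psi>: "\<psi> \<in> test_densities a \<beta> W"
    have "(SUP W\<in>short_curves \<W> \<delta>. SUP \<psi>\<in>test_densities a \<beta> W.
        ereal (curve_len W powr (- (1/p)) * (\<bar>curve_int W (\<lambda>x. f x * \<psi> x)\<bar> / curve_avg W \<psi>)))
       \<le> ereal (A * \<delta> powr (1 - 1/p)) * Tm"
      using f unfolding billiard_cone_def Tm_def by blast
    then have "ereal (curve_len W powr (- (1/p)) * (\<bar>curve_int W (\<lambda>x. f x * \<psi> x)\<bar> / curve_avg W \<psi>))
       \<le> ereal (A * \<delta> powr (1 - 1/p)) * Tm"
      using W \<psi> unfolding SUP_le_iff by blast
    then show "curve_len W powr (- (1/p)) * (\<bar>curve_int W (\<lambda>x. f x * \<psi> x)\<bar> / curve_avg W \<psi>)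
       \<le> A * \<delta> powr (1 - 1/p) * m" by (simp add: m)
  next
    fix W1 W2 \<psi>1 \<psi>2
    assume "W1 \<in> short_curves \<W> \<delta>" "W2 \<in> short_curves \<W> \<delta>" "dist_Ws H W1 W2 \<le> ereal \<delta>"
      "\<psi>1 \<in> test_densities a \<alpha> W1" "\<psi>2 \<in> test_densities a \<alpha> W2" "dist_star W1 W2 \<psi>1 \<psi>2 = 0"
    then have "ereal \<bar>curve_int W1 (\<lambda>x. f x * \<psi>1 x) / curve_avg W1 \<psi>1
              - curve_int W2 (\<lambda>x. f x * \<psi>2 x) / curve_avg W2 \<psi>2\<bar>
           \<le> ereal (real_of_ereal (dist_Ws H W1 W2) powr \<gamma> * \<delta> powr (1 - \<gamma>) * c * A) * Tm"
      using f unfolding billiard_cone_def Tm_def by blast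
    then show "\<bar>curve_int W1 (\<lambda>x. f x * \<psi>1 x) / curve_avg W1 \<psi>1
              - curve_int W2 (\<lambda>x. f x * \<psi>2 x) / curve_avg W2 \<psi>2\<bar>
           \<le> real_of_ereal (dist_Ws H W1 W2) powr \<gamma> * \<delta> powr (1 - \<gamma>) * c * A * m"
      by (simp add: m)
  qed
  then show ?thesis ..
qed

lemma c_pos: "0 < c"
  using constants \<sigma>_ge_one zero_less_mult_pos[of A c] by simp

lemma cone_at_imp_cone:
  assumes f: "curve_continuous f" and m: "cone_at m f"
  shows "f \<in> the_cone \<or> (\<forall>x\<in>M. f x = 0)"
proof (cases "\<forall>x\<in>M. f x = 0")
  case False
  have plus: "triple_plus \<W> a \<beta> \<delta> f \<le> ereal (L * m)"
    unfolding triple_plus_def using cone_atD(3)[OF m] by (intro SUP_least) simp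
  have minus: "ereal m \<le> triple_minus \<W> a \<beta> \<delta> f"
    unfolding triple_minus_def using cone_atD(2)[OF m] by (intro INF_greatest) simp
  have mono: "ereal (k * m) \<le> ereal k * triple_minus \<W> a \<beta> \<delta> f" if "0 \<le> k" for k
    using ereal_mult_left_mono[OF minus, of "ereal k"] that by simp
  have "f \<in> cone_domain \<W> a \<beta> \<delta>"
    unfolding cone_domain_def mem_Collect_eq
  proof (intro conjI ballI)
    fix W assume "W \<in> short_curves \<W> \<delta>"
    then have W: "W \<in> \<W>" by (rule short_curvesD)
    then have "continuous_on {lo W..hi W} (\<lambda>r. f (graph_pt W r) * speed W r)"
      using f speed_continuous_on[OF W] unfolding curve_continuous_def base_def
      by (intro continuous_on_mult) auto
    then show "(\<lambda>r. f (graph_pt W r) * speed W r) absolutely_integrable_on base W"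
      unfolding base_def by (rule absolutely_integrable_continuous_real)
  next
    show "triple_plus \<W> a \<beta> \<delta> f < \<infinity>" using plus by (rule order_le_less_trans) simp
  qed
  moreover have "triple_plus \<W> a \<beta> \<delta> f \<le> ereal L * triple_minus \<W> a \<beta> \<delta> f"
    using plus mono[of L] constants by (auto intro: order_trans)
  moreover have "(SUP W\<in>short_curves \<W> \<delta>. SUP \<psi>\<in>test_densities a \<beta> W.
        ereal (curve_len W powr (- (1/p)) * (\<bar>curve_int W (\<lambda>x. f x * \<psi> x)\<bar> / curve_avg W \<psi>)))
       \<le> ereal (A * \<delta> powr (1 - 1/p)) * triple_minus \<W> a \<beta> \<delta> f"
  proof (intro SUP_least)
    fix W \<psi> assume "W \<in> short_curves \<W> \<delta>" "\<psi> \<in> test_densities a \<beta> W"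
    from cone_atD(4)[OF m this]
    have "ereal (curve_len W powr (- (1/p)) * (\<bar>curve_int W (\<lambda>x. f x * \<psi> x)\<bar> / curve_avg W \<psi>))
        \<le> ereal (A * \<delta> powr (1 - 1/p) * m)" by (simp only: ereal_less_eq)
    also have "\<dots> \<le> ereal (A * \<delta> powr (1 - 1/p)) * triple_minus \<W> a \<beta> \<delta> f"
      using constants by (intro mono) simp
    finally show "ereal (curve_len W powr (- (1/p)) * (\<bar>curve_int W (\<lambda>x. f x * \<psi> x)\<bar> / curve_avg W \<psi>))
        \<le> ereal (A * \<delta> powr (1 - 1/p)) * triple_minus \<W> a \<beta> \<delta> f" .
  qed
  moreover have "ereal \<bar>curve_int W1 (\<lambda>x. f x * \<psi>1 x) / curve_avg W1 \<psi>1
              - curve_int W2 (\<lambda>x. f x * \<psi>2 x) / curve_avg W2 \<psi>2\<bar>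
           \<le> ereal (real_of_ereal (dist_Ws H W1 W2) powr \<gamma> * \<delta> powr (1 - \<gamma>) * c * A)
              * triple_minus \<W> a \<beta> \<delta> f"
    if "W1 \<in> short_curves \<W> \<delta>" "W2 \<in> short_curves \<W> \<delta>" "dist_Ws H W1 W2 \<le> ereal \<delta>"
      "\<psi>1 \<in> test_densities a \<alpha> W1" "\<psi>2 \<in> test_densities a \<alpha> W2" "dist_star W1 W2 \<psi>1 \<psi>2 = 0"
    for W1 W2 \<psi>1 \<psi>2
    using constants c_pos
    by (intro order_trans[OF _ mono]) (use cone_atD(5)[OF m that] in auto)
  ultimately show ?thesis using False unfolding billiard_cone_def by blast
qed simp

lemma curve_int_add_left:
  assumes "curve_continuous f" "curve_continuous f'" "W \<in> \<W>" "\<psi> \<in> test_densities a \<eta> W"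
  shows "curve_int W (\<lambda>x. (f x + f' x) * \<psi> x) = curve_int W (\<lambda>x. f x * \<psi> x) + curve_int W (\<lambda>x. f' x * \<psi> x)"
  unfolding curve_int_eq_seg_int
  using test_densitiesD(1)[OF assms(3,4)]
  by (intro seg_int_add_left segment_whole assms) (simp add: base_def)

lemma cone_at_add:
  assumes f: "curve_continuous f" "curve_continuous f'" and m: "cone_at m f" "cone_at m' f'"
  shows "cone_at (m + m') (\<lambda>x. f x + f' x)"
  unfolding cone_at_def
proof (intro conjI ballI impI)
  show "0 \<le> m + m'" using cone_atD(1)[OF m(1)] cone_atD(1)[OF m(2)] by simp
next
  fix W \<psi> assume W: "W \<in> scale_curves \<W> \<delta>" and \<psi>: "\<psi> \<in> test_densities a \<beta> W"
  have add: "curve_int W (\<lambda>x. (f x + f' x) * \<psi> x) = curve_int W (\<lambda>x. f x * \<psi> x) + curve_int W (\<lambda>x. f' x * \<psi> x)"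
    using short_curvesD[OF scale_imp_short[OF W]] by (intro curve_int_add_left[OF f _ \<psi>])
  have pos: "0 < curve_int W \<psi>"
    using density_integral_pos[OF scale_imp_short[OF W] \<psi>] \<beta>_range by simp
  show "m + m' \<le> curve_int W (\<lambda>x. (f x + f' x) * \<psi> x) / curve_int W \<psi>"
    using cone_atD(2)[OF m(1) W \<psi>] cone_atD(2)[OF m(2) W \<psi>] by (simp add: add add_divide_distrib)
  have "\<bar>curve_int W (\<lambda>x. (f x + f' x) * \<psi> x)\<bar> / curve_int W \<psi> \<le>
      \<bar>curve_int W (\<lambda>x. f x * \<psi> x)\<bar> / curve_int W \<psi> + \<bar>curve_int W (\<lambda>x. f' x * \<psi> x)\<bar> / curve_int W \<psi>"
    unfolding add add_divide_distrib[symmetric] using pos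
    by (intro divide_right_mono abs_triangle_ineq) simp
  then show "\<bar>curve_int W (\<lambda>x. (f x + f' x) * \<psi> x)\<bar> / curve_int W \<psi> \<le> L * (m + m')"
    using cone_atD(3)[OF m(1) W \<psi>] cone_atD(3)[OF m(2) W \<psi>] by (simp add: distrib_left)
next
  fix W \<psi> assume W: "W \<in> short_curves \<W> \<delta>" and \<psi>: "\<psi> \<in> test_densities a \<beta> W"
  have add: "curve_int W (\<lambda>x. (f x + f' x) * \<psi> x) = curve_int W (\<lambda>x. f x * \<psi> x) + curve_int W (\<lambda>x. f' x * \<psi> x)"
    using short_curvesD[OF W] by (intro curve_int_add_left[OF f _ \<psi>])
  have pos: "0 < curve_avg W \<psi>"
    using density_integral_pos[OF W \<psi>] \<beta>_range by simp
  have "curve_len W powr (- (1/p)) * (\<bar>curve_int W (\<lambda>x. (f x + f' x) * \<psi> x)\<bar> / curve_avg W \<psi>) \<le>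
      curve_len W powr (- (1/p)) * (\<bar>curve_int W (\<lambda>x. f x * \<psi> x)\<bar> / curve_avg W \<psi>
        + \<bar>curve_int W (\<lambda>x. f' x * \<psi> x)\<bar> / curve_avg W \<psi>)"
    unfolding add add_divide_distrib[symmetric] using pos
    by (intro mult_left_mono divide_right_mono abs_triangle_ineq) simp_all
  then show "curve_len W powr (- (1/p)) * (\<bar>curve_int W (\<lambda>x. (f x + f' x) * \<psi> x)\<bar> / curve_avg W \<psi>)
      \<le> A * \<delta> powr (1 - 1/p) * (m + m')"
    using cone_atD(4)[OF m(1) W \<psi>] cone_atD(4)[OF m(2) W \<psi>] by (simp add: distrib_left)
next
  fix W1 W2 \<psi>1 \<psi>2
  assume *: "W1 \<in> short_curves \<W> \<delta>" "W2 \<in> short_curves \<W> \<delta>" "dist_Ws H W1 W2 \<le> ereal \<delta>"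
      "\<psi>1 \<in> test_densities a \<alpha> W1" "\<psi>2 \<in> test_densities a \<alpha> W2" "dist_star W1 W2 \<psi>1 \<psi>2 = 0"
  have add: "curve_int W1 (\<lambda>x. (f x + f' x) * \<psi>1 x) = curve_int W1 (\<lambda>x. f x * \<psi>1 x) + curve_int W1 (\<lambda>x. f' x * \<psi>1 x)"
    "curve_int W2 (\<lambda>x. (f x + f' x) * \<psi>2 x) = curve_int W2 (\<lambda>x. f x * \<psi>2 x) + curve_int W2 (\<lambda>x. f' x * \<psi>2 x)"
    using curve_int_add_left[OF f _ *(4)] curve_int_add_left[OF f _ *(5)]
      short_curvesD[OF *(1)] short_curvesD[OF *(2)] by auto
  show "\<bar>curve_int W1 (\<lambda>x. (f x + f' x) * \<psi>1 x) / curve_avg W1 \<psi>1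
              - curve_int W2 (\<lambda>x. (f x + f' x) * \<psi>2 x) / curve_avg W2 \<psi>2\<bar>
           \<le> real_of_ereal (dist_Ws H W1 W2) powr \<gamma> * \<delta> powr (1 - \<gamma>) * c * A * (m + m')"
    using cone_atD(5)[OF m(1) *] cone_atD(5)[OF m(2) *]
    unfolding add add_divide_distrib distrib_left by linarith
qed

text \<open>Test the sum with the density 1. Applied to \<open>t + g\<close> and \<open>t - g\<close> this bounds both witnesses by \<open>2 t\<close>.\<close>

lemma cone_at_opposite:
  assumes f: "curve_continuous f" "curve_continuous f'" and m: "cone_at m f" "cone_at m' f'"
    and sum: "\<And>x. f x + f' x = k"
  shows "m + m' \<le> k"
proof -
  obtain W where W: "W \<in> scale_curves \<W> \<delta>" using scale_nonempty by blast
  note short = scale_imp_short[OF W]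
  have one: "(\<lambda>_. 1) \<in> test_densities a \<beta> W"
    using const_test_density[of W 1 a \<beta>] short_curvesD[OF short] constants \<beta>_range by simp
  have "m + m' \<le> curve_int W (\<lambda>x. (f x + f' x) * 1) / curve_int W (\<lambda>_. 1)"
    by (rule cone_atD(2)[OF cone_at_add[OF f m] W one])
  also have "curve_int W (\<lambda>x. (f x + f' x) * 1) = k * curve_int W (\<lambda>_. 1)"
    by (simp add: curve_int_def sum)
  finally show ?thesis using density_integral_pos(2)[OF short one] \<beta>_range by simp
qed

end

section \<open>Averages on neighbouring curves\<close>

context curve_family
begin

lemma seg_int_one_remainder:
  assumes W: "W \<in> \<W>" and xy: "lo W \<le> x" "x \<le> y" "y \<le> hi W" and u: "continuous_on (base W) u"
    and bounds: "\<And>r. r \<in> base W \<Longrightarrow> 0 \<le> u r" "\<And>r. r \<in> base W \<Longrightarrow> u r \<le> k"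
  shows "seg_int W x y (\<lambda>_. 1) u \<le> seg_int W (lo W) (hi W) (\<lambda>_. 1) u"
    and "seg_int W (lo W) (hi W) (\<lambda>_. 1) u - seg_int W x y (\<lambda>_. 1) u
      \<le> k * (\<sigma> * ((hi W - lo W) - (y - x)))"
proof -
  have cont: "continuous_on {p..q} u" if "lo W \<le> p" "q \<le> hi W" for p q
    using that by (intro continuous_on_subset[OF u]) (auto simp: base_def)
  have seg: "segment W (lo W) (hi W)" "segment W (lo W) x" "segment W x (hi W)" "segment W y (hi W)"
    using W xy by (auto simp: segment_def)
  have "lo W \<in> base W" using lo_less_hi[OF W] by (simp add: base_def)
  then have k: "0 \<le> k" using bounds by force
  have small: "0 \<le> seg_int W p q (\<lambda>_. 1) u" "seg_int W p q (\<lambda>_. 1) u \<le> k * (\<sigma> * (q - p))"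
    if s: "segment W p q" for p q
  proof -
    note s' = segmentD[OF s]
    have "seg_int W p q (\<lambda>_. 1) (\<lambda>_. 0) \<le> seg_int W p q (\<lambda>_. 1) u"
      using s' bounds(1) by (intro seg_int_one_mono s cont) auto
    then show "0 \<le> seg_int W p q (\<lambda>_. 1) u" by (simp add: seg_int_def)
    have "seg_int W p q (\<lambda>_. 1) u \<le> seg_int W p q (\<lambda>_. 1) (\<lambda>_. k)"
      using s' bounds(2) by (intro seg_int_one_mono s cont) auto
    also have "\<dots> \<le> k * (\<sigma> * (q - p))" using k by (intro seg_int_one_const s)
    finally show "seg_int W p q (\<lambda>_. 1) u \<le> k * (\<sigma> * (q - p))" .
  qed
  have "seg_int W (lo W) (hi W) (\<lambda>_. 1) u = seg_int W (lo W) x (\<lambda>_. 1) u + seg_int W x (hi W) (\<lambda>_. 1) u"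
    using xy by (intro seg_int_split[OF seg(1)] cont) auto
  also have "seg_int W x (hi W) (\<lambda>_. 1) u = seg_int W x y (\<lambda>_. 1) u + seg_int W y (hi W) (\<lambda>_. 1) u"
    using xy by (intro seg_int_split[OF seg(3)] cont) auto
  finally have eq: "seg_int W (lo W) (hi W) (\<lambda>_. 1) u - seg_int W x y (\<lambda>_. 1) u =
      seg_int W (lo W) x (\<lambda>_. 1) u + seg_int W y (hi W) (\<lambda>_. 1) u" by simp
  show "seg_int W x y (\<lambda>_. 1) u \<le> seg_int W (lo W) (hi W) (\<lambda>_. 1) u"
    using eq small(1)[OF seg(2)] small(1)[OF seg(4)] by linarith
  have "k * (\<sigma> * (x - lo W)) + k * (\<sigma> * (hi W - y)) = k * (\<sigma> * ((hi W - lo W) - (y - x)))"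
    by (simp add: algebra_simps)
  then show "seg_int W (lo W) (hi W) (\<lambda>_. 1) u - seg_int W x y (\<lambda>_. 1) u
      \<le> k * (\<sigma> * ((hi W - lo W) - (y - x)))"
    using eq small(2)[OF seg(2)] small(2)[OF seg(4)] by linarith
qed

lemma seg_int_one_near:
  assumes near: "near \<epsilon> W1 W2 x y"
  shows "\<bar>seg_int W1 x y (\<lambda>_. 1) (\<lambda>_. 1) - seg_int W2 x y (\<lambda>_. 1) (\<lambda>_. 1)\<bar> \<le> \<epsilon> * (y - x)"
proof -
  have seg: "segment W1 x y" "segment W2 x y" and xy: "x < y" using near by (auto simp: near_def)
  have int: "speed W1 integrable_on {x..y}" "speed W2 integrable_on {x..y}"
    using seg_integrable[OF seg(1), of "\<lambda>_. 1" "\<lambda>_. 1"] seg_integrable[OF seg(2), of "\<lambda>_. 1" "\<lambda>_. 1"]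
    by auto
  have "norm (integral {x..y} (\<lambda>r. speed W1 r - speed W2 r)) \<le> integral {x..y} (\<lambda>_. \<epsilon>)"
    using near_speed[OF near] by (intro integral_norm_bound_integral integrable_diff int) auto
  then show ?thesis using xy by (simp add: integral_diff[OF int] seg_int_def mult.commute)
qed

text \<open>The lengths differ by the parts that are not above the common base, of length at most \<open>\<sigma> \<epsilon>\<close>, and by the
  difference of the arclength elements above it, at most \<open>\<epsilon>\<close>.\<close>

lemma curve_len_diff:
  assumes W: "W1 \<in> \<W>" "W2 \<in> \<W>" "curve_len W1 \<le> 1" and dist: "dist_Ws H W1 W2 \<le> ereal \<epsilon>"
    and \<epsilon>: "0 < \<epsilon>"
  shows "\<bar>curve_len W1 - curve_len W2\<bar> \<le> (1 + \<sigma>) * \<epsilon>"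
  using W(1,2) dist
proof (cases rule: dist_Ws_cases)
  case short
  have "curve_len W \<le> \<sigma> * \<epsilon>" if "W \<in> \<W>" "hi W - lo W \<le> \<epsilon>" for W
    using curve_len_bounds(2)[OF that(1)] mult_left_mono[OF that(2), of \<sigma>] \<sigma>_ge_one by linarith
  then have "curve_len W1 \<le> \<sigma> * \<epsilon>" "curve_len W2 \<le> \<sigma> * \<epsilon>" using short W by auto
  then show ?thesis
    using curve_len_bounds(3)[OF W(1)] curve_len_bounds(3)[OF W(2)] \<epsilon> unfolding distrib_right by linarith
next
  case (overlapping x y)
  have xy: "x < y" "y - x \<le> 1"
    using overlapping curve_len_bounds(1)[OF W(1)] W(3) by (auto simp: near_def)
  have rem: "seg_int W x y (\<lambda>_. 1) (\<lambda>_. 1) \<le> curve_len W"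
    "curve_len W \<le> seg_int W x y (\<lambda>_. 1) (\<lambda>_. 1) + \<sigma> * \<epsilon>"
    if W: "W \<in> \<W>" "lo W \<le> x" "y \<le> hi W" "(hi W - lo W) - (y - x) \<le> \<epsilon>" for W
  proof -
    have len: "curve_len W = seg_int W (lo W) (hi W) (\<lambda>_. 1) (\<lambda>_. 1)"
      using seg_int_one_const_whole[of W 1] by simp
    show "seg_int W x y (\<lambda>_. 1) (\<lambda>_. 1) \<le> curve_len W"
      unfolding len using W xy by (intro seg_int_one_remainder(1)[where k = 1]) auto
    have "seg_int W (lo W) (hi W) (\<lambda>_. 1) (\<lambda>_. 1) - seg_int W x y (\<lambda>_. 1) (\<lambda>_. 1)
        \<le> 1 * (\<sigma> * ((hi W - lo W) - (y - x)))"
      using W xy by (intro seg_int_one_remainder(2)) auto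
    then show "curve_len W \<le> seg_int W x y (\<lambda>_. 1) (\<lambda>_. 1) + \<sigma> * \<epsilon>"
      unfolding len using mult_left_mono[OF W(4), of \<sigma>] \<sigma>_ge_one by linarith
  qed
  have "\<bar>seg_int W1 x y (\<lambda>_. 1) (\<lambda>_. 1) - seg_int W2 x y (\<lambda>_. 1) (\<lambda>_. 1)\<bar> \<le> \<epsilon>"
    using seg_int_one_near[OF overlapping(1)] mult_left_mono[OF xy(2), of \<epsilon>] \<epsilon> by linarith
  then show ?thesis
    using rem[OF W(1)] rem[OF W(2)] overlapping unfolding distrib_right by linarith
qed

definition ratio_const :: "real \<Rightarrow> real" where
  "ratio_const a = 2 * density_const a * \<sigma> * (1 + density_const a) + (1 + \<sigma>)"

text \<open>Above the common base the two densities have the same integral. The remaining parts of the curves have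
  length of order \<open>\<epsilon>\<close>, and on them the densities are bounded by their averages, so that the total
  integrals agree up to a relative error of order \<open>\<epsilon>\<close> divided by the length of the base. The
  same holds for the lengths of the curves, hence for the averages.\<close>

lemma average_ratio:
  assumes W: "W1 \<in> \<W>" "W2 \<in> \<W>" "curve_len W1 \<le> 1" "curve_len W2 \<le> 1"
    and "1 \<le> a" "0 < \<eta>" "\<eta> \<le> 1"
    and \<psi>: "\<psi>1 \<in> test_densities a \<eta> W1" "\<psi>2 \<in> test_densities a \<eta> W2"
    and dist: "dist_Ws H W1 W2 \<le> ereal \<epsilon>" and \<epsilon>: "0 < \<epsilon>"
    and over: "lo W1 \<le> x" "lo W2 \<le> x" "x < y" "y \<le> hi W1" "y \<le> hi W2"
      "(hi W1 - lo W1) - (y - x) \<le> \<epsilon>" "(hi W2 - lo W2) - (y - x) \<le> \<epsilon>"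
    and eq: "\<And>r. r \<in> {x..y} \<Longrightarrow> \<psi>1 (graph_pt W1 r) * speed W1 r = \<psi>2 (graph_pt W2 r) * speed W2 r"
  shows "curve_avg W1 \<psi>1 / curve_avg W2 \<psi>2 \<le> density_const a"
    and "\<bar>1 - curve_avg W1 \<psi>1 / curve_avg W2 \<psi>2\<bar> \<le> ratio_const a * \<epsilon> / (y - x)"
proof -
  define v1 v2 where "v1 = curve_avg W1 \<psi>1" and "v2 = curve_avg W2 \<psi>2"
  define E where "E = density_const a"
  define u1 u2 where "u1 = (\<lambda>r. \<psi>1 (graph_pt W1 r))" and "u2 = (\<lambda>r. \<psi>2 (graph_pt W2 r))"
  note d1 = density_compare_average[OF W(1,3) assms(5,6,7) \<psi>(1), folded v1_def]
  note d2 = density_compare_average[OF W(2,4) assms(5,6,7) \<psi>(2), folded v2_def]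
  have E: "exp a \<le> E" "1 \<le> E" "\<sigma> * exp (2 * a) \<le> E" using density_const_ge[OF assms(5)] by (auto simp: E_def)
  have x: "x \<in> base W1" "x \<in> base W2" "x \<in> {x..y}" using over by (auto simp: base_def)
  have v: "0 < v1" "0 < v2" by (rule d1(1) d2(1))+
  have pos: "0 < u2 x" using test_densitiesD(2)[OF W(2) \<psi>(2) x(2)] by (simp add: u2_def)
  \<comment> \<open>Compare both averages with the values of the densities at the common point \<open>x\<close>.\<close>
  have "u1 x * 1 \<le> u1 x * speed W1 x"
    using speed_ge_one[of W1 x] test_densitiesD(2)[OF W(1) \<psi>(1) x(1)]
    by (intro mult_left_mono) (auto simp: u1_def)
  also have "\<dots> = u2 x * speed W2 x" using eq[OF x(3)] by (simp add: u1_def u2_def)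
  also have "\<dots> \<le> u2 x * \<sigma>" using speed_le[OF W(2) x(2)] pos by (intro mult_left_mono) auto
  also have "\<dots> \<le> (exp a * v2) * \<sigma>"
    using d2(2)[OF x(2)] \<sigma>_ge_one by (intro mult_right_mono) (auto simp: u2_def)
  finally have "exp a * u1 x \<le> exp a * ((exp a * v2) * \<sigma>)" by (intro mult_left_mono) auto
  then have "v1 \<le> exp a * ((exp a * v2) * \<sigma>)" using d1(3)[OF x(1)] unfolding u1_def by (rule order_trans[rotated])
  also have "\<dots> = (\<sigma> * exp (2 * a)) * v2" unfolding exp_double power2_eq_square by (simp add: mult_ac)
  also have "\<dots> \<le> E * v2" using E(3) v by (intro mult_right_mono) auto
  finally have v12: "v1 \<le> E * v2" .
  then show "curve_avg W1 \<psi>1 / curve_avg W2 \<psi>2 \<le> density_const a"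
    using v by (simp add: v1_def[symmetric] v2_def[symmetric] E_def field_simps)
  have J: "v1 * curve_len W1 = seg_int W1 (lo W1) (hi W1) (\<lambda>_. 1) u1"
    "v2 * curve_len W2 = seg_int W2 (lo W2) (hi W2) (\<lambda>_. 1) u2"
    using curve_len_bounds(3)[OF W(1)] curve_len_bounds(3)[OF W(2)]
    by (auto simp: v1_def v2_def u1_def u2_def curve_avg_def curve_int_eq_seg_int_one)
  have common: "seg_int W1 x y (\<lambda>_. 1) u1 = seg_int W2 x y (\<lambda>_. 1) u2"
    using eq unfolding seg_int_def u1_def u2_def by (intro integral_cong) simp
  have rem: "0 \<le> v * curve_len W - seg_int W x y (\<lambda>_. 1) u"
    "v * curve_len W - seg_int W x y (\<lambda>_. 1) u \<le> E * \<sigma> * \<epsilon> * v"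
    if W: "W \<in> \<W>" "lo W \<le> x" "y \<le> hi W" "(hi W - lo W) - (y - x) \<le> \<epsilon>"
      and J: "v * curve_len W = seg_int W (lo W) (hi W) (\<lambda>_. 1) u"
      and u: "continuous_on (base W) u" "\<And>r. r \<in> base W \<Longrightarrow> 0 < u r" "\<And>r. r \<in> base W \<Longrightarrow> u r \<le> exp a * v"
      and v: "0 < v" for W u v
  proof -
    have le: "exp a * v \<le> E * v" using E v by (intro mult_right_mono) auto
    have k: "\<And>r. r \<in> base W \<Longrightarrow> 0 \<le> u r" "\<And>r. r \<in> base W \<Longrightarrow> u r \<le> E * v"
      using u(2,3) le by (auto intro: less_imp_le order_trans)
    have "seg_int W (lo W) (hi W) (\<lambda>_. 1) u - seg_int W x y (\<lambda>_. 1) u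
        \<le> E * v * (\<sigma> * ((hi W - lo W) - (y - x)))"
      using W over(3) by (intro seg_int_one_remainder u k) auto
    also have "\<dots> \<le> E * v * (\<sigma> * \<epsilon>)"
      using W(4) E v \<sigma>_ge_one by (intro mult_left_mono) auto
    finally show "v * curve_len W - seg_int W x y (\<lambda>_. 1) u \<le> E * \<sigma> * \<epsilon> * v"
      using J by (simp add: mult_ac)
    have "seg_int W x y (\<lambda>_. 1) u \<le> seg_int W (lo W) (hi W) (\<lambda>_. 1) u"
      using W over(3) by (intro seg_int_one_remainder[where k = "E * v"] u k) auto
    then show "0 \<le> v * curve_len W - seg_int W x y (\<lambda>_. 1) u" using J by simp
  qed
  have r1: "0 \<le> v1 * curve_len W1 - seg_int W1 x y (\<lambda>_. 1) u1"
    "v1 * curve_len W1 - seg_int W1 x y (\<lambda>_. 1) u1 \<le> E * \<sigma> * \<epsilon> * v1"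
    using W over J(1) v test_densitiesD(1,2)[OF W(1) \<psi>(1)] d1(2)
    by (intro rem[of W1]; simp add: u1_def)+
  have r2: "0 \<le> v2 * curve_len W2 - seg_int W2 x y (\<lambda>_. 1) u2"
    "v2 * curve_len W2 - seg_int W2 x y (\<lambda>_. 1) u2 \<le> E * \<sigma> * \<epsilon> * v2"
    using W over J(2) v test_densitiesD(1,2)[OF W(2) \<psi>(2)] d2(2)
    by (intro rem[of W2]; simp add: u2_def)+
  define K where "K = E * \<sigma> * \<epsilon>"
  have K: "0 \<le> K" using E \<sigma>_ge_one \<epsilon> by (simp add: K_def)
  have Kv: "K * v1 \<le> K * (E * v2)" "0 \<le> K * v2" "0 \<le> K * v1"
    using K v v12 by (auto intro: mult_left_mono)
  have 1: "\<bar>v1 * curve_len W1 - v2 * curve_len W2\<bar> \<le> K * (1 + E) * v2"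
    using r1 r2 Kv common unfolding K_def[symmetric] by (simp add: distrib_right distrib_left mult_ac)
  have "v2 * \<bar>curve_len W1 - curve_len W2\<bar> \<le> v2 * ((1 + \<sigma>) * \<epsilon>)"
    using curve_len_diff[OF W(1,2,3) dist \<epsilon>] v by (intro mult_left_mono) auto
  then have 2: "\<bar>v2 * curve_len W1 - v2 * curve_len W2\<bar> \<le> v2 * ((1 + \<sigma>) * \<epsilon>)"
    using v by (simp add: abs_mult flip: right_diff_distrib)
  have "\<bar>v2 * curve_len W1 - v1 * curve_len W1\<bar> \<le> K * (1 + E) * v2 + v2 * ((1 + \<sigma>) * \<epsilon>)"
    using 1 2 by linarith
  also have "\<dots> \<le> ratio_const a * \<epsilon> * v2"
  proof -
    have "0 \<le> E * \<sigma> * (1 + E) * \<epsilon> * v2" using E \<sigma>_ge_one \<epsilon> v by simp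
    then show ?thesis by (simp add: ratio_const_def E_def[symmetric] K_def algebra_simps)
  qed
  finally have 3: "\<bar>v2 - v1\<bar> * curve_len W1 \<le> ratio_const a * \<epsilon> * v2"
    using curve_len_bounds(3)[OF W(1)] by (simp add: abs_mult flip: left_diff_distrib)
  have "y - x \<le> curve_len W1" using curve_len_bounds(1)[OF W(1)] over by linarith
  then have "\<bar>v2 - v1\<bar> * (y - x) \<le> \<bar>v2 - v1\<bar> * curve_len W1" by (intro mult_left_mono) auto
  with 3 have 4: "\<bar>v2 - v1\<bar> * (y - x) \<le> ratio_const a * \<epsilon> * v2" by linarith
  have "\<bar>1 - v1 / v2\<bar> = \<bar>v2 - v1\<bar> / v2" using v by (simp add: field_simps abs_divide)
  also have "\<dots> \<le> ratio_const a * \<epsilon> / (y - x)" using 4 v over(3) by (simp add: field_simps)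
  finally show "\<bar>1 - curve_avg W1 \<psi>1 / curve_avg W2 \<psi>2\<bar> \<le> ratio_const a * \<epsilon> / (y - x)"
    by (simp add: v1_def v2_def)
qed

end

section \<open>Small functions lie in the cone after adding a constant\<close>

context cone_setting
begin

lemma \<epsilon>_powr_le:
  assumes "0 < \<epsilon>" "\<epsilon> \<le> 1"
  shows "\<epsilon> powr (1/p) \<le> \<epsilon> powr \<gamma>" "\<epsilon> powr (1 - \<beta>) \<le> \<epsilon> powr \<gamma>" "\<epsilon> \<le> \<epsilon> powr \<gamma>"
proof -
  show "\<epsilon> powr (1/p) \<le> \<epsilon> powr \<gamma>" using assms exponents by (intro powr_mono') auto
  show "\<epsilon> powr (1 - \<beta>) \<le> \<epsilon> powr \<gamma>" using assms exponents by (intro powr_mono') auto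
  have "\<gamma> \<le> 1" using exponents by simp
  then have "\<epsilon> powr 1 \<le> \<epsilon> powr \<gamma>" using assms by (intro powr_mono') auto
  then show "\<epsilon> \<le> \<epsilon> powr \<gamma>" using assms by simp
qed

lemma stable_bound_average:
  assumes b: "stable_bound b g" and W: "W \<in> short_curves \<W> \<delta>" and \<psi>: "\<psi> \<in> test_densities a \<eta> W"
    and \<eta>: "\<beta> \<le> \<eta>" "\<eta> \<le> 1" and b0: "0 \<le> b"
  shows "\<bar>curve_int W (\<lambda>x. g x * \<psi> x)\<bar> \<le> b * density_const a * curve_avg W \<psi> * curve_len W powr (1/p)"
proof -
  note W' = short_curvesD[OF W]
  have h: "holder_on (base W) \<eta> (density_const a * curve_avg W \<psi>) (\<lambda>r. \<psi> (graph_pt W r))"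
    and v: "0 < curve_avg W \<psi>"
    using density_compare_average(1,4)[OF W'(1,3) _ _ _ \<psi>] \<eta> \<beta>_range constants by auto
  have diam: "\<bar>r - s\<bar> \<le> 1" if "r \<in> base W" "s \<in> base W" for r s
    using curve_len_bounds(1)[OF W'(1)] W'(3) that by (auto simp: base_def)
  have "holder_on {lo W..hi W} \<beta> (density_const a * curve_avg W \<psi>) (\<lambda>r. \<psi> (graph_pt W r))"
    using holder_on_lower_exponent[OF h \<beta>_range(1) \<eta> order_refl diam] by (simp add: base_def)
  from stable_boundD[OF b segment_whole[OF W'(1)] this]
  have "\<bar>curve_int W (\<lambda>x. g x * \<psi> x)\<bar> \<le> b * (density_const a * curve_avg W \<psi>) * (hi W - lo W) powr (1/p)"
    by (simp add: curve_int_eq_seg_int)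
  also have "\<dots> \<le> b * (density_const a * curve_avg W \<psi>) * curve_len W powr (1/p)"
    using curve_len_bounds[OF W'(1)] lo_less_hi[OF W'(1)] p_inverse b0 v density_const_ge(2)[of a] constants
    by (intro mult_left_mono powr_mono2) auto
  finally show ?thesis by (simp add: mult_ac)
qed

definition unstable_const :: real where
  "unstable_const = density_const a * (5 + ratio_const a + 8 * density_const a * \<Lambda>\<^sup>2)"

text \<open>Normalise the densities to functions \<open>w1\<close>, \<open>w2\<close> of average 1. If the curves are no longer than of order
  \<open>\<epsilon>\<close>, the stable bound suffices. Otherwise remove the end pieces; above the common base,
  \<open>w1\<close> is transported to the second curve by the unstable bound and compared there with \<open>w2\<close>. The
  difference \<open>w1 - w2\<close> has two sources: the ratio of the arclength elements, with small Hoelder norm by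
  interpolation, and the ratio \<open>\<rho>\<close> of the averages, with \<open>\<bar>1 - \<rho>\<bar>\<close> of order \<open>\<epsilon> / (y - x)\<close>. The
  latter is compensated by the factor \<open>(y - x)\<^bsup>1/p\<^esup>\<close> of the stable bound since \<open>y - x > \<epsilon>\<close>.\<close>

lemma bounds_imp_averages_close:
  assumes g: "curve_continuous g" and b: "stable_bound b g" "unstable_bound b g" "0 \<le> b"
    and W: "W1 \<in> short_curves \<W> \<delta>" "W2 \<in> short_curves \<W> \<delta>"
    and dist: "dist_Ws H W1 W2 \<le> ereal \<epsilon>" and \<epsilon>: "0 < \<epsilon>" "\<epsilon> \<le> 1" "\<epsilon> \<le> \<epsilon>0"
    and \<psi>: "\<psi>1 \<in> test_densities a \<alpha> W1" "\<psi>2 \<in> test_densities a \<alpha> W2"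
    and star: "dist_star W1 W2 \<psi>1 \<psi>2 = 0"
  shows "\<bar>curve_int W1 (\<lambda>x. g x * \<psi>1 x) / curve_avg W1 \<psi>1 - curve_int W2 (\<lambda>x. g x * \<psi>2 x) / curve_avg W2 \<psi>2\<bar>
    \<le> unstable_const * b * \<epsilon> powr \<gamma>"
proof -
  note W1 = short_curvesD[OF W(1)] and W2 = short_curvesD[OF W(2)]
  define v1 v2 where "v1 = curve_avg W1 \<psi>1" and "v2 = curve_avg W2 \<psi>2"
  define E where "E = density_const a"
  have a1: "1 \<le> a" using constants by simp
  have E: "1 \<le> E" using density_const_ge(2)[OF a1] by (simp add: E_def)
  have rc: "0 \<le> ratio_const a" using E \<sigma>_ge_one by (simp add: ratio_const_def E_def[symmetric])
  define w1 w2 where "w1 = (\<lambda>r. 1 / v1 * \<psi>1 (graph_pt W1 r))" and "w2 = (\<lambda>r. 1 / v2 * \<psi>2 (graph_pt W2 r))"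
  have diam: "\<bar>r - s\<bar> \<le> 1" if "W \<in> short_curves \<W> \<delta>" "r \<in> base W" "s \<in> base W" for W r s
    using curve_len_bounds(1)[OF short_curvesD(1)[OF that(1)]] short_curvesD(3)[OF that(1)] that
    by (auto simp: base_def)
  have norm: "holder_on (base W) \<alpha> E (\<lambda>r. 1 / curve_avg W \<psi> * \<psi> (graph_pt W r))"
    if "W \<in> short_curves \<W> \<delta>" "\<psi> \<in> test_densities a \<alpha> W" for W \<psi>
  proof -
    note W' = short_curvesD[OF that(1)]
    have v: "0 < curve_avg W \<psi>" and
      h: "holder_on (base W) \<alpha> (density_const a * curve_avg W \<psi>) (\<lambda>r. \<psi> (graph_pt W r))"
      using density_compare_average(1,4)[OF W'(1,3) a1 \<beta>_range(3,4) that(2)] by auto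
    show ?thesis using holder_on_scale[OF h, of "1 / curve_avg W \<psi>"] v by (simp add: E_def)
  qed
  have v: "0 < v1" "0 < v2"
    using density_integral_pos(1)[OF W(1) \<psi>(1)] density_integral_pos(1)[OF W(2) \<psi>(2)] \<beta>_range
    by (auto simp: v1_def v2_def)
  have ha: "holder_on (base W1) \<alpha> E w1" "holder_on (base W2) \<alpha> E w2"
    using norm[OF W(1) \<psi>(1)] norm[OF W(2) \<psi>(2)] by (auto simp: w1_def w2_def v1_def v2_def)
  have hb: "holder_on (base W1) \<beta> E w1" "holder_on (base W2) \<beta> E w2"
    using holder_on_lower_exponent[OF ha(1) \<beta>_range(1,5,4) order_refl diam[OF W(1)]]
      holder_on_lower_exponent[OF ha(2) \<beta>_range(1,5,4) order_refl diam[OF W(2)]] by simp_all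
  define I1 I2 where "I1 = seg_int W1 (lo W1) (hi W1) g w1" and "I2 = seg_int W2 (lo W2) (hi W2) g w2"
  have I: "curve_int W1 (\<lambda>x. g x * \<psi>1 x) / curve_avg W1 \<psi>1 = I1"
    "curve_int W2 (\<lambda>x. g x * \<psi>2 x) / curve_avg W2 \<psi>2 = I2"
    unfolding I1_def I2_def w1_def w2_def seg_int_cmult curve_int_eq_seg_int v1_def v2_def by simp_all
  define \<mu> where "\<mu> = b * E * \<epsilon> powr \<gamma>"
  have bE: "0 \<le> b * E" using b(3) E by simp
  have \<mu>0: "0 \<le> \<mu>" using bE by (simp add: \<mu>_def)
  have small_powr: "b * E * z powr (1/p) \<le> \<mu>" if "0 \<le> z" "z \<le> \<epsilon>" for z
  proof -
    have "z powr (1/p) \<le> \<epsilon> powr (1/p)" using that p_inverse by (intro powr_mono2) auto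
    also have "\<dots> \<le> \<epsilon> powr \<gamma>" by (rule \<epsilon>_powr_le(1)[OF \<epsilon>(1,2)])
    finally show ?thesis unfolding \<mu>_def by (rule mult_left_mono[OF _ bE])
  qed
  have short_int: "\<bar>seg_int W (lo W) (hi W) g w\<bar> \<le> 2 * \<mu>"
    if "W \<in> \<W>" "holder_on (base W) \<beta> E w" "hi W - lo W \<le> 2 * \<epsilon>" for W w
  proof -
    have "\<bar>seg_int W (lo W) (hi W) g w\<bar> \<le> b * E * (hi W - lo W) powr (1/p)"
      using that(2) by (intro stable_boundD[OF b(1) segment_whole[OF that(1)]]) (simp add: base_def)
    also have "\<dots> \<le> b * E * (2 * \<epsilon> powr (1/p))"
    proof -
      have "(hi W - lo W) powr (1/p) \<le> (2 * \<epsilon>) powr (1/p)"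
        using that(3) lo_less_hi[OF that(1)] p_inverse by (intro powr_mono2) auto
      also have "\<dots> \<le> 2 * \<epsilon> powr (1/p)" using \<epsilon> p_inverse by (intro scaled_powr_le) auto
      finally show ?thesis by (rule mult_left_mono[OF _ bE])
    qed
    also have "\<dots> \<le> 2 * \<mu>" using small_powr[of \<epsilon>] \<epsilon> by simp
    finally show ?thesis .
  qed
  have "\<bar>I1 - I2\<bar> \<le> (5 + ratio_const a + 8 * E * \<Lambda>\<^sup>2) * \<mu>"
  proof -
    have weak: ?thesis if "\<bar>I1 - I2\<bar> \<le> 4 * \<mu>"
    proof -
      have "4 * \<mu> \<le> (5 + ratio_const a + 8 * E * \<Lambda>\<^sup>2) * \<mu>"
        using \<mu>0 rc E by (intro mult_right_mono) auto
      then show ?thesis using that by linarith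
    qed
    show ?thesis
      using W1(1) W2(1) dist
    proof (cases rule: dist_Ws_cases)
      case short
      then show ?thesis
        using short_int[OF W1(1) hb(1)] short_int[OF W2(1) hb(2)] \<epsilon> unfolding I1_def I2_def
        by (intro weak[unfolded I1_def I2_def]) linarith
    next
      case (overlapping x y)
      have near: "near \<epsilon> W1 W2 x y" by fact
      have seg: "segment W1 x y" "segment W2 x y" and xy: "x < y" using near by (auto simp: near_def)
      have sub: "{x..y} \<subseteq> base W1" "{x..y} \<subseteq> base W2" using segmentD(5)[OF seg(1)] segmentD(5)[OF seg(2)] by auto
      show ?thesis
      proof (cases "y - x \<le> \<epsilon>")
        case True
        then show ?thesis
          using short_int[OF W1(1) hb(1)] short_int[OF W2(1) hb(2)] overlapping unfolding I1_def I2_def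
          by (intro weak[unfolded I1_def I2_def]) linarith
      next
        case False
        define k where "k = (\<lambda>r. 1 - speed W1 r / speed W2 r)"
        define \<rho> where "\<rho> = v1 / v2"
        have len1: "y - x \<le> 1" using curve_len_bounds(1)[OF W1(1)] W1(3) overlapping by linarith
        have eq: "\<psi>1 (graph_pt W1 r) * speed W1 r = \<psi>2 (graph_pt W2 r) * speed W2 r" if "r \<in> {x..y}" for r
        proof -
          have "C0_norm {x..y} (\<lambda>r. \<psi>1 (graph_pt W1 r) * speed W1 r - \<psi>2 (graph_pt W2 r) * speed W2 r) \<le> ereal 0"
            using star by (simp add: dist_star_def overlapping(2) zero_ereal_def)
          then show ?thesis using that by (auto simp: C0_norm_le_iff)
        qed
        have \<rho>: "\<rho> \<le> E" "\<bar>1 - \<rho>\<bar> \<le> ratio_const a * \<epsilon> / (y - x)" "0 < \<rho>"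
          using average_ratio[OF W1(1) W2(1) W1(3) W2(3) a1 \<beta>_range(3,4) \<psi> dist \<epsilon>(1), of x y]
            overlapping xy eq v by (auto simp: \<rho>_def v1_def v2_def E_def)
        have rem: "\<bar>seg_int W (lo W) (hi W) g w - seg_int W x y g w\<bar> \<le> 2 * \<mu>"
          if "W \<in> \<W>" "holder_on (base W) \<beta> E w" "lo W \<le> x" "x - lo W \<le> \<epsilon>" "y \<le> hi W" "hi W - y \<le> \<epsilon>" for W w
        proof -
          have "\<bar>seg_int W (lo W) (hi W) g w - seg_int W x y g w\<bar>
              \<le> b * E * ((x - lo W) powr (1/p) + (hi W - y) powr (1/p))"
            using that xy by (intro seg_int_remainder[OF g b(1)]) auto
          also have "\<dots> \<le> 2 * \<mu>"
            using small_powr[of "x - lo W"] small_powr[of "hi W - y"] that by (simp add: distrib_left)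
          finally show ?thesis .
        qed
        have 1: "\<bar>I1 - seg_int W1 x y g w1\<bar> \<le> 2 * \<mu>" "\<bar>I2 - seg_int W2 x y g w2\<bar> \<le> 2 * \<mu>"
          using rem[OF W1(1) hb(1)] rem[OF W2(1) hb(2)] overlapping by (auto simp: I1_def I2_def)
        have 2: "\<bar>seg_int W1 x y g w1 - seg_int W2 x y g w1\<bar> \<le> \<mu>"
          using unstable_boundD[OF b(2) \<epsilon>(1,3) near holder_on_subset[OF ha(1) sub(1)]] by (simp add: \<mu>_def)
        \<comment> \<open>On the common base, \<open>w2 = \<rho> w1 (1 - k)\<close>.\<close>
        have split: "w1 r - w2 r = (1 - \<rho>) * w1 r + \<rho> * (w1 r * k r)" if "r \<in> {x..y}" for r
        proof -
          have "\<psi>2 (graph_pt W2 r) = \<psi>1 (graph_pt W1 r) * speed W1 r / speed W2 r"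
            using eq[OF that] speed_ge_one[of W2 r] by (simp add: field_simps)
          then show ?thesis using v speed_ge_one[of W2 r]
            by (simp add: w1_def w2_def k_def \<rho>_def field_simps)
        qed
        have hk: "holder_on {x..y} \<beta> (4 * \<Lambda>\<^sup>2 * \<epsilon> powr (1 - \<beta>)) k"
          unfolding k_def using near len1 \<epsilon> \<beta>_range by (intro near_speed_ratio_holder) auto
        have hw: "holder_on {x..y} \<beta> E w1" by (rule holder_on_subset[OF hb(1) sub(1)])
        note hwk = holder_on_mult[OF hw hk]
        have cw: "continuous_on {x..y} w1" "continuous_on {x..y} w2" "continuous_on {x..y} (\<lambda>r. w1 r * k r)"
          using holder_on_imp_continuous_on[OF hw] holder_on_imp_continuous_on[OF hwk]
            holder_on_imp_continuous_on[OF holder_on_subset[OF hb(2) sub(2)]] \<beta>_range by auto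
        have "seg_int W2 x y g w1 - seg_int W2 x y g w2 = seg_int W2 x y g (\<lambda>r. (1 - \<rho>) * w1 r + \<rho> * (w1 r * k r))"
          unfolding seg_int_diff[OF seg(2) g cw(1,2), symmetric] using split by (intro seg_int_cong) simp
        also have "\<dots> = seg_int W2 x y g (\<lambda>r. (1 - \<rho>) * w1 r) + seg_int W2 x y g (\<lambda>r. \<rho> * (w1 r * k r))"
          using cw by (intro seg_int_add[OF seg(2) g] continuous_on_mult_left)
        also have "\<dots> = (1 - \<rho>) * seg_int W2 x y g w1 + \<rho> * seg_int W2 x y g (\<lambda>r. w1 r * k r)"
          by (simp only: seg_int_cmult)
        finally have 3: "\<bar>seg_int W2 x y g w1 - seg_int W2 x y g w2\<bar>
            \<le> \<bar>1 - \<rho>\<bar> * \<bar>seg_int W2 x y g w1\<bar> + \<rho> * \<bar>seg_int W2 x y g (\<lambda>r. w1 r * k r)\<bar>"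
          using \<rho>(3) abs_triangle_ineq[of "(1 - \<rho>) * seg_int W2 x y g w1" "\<rho> * seg_int W2 x y g (\<lambda>r. w1 r * k r)"]
          by (simp add: abs_mult)
        have "\<bar>1 - \<rho>\<bar> * \<bar>seg_int W2 x y g w1\<bar> \<le> (ratio_const a * \<epsilon> / (y - x)) * (b * E * (y - x) powr (1/p))"
          using \<rho>(2) stable_boundD[OF b(1) seg(2) hw] rc \<epsilon> xy by (intro mult_mono) auto
        also have "\<dots> = ratio_const a * (b * E) * (\<epsilon> * (y - x) powr (1/p - 1))"
          using xy by (simp add: powr_diff)
        also have "\<dots> \<le> ratio_const a * (b * E) * \<epsilon> powr \<gamma>"
        proof -
          have "(y - x) powr (1/p - 1) \<le> \<epsilon> powr (1/p - 1)"
            using False \<epsilon> p_inverse by (intro powr_mono2') auto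
          then have "\<epsilon> * (y - x) powr (1/p - 1) \<le> \<epsilon> * \<epsilon> powr (1/p - 1)" using \<epsilon> by (intro mult_left_mono) auto
          also have "\<dots> = \<epsilon> powr (1/p)" using \<epsilon> by (simp add: powr_diff)
          also have "\<dots> \<le> \<epsilon> powr \<gamma>" by (rule \<epsilon>_powr_le(1)[OF \<epsilon>(1,2)])
          finally show ?thesis using rc bE by (intro mult_left_mono) auto
        qed
        finally have 4: "\<bar>1 - \<rho>\<bar> * \<bar>seg_int W2 x y g w1\<bar> \<le> ratio_const a * \<mu>" by (simp add: \<mu>_def mult_ac)
        have "\<bar>seg_int W2 x y g (\<lambda>r. w1 r * k r)\<bar>
            \<le> b * (2 * E * (4 * \<Lambda>\<^sup>2 * \<epsilon> powr (1 - \<beta>))) * (y - x) powr (1/p)"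
          by (rule stable_boundD[OF b(1) seg(2) hwk])
        also have "\<dots> \<le> b * (2 * E * (4 * \<Lambda>\<^sup>2 * \<epsilon> powr \<gamma>)) * 1"
          using \<epsilon>_powr_le(2)[OF \<epsilon>(1,2)] b(3) E len1 xy p_inverse
          by (intro mult_mono mult_left_mono powr_le1) auto
        finally have "\<bar>seg_int W2 x y g (\<lambda>r. w1 r * k r)\<bar> \<le> 8 * \<Lambda>\<^sup>2 * \<mu>" by (simp add: \<mu>_def mult_ac)
        then have "\<rho> * \<bar>seg_int W2 x y g (\<lambda>r. w1 r * k r)\<bar> \<le> E * (8 * \<Lambda>\<^sup>2 * \<mu>)"
          using \<rho>(1,3) by (intro mult_mono) auto
        then have "\<bar>I1 - I2\<bar> \<le> 5 * \<mu> + ratio_const a * \<mu> + E * (8 * \<Lambda>\<^sup>2 * \<mu>)" using 1 2 3 4 by linarith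
        then show ?thesis by (simp add: algebra_simps)
      qed
    qed
  qed
  then show ?thesis unfolding I by (simp add: \<mu>_def unstable_const_def E_def[symmetric] mult_ac)
qed

text \<open>The averages of \<open>g\<close> over curves of length at least \<open>\<delta>\<close> are at most \<open>c2 b\<close> in modulus, which makes
  \<open>t - c2 b\<close> a witness. Each of the three cone conditions holds strictly for the constant function 1, and
  the contribution of \<open>g\<close> to it is a multiple of \<open>b\<close>; the quotients in the choice of \<open>C\<close> are the ratios
  of these contributions to the available room.\<close>

lemma bounds_imp_cone_at:
  "\<exists>C\<ge>1. \<forall>g b t. curve_continuous g \<longrightarrow> stable_bound b g \<longrightarrow> unstable_bound b g \<longrightarrow> 0 \<le> b \<longrightarrow> C * b \<le> t \<longrightarrow>
     (\<exists>m. cone_at m (\<lambda>x. g x + t))"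
proof -
  define E where "E = density_const a"
  define c2 where "c2 = E * \<delta> powr (1/p - 1)"
  have E: "1 \<le> E" using density_const_ge(2)[of a] constants by (simp add: E_def)
  have c2: "0 \<le> c2" using E by (simp add: c2_def)
  define k1 where "k1 = (A - 2) * \<delta> powr (1 - 1/p)"
  define k2 where "k2 = (A * c - (1 + \<sigma>)) * \<delta> powr (1 - \<gamma>)"
  have k: "0 < k1" "0 < k2" using constants by (auto simp: k1_def k2_def)
  define C where "C = max 1 (max c2 (max ((L + 1) * c2 / (L - 1))
     (max ((E + A * \<delta> powr (1 - 1/p) * c2) / k1) ((unstable_const + \<delta> powr (1 - \<gamma>) * c * A * c2) / k2))))"
  have C: "1 \<le> C" "c2 \<le> C" "(L + 1) * c2 / (L - 1) \<le> C"
    "(E + A * \<delta> powr (1 - 1/p) * c2) / k1 \<le> C" "(unstable_const + \<delta> powr (1 - \<gamma>) * c * A * c2) / k2 \<le> C"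
    by (auto simp: C_def)
  have "\<exists>m. cone_at m (\<lambda>x. g x + t)"
    if g: "curve_continuous g" and b: "stable_bound b g" "unstable_bound b g" "0 \<le> b" and t: "C * b \<le> t" for g b t
  proof -
    have Cb: "X * b \<le> t" if "X \<le> C" for X using mult_right_mono[OF that b(3)] t by linarith
    have t_ge: "c2 * b \<le> t" "(L + 1) * c2 / (L - 1) * b \<le> t"
      "(E + A * \<delta> powr (1 - 1/p) * c2) / k1 * b \<le> t" "(unstable_const + \<delta> powr (1 - \<gamma>) * c * A * c2) / k2 * b \<le> t"
      using C(2-5) by (auto simp only: intro!: Cb)
    have tL: "(L + 1) * c2 * b \<le> (L - 1) * t" using t_ge(2) constants by (simp add: field_simps)
    have tA: "(E + A * \<delta> powr (1 - 1/p) * c2) * b \<le> k1 * t" using t_ge(3) k by (simp add: field_simps)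
    have tc: "(unstable_const + \<delta> powr (1 - \<gamma>) * c * A * c2) * b \<le> k2 * t" using t_ge(4) k by (simp add: field_simps)
    have t0: "0 \<le> t" using t_ge(1) mult_nonneg_nonneg[OF c2 b(3)] by linarith
    have add: "curve_int W (\<lambda>x. (g x + t) * \<psi> x) = curve_int W (\<lambda>x. g x * \<psi> x) + t * curve_int W \<psi>"
      if "W \<in> short_curves \<W> \<delta>" "\<psi> \<in> test_densities a \<eta> W" for W \<psi> \<eta>
      using curve_int_add_left[OF g _ short_curvesD(1)[OF that(1)] that(2), of "\<lambda>_. t"]
      by (simp add: curve_int_def mult.assoc)
    have "cone_at (t - c2 * b) (\<lambda>x. g x + t)"
      unfolding cone_at_def
    proof (intro conjI ballI impI)
      show "0 \<le> t - c2 * b" using t_ge(1) by simp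
    next
      fix W \<psi> assume W': "W \<in> scale_curves \<W> \<delta>" and \<psi>: "\<psi> \<in> test_densities a \<beta> W"
      note W = scale_imp_short[OF W']
      define J where "J = curve_int W \<psi>"
      define G where "G = curve_int W (\<lambda>x. g x * \<psi> x)"
      note pos = density_integral_pos[OF W \<psi> \<beta>_range(1,2)]
      have J: "0 < J" using pos by (simp add: J_def)
      have len: "\<delta> \<le> curve_len W" using W' by (simp add: scale_curves_def)
      have "\<bar>G\<bar> \<le> b * E * curve_avg W \<psi> * curve_len W powr (1/p)"
        unfolding G_def E_def by (rule stable_bound_average[OF b(1) W \<psi> order_refl \<beta>_range(2) b(3)])
      also have "\<dots> = b * E * J * curve_len W powr (1/p - 1)"
        using pos constants len by (simp add: J_def powr_diff)
      also have "\<dots> \<le> b * E * J * \<delta> powr (1/p - 1)"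
        using b(3) E J len constants p_inverse by (intro mult_left_mono powr_mono2') auto
      finally have G: "\<bar>G\<bar> / J \<le> c2 * b" using J by (simp add: c2_def field_simps)
      have eq: "curve_int W (\<lambda>x. (g x + t) * \<psi> x) / curve_int W \<psi> = G / J + t"
        unfolding add[OF W \<psi>] using J by (simp add: G_def J_def field_simps)
      have absG: "\<bar>G / J\<bar> \<le> c2 * b" using G J by (simp add: abs_divide)
      show "t - c2 * b \<le> curve_int W (\<lambda>x. (g x + t) * \<psi> x) / curve_int W \<psi>"
        unfolding eq using absG by linarith
      have "\<bar>curve_int W (\<lambda>x. (g x + t) * \<psi> x)\<bar> / curve_int W \<psi> = \<bar>G / J + t\<bar>"
        unfolding eq[symmetric] using J by (simp add: abs_divide J_def)
      also have "\<dots> \<le> c2 * b + t" using absG t0 by linarith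
      also have "\<dots> \<le> L * (t - c2 * b)" using tL by (simp add: algebra_simps)
      finally show "\<bar>curve_int W (\<lambda>x. (g x + t) * \<psi> x)\<bar> / curve_int W \<psi> \<le> L * (t - c2 * b)" .
    next
      fix W \<psi> assume W: "W \<in> short_curves \<W> \<delta>" and \<psi>: "\<psi> \<in> test_densities a \<beta> W"
      note W' = short_curvesD[OF W] and pos = density_integral_pos[OF W \<psi> \<beta>_range(1,2)]
      note len = curve_len_bounds(3)[OF W'(1)]
      define v where "v = curve_avg W \<psi>"
      define G where "G = curve_int W (\<lambda>x. g x * \<psi> x)"
      have v: "0 < v" using pos by (simp add: v_def)
      have "\<bar>G\<bar> \<le> b * E * v * curve_len W powr (1/p)"
        unfolding G_def E_def v_def by (rule stable_bound_average[OF b(1) W \<psi> order_refl \<beta>_range(2) b(3)])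
      then have G: "\<bar>G\<bar> / v \<le> b * E * curve_len W powr (1/p)" using v by (simp add: field_simps)
      have "\<bar>curve_int W (\<lambda>x. (g x + t) * \<psi> x)\<bar> \<le> \<bar>G\<bar> + t * (v * curve_len W)"
      proof -
        have "0 \<le> t * (v * curve_len W)" using t0 v len by simp
        then show ?thesis unfolding add[OF W \<psi>] pos(3) G_def v_def by linarith
      qed
      then have "\<bar>curve_int W (\<lambda>x. (g x + t) * \<psi> x)\<bar> / v \<le> (\<bar>G\<bar> + t * (v * curve_len W)) / v"
        using v by (intro divide_right_mono) auto
      also have "\<dots> \<le> b * E * curve_len W powr (1/p) + t * curve_len W"
        using G v by (simp add: add_divide_distrib)
      finally have "curve_len W powr (- (1/p)) * (\<bar>curve_int W (\<lambda>x. (g x + t) * \<psi> x)\<bar> / v)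
          \<le> curve_len W powr (- (1/p)) * (b * E * curve_len W powr (1/p) + t * curve_len W)"
        by (intro mult_left_mono) auto
      also have "\<dots> = b * E + t * curve_len W powr (1 - 1/p)"
      proof -
        have "curve_len W powr (- (1/p)) * curve_len W powr (1/p) = 1"
          "curve_len W powr (- (1/p)) * curve_len W = curve_len W powr (1 - 1/p)"
          using len by (simp_all add: powr_minus powr_diff field_simps)
        then show ?thesis by (simp add: distrib_left mult.left_commute[of "curve_len W powr (- (1/p))"])
      qed
      also have "\<dots> \<le> b * E + t * (2 * \<delta> powr (1 - 1/p))"
      proof -
        have "curve_len W powr (1 - 1/p) \<le> (2 * \<delta>) powr (1 - 1/p)"
          using len W'(2) p_inverse by (intro powr_mono2) auto
        also have "\<dots> \<le> 2 * \<delta> powr (1 - 1/p)"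
          using p_inverse constants by (intro scaled_powr_le) auto
        finally show ?thesis using t0 by (intro add_left_mono mult_left_mono)
      qed
      also have "\<dots> \<le> A * \<delta> powr (1 - 1/p) * (t - c2 * b)"
        using tA by (simp add: k1_def algebra_simps)
      finally show "curve_len W powr (- (1/p)) * (\<bar>curve_int W (\<lambda>x. (g x + t) * \<psi> x)\<bar> / curve_avg W \<psi>)
          \<le> A * \<delta> powr (1 - 1/p) * (t - c2 * b)" by (simp add: v_def)
    next
      fix W1 W2 \<psi>1 \<psi>2
      assume W: "W1 \<in> short_curves \<W> \<delta>" "W2 \<in> short_curves \<W> \<delta>" and dist: "dist_Ws H W1 W2 \<le> ereal \<delta>"
        and \<psi>: "\<psi>1 \<in> test_densities a \<alpha> W1" "\<psi>2 \<in> test_densities a \<alpha> W2"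
        and star: "dist_star W1 W2 \<psi>1 \<psi>2 = 0"
      note W1 = short_curvesD[OF W(1)] and W2 = short_curvesD[OF W(2)]
      define Q where "Q = curve_int W1 (\<lambda>x. (g x + t) * \<psi>1 x) / curve_avg W1 \<psi>1
            - curve_int W2 (\<lambda>x. (g x + t) * \<psi>2 x) / curve_avg W2 \<psi>2"
      define d where "d = real_of_ereal (dist_Ws H W1 W2)"
      have dist0: "0 \<le> dist_Ws H W1 W2"
        unfolding dist_Ws_def using C0_norm_nonneg by (auto simp: sym_diff_measure_def intro!: add_nonneg_nonneg)
      have d: "dist_Ws H W1 W2 = ereal d" "0 \<le> d" "d \<le> \<delta>"
        using dist dist0 unfolding d_def by (cases "dist_Ws H W1 W2"; simp)+
      have pos1: "0 < curve_avg W1 \<psi>1" "curve_int W1 \<psi>1 = curve_avg W1 \<psi>1 * curve_len W1"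
        using density_integral_pos[OF W(1) \<psi>(1)] \<beta>_range by auto
      have pos2: "0 < curve_avg W2 \<psi>2" "curve_int W2 \<psi>2 = curve_avg W2 \<psi>2 * curve_len W2"
        using density_integral_pos[OF W(2) \<psi>(2)] \<beta>_range by auto
      define G where "G = curve_int W1 (\<lambda>x. g x * \<psi>1 x) / curve_avg W1 \<psi>1
            - curve_int W2 (\<lambda>x. g x * \<psi>2 x) / curve_avg W2 \<psi>2"
      have Q: "Q = G + t * (curve_len W1 - curve_len W2)"
        unfolding Q_def add[OF W(1) \<psi>(1)] add[OF W(2) \<psi>(2)] pos1(2) pos2(2) G_def
        using pos1(1) pos2(1) by (simp add: add_divide_distrib right_diff_distrib)
      have bound: "\<bar>Q\<bar> \<le> unstable_const * b * \<epsilon> powr \<gamma> + t * ((1 + \<sigma>) * \<epsilon>)"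
        if \<epsilon>: "0 < \<epsilon>" "d \<le> \<epsilon>" "\<epsilon> \<le> \<delta>" for \<epsilon>
      proof -
        have dist\<epsilon>: "dist_Ws H W1 W2 \<le> ereal \<epsilon>" using d \<epsilon> by simp
        have "\<bar>G\<bar> \<le> unstable_const * b * \<epsilon> powr \<gamma>"
          unfolding G_def using \<epsilon> \<delta>_small by (intro bounds_imp_averages_close[OF g b W dist\<epsilon> _ _ _ \<psi> star]) auto
        moreover have "t * \<bar>curve_len W1 - curve_len W2\<bar> \<le> t * ((1 + \<sigma>) * \<epsilon>)"
          using curve_len_diff[OF W1(1) W2(1) W1(3) dist\<epsilon> \<epsilon>(1)] t0 by (intro mult_left_mono)
        ultimately show ?thesis
          unfolding Q using abs_triangle_ineq[of G "t * (curve_len W1 - curve_len W2)"] t0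
          by (simp add: abs_mult)
      qed
      have "\<bar>Q\<bar> \<le> unstable_const * b * d powr \<gamma> + t * ((1 + \<sigma>) * (d powr \<gamma> * \<delta> powr (1 - \<gamma>)))"
      proof (cases "d = 0")
        case True
        \<comment> \<open>Curves at distance 0: let \<open>\<epsilon>\<close> tend to 0.\<close>
        have "\<forall>\<^sub>F x in at_right (0::real). 0 \<le> x"
          using eventually_at_right_less[of "0::real"] by (rule eventually_mono) simp
        then have "((\<lambda>\<epsilon>. unstable_const * b * \<epsilon> powr \<gamma> + t * ((1 + \<sigma>) * \<epsilon>)) \<longlongrightarrow>
            unstable_const * b * 0 powr \<gamma> + t * ((1 + \<sigma>) * 0)) (at_right 0)"
          using exponents by (intro tendsto_intros) auto
        moreover have "\<forall>\<^sub>F \<epsilon> in at_right 0. \<bar>Q\<bar> \<le> unstable_const * b * \<epsilon> powr \<gamma> + t * ((1 + \<sigma>) * \<epsilon>)"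
          unfolding eventually_at_right_field using bound constants True by (intro exI[of _ \<delta>]) auto
        ultimately have "\<bar>Q\<bar> \<le> unstable_const * b * 0 powr \<gamma> + t * ((1 + \<sigma>) * 0)"
          by (rule tendsto_lowerbound) simp
        then show ?thesis using True by simp
      next
        case False
        then have dpos: "0 < d" using d by simp
        have "d = d powr \<gamma> * d powr (1 - \<gamma>)" using dpos by (simp flip: powr_add)
        also have "\<dots> \<le> d powr \<gamma> * \<delta> powr (1 - \<gamma>)"
        proof -
          have "0 \<le> 1 - \<gamma>" using exponents by simp
          then show ?thesis using d by (intro mult_left_mono powr_mono2) auto
        qed
        finally have "t * ((1 + \<sigma>) * d) \<le> t * ((1 + \<sigma>) * (d powr \<gamma> * \<delta> powr (1 - \<gamma>)))"
          using t0 \<sigma>_ge_one by (intro mult_left_mono) auto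
        then show ?thesis using bound[OF dpos order_refl d(3)] by linarith
      qed
      also have "\<dots> = d powr \<gamma> * (unstable_const * b + t * ((1 + \<sigma>) * \<delta> powr (1 - \<gamma>)))"
        by (simp add: algebra_simps)
      also have "\<dots> \<le> d powr \<gamma> * (\<delta> powr (1 - \<gamma>) * c * A * (t - c2 * b))"
      proof (rule mult_left_mono)
        show "unstable_const * b + t * ((1 + \<sigma>) * \<delta> powr (1 - \<gamma>)) \<le> \<delta> powr (1 - \<gamma>) * c * A * (t - c2 * b)"
          using tc by (simp add: k2_def algebra_simps)
      qed simp
      finally show "\<bar>curve_int W1 (\<lambda>x. (g x + t) * \<psi>1 x) / curve_avg W1 \<psi>1
            - curve_int W2 (\<lambda>x. (g x + t) * \<psi>2 x) / curve_avg W2 \<psi>2\<bar>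
         \<le> real_of_ereal (dist_Ws H W1 W2) powr \<gamma> * \<delta> powr (1 - \<gamma>) * c * A * (t - c2 * b)"
        by (simp add: Q_def d_def mult_ac)
    qed
    then show ?thesis ..
  qed
  then show ?thesis using C(1) by (intro exI[of _ C]) blast
qed

end

section \<open>Functions between constants in the cone order are bounded\<close>

text \<open>For cutting long segments into short ones: \<open>n\<close> bisections reach length \<open>h\<close> at the cost of a factor
  \<open>2\<^bsup>n\<^esup>\<close>.\<close>

lemma bisection_bound:
  fixes \<Phi> :: "real \<Rightarrow> real \<Rightarrow> real"
  assumes add: "\<And>x y z. X \<le> x \<Longrightarrow> x \<le> z \<Longrightarrow> z \<le> y \<Longrightarrow> y \<le> Y \<Longrightarrow> \<Phi> x y = \<Phi> x z + \<Phi> z y"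
    and small: "\<And>x y. X \<le> x \<Longrightarrow> x \<le> y \<Longrightarrow> y \<le> Y \<Longrightarrow> y - x \<le> h \<Longrightarrow> \<bar>\<Phi> x y\<bar> \<le> k"
  shows "X \<le> x \<Longrightarrow> x \<le> y \<Longrightarrow> y \<le> Y \<Longrightarrow> y - x \<le> 2 ^ n * h \<Longrightarrow> \<bar>\<Phi> x y\<bar> \<le> 2 ^ n * k"
proof (induction n arbitrary: x y)
  case 0
  then show ?case using small by simp
next
  case (Suc n)
  define z where "z = (x + y) / 2"
  have z: "x \<le> z" "z \<le> y" "z - x \<le> 2 ^ n * h" "y - z \<le> 2 ^ n * h"
    using Suc.prems by (auto simp: z_def field_simps)
  have "\<bar>\<Phi> x z\<bar> \<le> 2 ^ n * k" "\<bar>\<Phi> z y\<bar> \<le> 2 ^ n * k"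
    using Suc.prems z by (auto intro!: Suc.IH)
  moreover have "\<Phi> x y = \<Phi> x z + \<Phi> z y" using Suc.prems z by (intro add) auto
  ultimately show ?case by simp
qed

context cone_setting
begin

definition short_const :: real where
  "short_const = A * \<delta> powr (1 - 1/p) * \<sigma>"

lemma short_const_nonneg: "0 \<le> short_const"
  using constants \<sigma>_ge_one by (simp add: short_const_def)

lemma cone_at_density_bound:
  assumes m: "cone_at m f" and seg: "segment W x y" and xy: "x < y" "\<sigma> * (y - x) \<le> 2 * \<delta>"
    and \<psi>: "lift u \<in> test_densities a \<beta> (sub_curve W x y)"
    and u: "\<And>r. r \<in> {x..y} \<Longrightarrow> u r \<le> k"
  shows "\<bar>seg_int W x y f u\<bar> \<le> short_const * m * k * (y - x) powr (1/p)"
proof -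
  define V where "V = sub_curve W x y"
  note V = curve_len_sub_curve_bounds[OF seg xy(1), folded V_def]
  have short: "V \<in> short_curves \<W> \<delta>" using V xy by (simp add: short_curves_def)
  note pos = density_integral_pos[OF short \<psi>[folded V_def] \<beta>_range(1,2)]
  have baseV: "base V = {x..y}" by (simp add: V_def)
  have cont: "continuous_on {x..y} u"
    using test_densitiesD(1)[OF V(1) \<psi>[folded V_def]] by (simp add: baseV)
  define v where "v = curve_avg V (lift u)"
  have "v * curve_len V = seg_int V (lo V) (hi V) (\<lambda>_. 1) u"
    using V by (simp add: v_def curve_avg_def curve_int_eq_seg_int_one)
  also have "\<dots> \<le> seg_int V (lo V) (hi V) (\<lambda>_. 1) (\<lambda>_. k)"
    using u cont by (intro seg_int_one_mono segment_whole V) (auto simp: V_def)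
  also have "\<dots> = k * curve_len V" by (rule seg_int_one_const_whole)
  finally have v: "v \<le> k" "0 < v" using V pos by (auto simp: v_def)
  have int: "curve_int V (\<lambda>z. f z * lift u z) = seg_int W x y f u"
    unfolding V_def by (rule curve_int_sub_curve[OF seg xy(1)])
  have "curve_len V powr (- (1/p)) * (\<bar>seg_int W x y f u\<bar> / v) \<le> A * \<delta> powr (1 - 1/p) * m"
    using cone_atD(4)[OF m short \<psi>[folded V_def]] by (simp only: int v_def)
  then have "\<bar>seg_int W x y f u\<bar> \<le> A * \<delta> powr (1 - 1/p) * m * v * curve_len V powr (1/p)"
    using v V by (simp add: powr_minus field_simps)
  also have "\<dots> \<le> A * \<delta> powr (1 - 1/p) * m * k * (\<sigma> * (y - x) powr (1/p))"
  proof -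
    have "curve_len V powr (1/p) \<le> (\<sigma> * (y - x)) powr (1/p)"
      using V p_inverse by (intro powr_mono2) auto
    also have "\<dots> \<le> \<sigma> * (y - x) powr (1/p)"
      using p_inverse \<sigma>_ge_one xy by (intro scaled_powr_le) auto
    finally show ?thesis
      using v constants cone_atD(1)[OF m] by (intro mult_mono mult_left_mono) auto
  qed
  finally show ?thesis by (simp add: short_const_def mult_ac)
qed

lemma \<sigma>_segment_le_one: "\<sigma> * (y - x) \<le> 2 * \<delta> \<Longrightarrow> x \<le> y \<Longrightarrow> y - x \<le> 2 * \<delta>" 
  using mult_right_mono[OF \<sigma>_ge_one, of "y - x"] by simp

text \<open>A Hoelder function \<open>u\<close> is the difference of the densities \<open>u + 2 B\<close> and \<open>2 B\<close>, to both of which the second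
  cone condition applies.\<close>

lemma cone_at_stable_short:
  assumes f: "curve_continuous f" and m: "cone_at m f" and seg: "segment W x y"
    and xy: "\<sigma> * (y - x) \<le> 2 * \<delta>" and u: "holder_on {x..y} \<beta> B u"
  shows "\<bar>seg_int W x y f u\<bar> \<le> 5 * short_const * m * B * (y - x) powr (1/p)"
proof -
  have le: "x \<le> y" using segmentD[OF seg] by simp
  have B0: "0 \<le> B" using holder_on_nonneg[OF u] le by auto
  show ?thesis
  proof (cases "x = y \<or> B = 0")
    case True
    have "seg_int W x y f u = 0"
      using True
    proof
      assume "B = 0"
      then have "u r = 0" if "r \<in> {x..y}" for r using holder_on_bound[OF u that] by simp
      then show ?thesis by (rule seg_int_zero)
    qed simp
    then show ?thesis using B0 short_const_nonneg cone_atD(1)[OF m] by simp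
  next
    case False
    then have lt: "x < y" and B: "0 < B" using le B0 by auto
    note V = curve_len_sub_curve_bounds[OF seg lt]
    have cont: "continuous_on {x..y} u" using holder_on_imp_continuous_on[OF u] \<beta>_range by simp
    have pos: "0 < u r + 2 * B" "u r + 2 * B \<le> 3 * B" if "r \<in> {x..y}" for r
      using holder_on_bound[OF u that] B by auto
    have "u r + 2 * B \<le> (u s + 2 * B) * exp (a * \<bar>r - s\<bar> powr \<beta>)"
      if rs: "r \<in> {x..y}" "s \<in> {x..y}" for r s
    proof -
      have "u r + 2 * B \<le> (u s + 2 * B) * exp (\<bar>r - s\<bar> powr \<beta> / (2 - 1))"
        using u B rs by (intro shifted_holder_ratio) auto
      also have "\<dots> \<le> (u s + 2 * B) * exp (a * \<bar>r - s\<bar> powr \<beta>)"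
        using pos[OF rs(2)] constants mult_right_mono[of 1 a "\<bar>r - s\<bar> powr \<beta>"]
        by (intro mult_left_mono) auto
      finally show ?thesis .
    qed
    then have "lift (\<lambda>r. u r + 2 * B) \<in> test_densities a \<beta> (sub_curve W x y)"
      using V pos(1) cont constants \<beta>_range
      by (intro test_densities_liftI) (auto intro!: continuous_intros)
    from cone_at_density_bound[OF m seg lt xy this pos(2)]
    have 1: "\<bar>seg_int W x y f (\<lambda>r. u r + 2 * B)\<bar> \<le> short_const * m * (3 * B) * (y - x) powr (1/p)" .
    have "lift (\<lambda>_. 2 * B) \<in> test_densities a \<beta> (sub_curve W x y)"
      using V B constants \<beta>_range const_test_density[OF V(1), of "2 * B" a \<beta>] by (simp add: lift_def)
    from cone_at_density_bound[OF m seg lt xy this order_refl]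
    have 2: "\<bar>seg_int W x y f (\<lambda>r. 2 * B)\<bar> \<le> short_const * m * (2 * B) * (y - x) powr (1/p)" .
    have "seg_int W x y f (\<lambda>r. u r + 2 * B) = seg_int W x y f u + seg_int W x y f (\<lambda>_. 2 * B)"
      by (intro seg_int_add seg f cont continuous_on_const)
    then show ?thesis using 1 2 by (simp add: algebra_simps abs_le_iff)
  qed
qed

definition shifted_const :: real where
  "shifted_const = 4 * \<delta> powr (1 - \<gamma>) * c * A + 4 * short_const * \<sigma> + 160 * short_const * \<Lambda>\<^sup>2"

lemma shifted_const_nonneg: "0 \<le> shifted_const"
  using short_const_nonneg constants c_pos \<sigma>_ge_one by (simp add: shifted_const_def)

text \<open>The third cone condition compares densities that agree after multiplication with the arclength
  elements. The partner of \<open>U = u + 3 B\<close> is therefore \<open>U s\<close> with the ratio \<open>s\<close> of the arclength elements.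
  Its logarithm is Hoelder with constant at most 1: one half comes from \<open>U\<close>, for which the shift is
  \<open>3 B\<close>, and the other half from \<open>s\<close>, which is Lipschitz and so has small Hoelder constant on curves of
  length at most \<open>2 \<delta>\<close>. Both densities have the same integral, so that dividing by averages
  only compares the lengths of the curves. Finally \<open>U s\<close> is replaced by \<open>U\<close> on the second curve, at the
  cost of the small Hoelder norm of \<open>U (1 - s)\<close>.\<close>

lemma cone_at_unstable_shifted:
  assumes f: "curve_continuous f" and m: "cone_at m f" and near: "near \<epsilon> W1 W2 x y"
    and \<epsilon>: "0 < \<epsilon>" "\<epsilon> \<le> \<delta>" and xy: "\<sigma> * (y - x) \<le> 2 * \<delta>"
    and u: "holder_on {x..y} \<alpha> B u" and B: "0 < B"
  shows "\<bar>seg_int W1 x y f (\<lambda>r. u r + 3 * B) - seg_int W2 x y f (\<lambda>r. u r + 3 * B)\<bar>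
    \<le> shifted_const * m * B * \<epsilon> powr \<gamma>"
proof -
  have seg: "segment W1 x y" "segment W2 x y" and lt: "x < y" and scat: "scat W1 = scat W2"
    using near by (auto simp: near_def)
  have W: "W1 \<in> \<W>" "W2 \<in> \<W>" using segmentD seg by auto
  have base: "\<And>r. r \<in> {x..y} \<Longrightarrow> r \<in> base W1" "\<And>r. r \<in> {x..y} \<Longrightarrow> r \<in> base W2"
    using segmentD(5)[OF seg(1)] segmentD(5)[OF seg(2)] by auto
  have len\<delta>: "y - x \<le> 2 * \<delta>" using \<sigma>_segment_le_one xy lt by simp
  then have len1: "y - x \<le> 1" using \<delta>_small by simp
  have \<epsilon>1: "\<epsilon> \<le> 1" using \<epsilon> \<delta>_small constants by simp
  have m0: "0 \<le> m" by (rule cone_atD(1)[OF m])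
  define V1 V2 where "V1 = sub_curve W1 x y" and "V2 = sub_curve W2 x y"
  note V1 = curve_len_sub_curve_bounds[OF seg(1) lt, folded V1_def]
  note V2 = curve_len_sub_curve_bounds[OF seg(2) lt, folded V2_def]
  have short: "V1 \<in> short_curves \<W> \<delta>" "V2 \<in> short_curves \<W> \<delta>"
    using V1 V2 xy by (auto simp: short_curves_def)
  have Vbase: "base V1 = {x..y}" "base V2 = {x..y}" by (auto simp: V1_def V2_def)
  have Vspeed: "speed V1 r = speed W1 r" "speed V2 r = speed W2 r" if "r \<in> {x..y}" for r
    using speed_sub_curve(2)[OF W(1) _ lt _ that] speed_sub_curve(2)[OF W(2) _ lt _ that]
      segmentD[OF seg(1)] segmentD[OF seg(2)] by (auto simp: V1_def V2_def)
  define U where "U = (\<lambda>r. u r + 3 * B)"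
  define s where "s = (\<lambda>r. speed W1 r / speed W2 r)"
  have hU: "holder_on {x..y} \<alpha> (4 * B) U"
    using holder_on_add_const[OF u, of "3 * B"] B by (simp add: U_def)
  have hUb: "holder_on {x..y} \<beta> (4 * B) U"
  proof -
    have "\<bar>r - r'\<bar> \<le> 1" if "r \<in> {x..y}" "r' \<in> {x..y}" for r r' using that len1 by auto
    from holder_on_lower_exponent[OF hU \<beta>_range(1,5,4) order_refl this] show ?thesis by simp
  qed
  have cU: "continuous_on {x..y} U" using holder_on_imp_continuous_on[OF hU] \<beta>_range by simp
  have Upos: "0 < U r" "U r \<le> 4 * B" if "r \<in> {x..y}" for r
    using holder_on_bound[OF u that] B by (auto simp: U_def)
  have sp: "1 \<le> speed W1 r" "1 \<le> speed W2 r" for r by (rule speed_ge_one)+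
  have csp: "continuous_on {x..y} (speed W1)" "continuous_on {x..y} (speed W2)"
    using speed_continuous_on[OF W(1)] speed_continuous_on[OF W(2)] base
    by (auto intro: continuous_on_subset)
  have nz: "speed W2 r \<noteq> 0" for r using sp(2)[of r] by simp
  have cs: "continuous_on {x..y} s" unfolding s_def using csp nz by (intro continuous_on_divide) auto
  have spos: "0 < s r" "s r \<le> \<sigma>" if "r \<in> {x..y}" for r
  proof -
    show "0 < s r" using sp(1)[of r] sp(2)[of r] by (simp add: s_def)
    have "speed W1 r / speed W2 r \<le> speed W1 r / 1" using sp(1)[of r] sp(2)[of r] by (intro divide_left_mono) auto
    then show "s r \<le> \<sigma>" using speed_le[OF W(1) base(1)[OF that]] by (simp add: s_def)
  qed
  have Uratio: "U r \<le> U r' * exp (\<bar>r - r'\<bar> powr \<alpha> / 2)" if "r \<in> {x..y}" "r' \<in> {x..y}" for r r'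
    using shifted_holder_ratio[OF u B, of 3 r r'] that by (simp add: U_def)
  have sratio: "s r \<le> s r' * exp (\<bar>r - r'\<bar> powr \<alpha> / 2)" if rr: "r \<in> {x..y}" "r' \<in> {x..y}" for r r'
  proof -
    define d where "d = \<bar>r - r'\<bar>"
    have d: "0 \<le> d" "d \<le> 2 * \<delta>" using rr len\<delta> by (auto simp: d_def)
    have grow: "speed V r \<le> speed V r' * exp (\<Lambda> * d)" if "V \<in> \<W>" "r \<in> base V" "r' \<in> base V" "d = \<bar>r - r'\<bar>" for V r r'
    proof -
      have "speed V r \<le> speed V r' + \<Lambda> * d * 1" using speed_lipschitz[OF that(1-3)] that(4) by simp
      also have "\<dots> \<le> speed V r' + \<Lambda> * d * speed V r'"
        using d \<Lambda>_ge_one speed_ge_one[of V r'] by (intro add_left_mono mult_left_mono) auto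
      also have "\<dots> = speed V r' * (1 + \<Lambda> * d)" by (simp add: algebra_simps)
      also have "\<dots> \<le> speed V r' * exp (\<Lambda> * d)"
        using speed_ge_one[of V r'] by (intro mult_left_mono exp_ge_add_one_self) auto
      finally show ?thesis .
    qed
    have 1: "speed W1 r \<le> speed W1 r' * exp (\<Lambda> * d)" "speed W2 r' \<le> speed W2 r * exp (\<Lambda> * d)"
      using grow[OF W(1) base(1)[OF rr(1)] base(1)[OF rr(2)] d_def]
        grow[OF W(2) base(2)[OF rr(2)] base(2)[OF rr(1)]] by (auto simp: d_def abs_minus_commute)
    have "speed W1 r * speed W2 r' \<le> (speed W1 r' * exp (\<Lambda> * d)) * (speed W2 r * exp (\<Lambda> * d))"
      using 1 sp(1)[of r'] sp(2)[of r'] by (intro mult_mono) (auto intro: order_trans[OF zero_le_one])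
    then have 2: "s r \<le> s r' * exp (2 * (\<Lambda> * d))"
      unfolding exp_double power2_eq_square s_def using sp(2)[of r] sp(2)[of r'] by (simp add: field_simps)
    have "2 * (\<Lambda> * d) = 2 * \<Lambda> * (d powr \<alpha> * d powr (1 - \<alpha>))"
      using powr_add_split[OF d(1) \<beta>_range(3), of 1] d by simp
    also have "\<dots> \<le> 2 * \<Lambda> * (d powr \<alpha> * (2 * \<delta>) powr (1 - \<alpha>))"
      using d \<Lambda>_ge_one \<beta>_range by (intro mult_left_mono powr_mono2) auto
    also have "\<dots> = (4 * \<Lambda> * (2 * \<delta>) powr (1 - \<alpha>)) * (d powr \<alpha> / 2)" by simp
    also have "\<dots> \<le> 1 * (d powr \<alpha> / 2)" using \<delta>_small(3) by (intro mult_right_mono) auto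
    finally have "s r' * exp (2 * (\<Lambda> * d)) \<le> s r' * exp (d powr \<alpha> / 2)"
      using spos[OF rr(2)] by (intro mult_left_mono) auto
    then show ?thesis using 2 by (simp add: d_def)
  qed
  have exp_le: "exp (z / 2) \<le> exp (a * z)" "exp (z / 2) * exp (z / 2) \<le> exp (a * z)" if "0 \<le> z" for z
    using that constants mult_right_mono[of 1 a z] by (auto simp flip: exp_add)
  have \<psi>1: "lift U \<in> test_densities a \<alpha> V1"
  proof (rule test_densities_liftI)
    fix r r' assume "r \<in> base V1" "r' \<in> base V1"
    then have rr: "r \<in> {x..y}" "r' \<in> {x..y}" by (auto simp: Vbase)
    have "U r' * exp (\<bar>r - r'\<bar> powr \<alpha> / 2) \<le> U r' * exp (a * \<bar>r - r'\<bar> powr \<alpha>)"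
      using Upos(1)[OF rr(2)] by (intro mult_left_mono exp_le) auto
    then show "U r \<le> U r' * exp (a * \<bar>r - r'\<bar> powr \<alpha>)" using Uratio[OF rr] by linarith
  qed (use V1 cU Upos constants \<beta>_range in \<open>auto simp: Vbase\<close>)
  have \<psi>2: "lift (\<lambda>r. U r * s r) \<in> test_densities a \<alpha> V2"
  proof (rule test_densities_liftI)
    fix r r' assume "r \<in> base V2" "r' \<in> base V2"
    then have rr: "r \<in> {x..y}" "r' \<in> {x..y}" by (auto simp: Vbase)
    define z where "z = \<bar>r - r'\<bar> powr \<alpha>"
    have "U r * s r \<le> (U r' * exp (z / 2)) * (s r' * exp (z / 2))"
      using Uratio[OF rr] sratio[OF rr] Upos(1)[OF rr(2)] spos(1)[OF rr(1)]
      by (intro mult_mono) (auto simp: z_def)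
    also have "\<dots> = (U r' * s r') * (exp (z / 2) * exp (z / 2))" by (simp only: mult_ac)
    also have "\<dots> \<le> (U r' * s r') * exp (a * z)"
      using Upos(1)[OF rr(2)] spos(1)[OF rr(2)] by (intro mult_left_mono exp_le) (auto simp: z_def)
    finally show "U r * s r \<le> U r' * s r' * exp (a * \<bar>r - r'\<bar> powr \<alpha>)" by (simp add: z_def)
  next
    show "continuous_on (base V2) (\<lambda>r. U r * s r)" unfolding Vbase by (intro continuous_on_mult cU cs)
  qed (use V2 Upos spos constants \<beta>_range in \<open>auto simp: Vbase\<close>)
  have over: "overlap V1 V2 = {x..y}" using scat by (simp add: overlap_def V1_def V2_def)
  have match: "U r * speed W1 r = U r * s r * speed W2 r" for r using nz[of r] by (simp add: s_def)
  have star: "dist_star V1 V2 (lift U) (lift (\<lambda>r. U r * s r)) = 0"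
  proof (rule antisym)
    show "dist_star V1 V2 (lift U) (lift (\<lambda>r. U r * s r)) \<le> 0"
      unfolding dist_star_def over zero_ereal_def C0_norm_le_iff using match by (simp add: Vspeed)
    show "0 \<le> dist_star V1 V2 (lift U) (lift (\<lambda>r. U r * s r))"
      unfolding dist_star_def by (rule C0_norm_nonneg)
  qed
  have dist: "dist_Ws H V1 V2 \<le> ereal \<epsilon>" unfolding V1_def V2_def using near by (rule dist_Ws_sub_curve)
  have dist0: "0 \<le> dist_Ws H V1 V2"
    unfolding dist_Ws_def using C0_norm_nonneg by (auto simp: sym_diff_measure_def intro!: add_nonneg_nonneg)
  define d where "d = real_of_ereal (dist_Ws H V1 V2)"
  have d: "0 \<le> d" "d \<le> \<epsilon>" using dist dist0 unfolding d_def by (cases "dist_Ws H V1 V2"; simp)+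
  define K1 K2 where "K1 = seg_int W1 x y f U" and "K2 = seg_int W2 x y f (\<lambda>r. U r * s r)"
  define J where "J = seg_int W1 x y (\<lambda>_. 1) U"
  have J2: "J = seg_int W2 x y (\<lambda>_. 1) (\<lambda>r. U r * s r)"
    unfolding J_def seg_int_def by (simp only: mult_1_left match)
  define l1 l2 where "l1 = curve_len V1" and "l2 = curve_len V2"
  have l: "0 < l1" "y - x \<le> l1" "0 < l2" using V1 V2 by (auto simp: l1_def l2_def)
  have ints: "curve_int V1 (\<lambda>z. f z * lift U z) = K1" "curve_int V2 (\<lambda>z. f z * lift (\<lambda>r. U r * s r) z) = K2"
    unfolding V1_def V2_def K1_def K2_def
    by (rule curve_int_sub_curve[OF seg(1) lt] curve_int_sub_curve[OF seg(2) lt])+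
  have avgs: "curve_avg V1 (lift U) = J / l1" "curve_avg V2 (lift (\<lambda>r. U r * s r)) = J / l2"
    using curve_int_sub_curve[OF seg(1) lt, of "\<lambda>_. 1" U] curve_int_sub_curve[OF seg(2) lt, of "\<lambda>_. 1" "\<lambda>r. U r * s r"]
    by (simp_all add: curve_avg_def l1_def l2_def J_def[symmetric] J2[symmetric] V1_def V2_def)
  have Jpos: "0 < J" using density_integral_pos(1)[OF short(1) \<psi>1 \<beta>_range(3,4)] l by (simp add: avgs zero_less_divide_iff)
  have "J \<le> seg_int W1 x y (\<lambda>_. 1) (\<lambda>_. 4 * B)"
    unfolding J_def using Upos(2) cU by (intro seg_int_one_mono seg) auto
  also have "\<dots> = 4 * B * l1"
    using seg_int_one_const_whole[of V1 "4 * B"] seg_int_sub_curve[OF W(1) _ lt, of x y] segmentD[OF seg(1)]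
    by (simp add: V1_def l1_def)
  finally have J4: "J / l1 \<le> 4 * B" using l by (simp add: field_simps)
  have "\<bar>K1 / (J / l1) - K2 / (J / l2)\<bar> \<le> d powr \<gamma> * \<delta> powr (1 - \<gamma>) * c * A * m"
  proof -
    have "dist_Ws H V1 V2 \<le> ereal \<delta>" using dist \<epsilon>(2) by (auto intro: order_trans)
    from cone_atD(5)[OF m short this \<psi>1 \<psi>2 star] show ?thesis by (simp only: ints avgs d_def)
  qed
  also have "\<dots> \<le> \<epsilon> powr \<gamma> * \<delta> powr (1 - \<gamma>) * c * A * m"
    using d exponents c_pos constants m0 by (intro mult_right_mono powr_mono2) auto
  finally have cone: "\<bar>K1 / (J / l1) - K2 / (J / l2)\<bar> \<le> \<epsilon> powr \<gamma> * \<delta> powr (1 - \<gamma>) * c * A * m" .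
  \<comment> \<open>The averages \<open>J / l1\<close> and \<open>J / l2\<close> of the two densities differ only through the lengths.\<close>
  have K: "K1 - K2 = (J / l1) * (K1 / (J / l1) - K2 / (J / l2)) + K2 * ((l2 - l1) / l1)"
    using l Jpos by (simp add: field_simps)
  have K2: "\<bar>K2\<bar> \<le> short_const * m * (4 * B * \<sigma>) * 1"
  proof -
    have "lift (\<lambda>r. U r * s r) \<in> test_densities a \<beta> V2"
      using constants \<beta>_range by (intro test_densities_lower_exponent[OF V2(1) short_curvesD(3)[OF short(2)] _ _ _ \<psi>2]) auto
    moreover have "U r * s r \<le> 4 * B * \<sigma>" if "r \<in> {x..y}" for r
      using Upos[OF that] spos[OF that] by (intro mult_mono) auto
    ultimately have "\<bar>K2\<bar> \<le> short_const * m * (4 * B * \<sigma>) * (y - x) powr (1/p)"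
      unfolding K2_def V2_def using seg(2) lt xy by (intro cone_at_density_bound[OF m]) auto
    also have "\<dots> \<le> short_const * m * (4 * B * \<sigma>) * 1"
      using lt len1 p_inverse short_const_nonneg m0 B \<sigma>_ge_one by (intro mult_left_mono powr_le1) auto
    finally show ?thesis .
  qed
  have "\<bar>l2 - l1\<bar> \<le> \<epsilon> * l1"
  proof -
    have "l1 = seg_int W1 x y (\<lambda>_. 1) (\<lambda>_. 1)" "l2 = seg_int W2 x y (\<lambda>_. 1) (\<lambda>_. 1)"
      using seg_int_one_const_whole[of V1 1] seg_int_sub_curve[OF W(1) _ lt, of x y] segmentD[OF seg(1)]
        seg_int_one_const_whole[of V2 1] seg_int_sub_curve[OF W(2) _ lt, of x y] segmentD[OF seg(2)]
      by (simp_all add: V1_def V2_def l1_def l2_def)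
    then have "\<bar>l2 - l1\<bar> \<le> \<epsilon> * (y - x)" using seg_int_one_near[OF near] by (simp add: abs_minus_commute)
    also have "\<dots> \<le> \<epsilon> * l1" using l \<epsilon> by (intro mult_left_mono) auto
    finally show ?thesis .
  qed
  then have l12: "\<bar>(l2 - l1) / l1\<bar> \<le> \<epsilon> powr \<gamma>"
    using l \<epsilon>_powr_le(3)[OF \<epsilon>(1) \<epsilon>1] by (simp add: abs_divide divide_le_eq) (meson order_trans mult_right_mono less_imp_le)
  have "\<bar>K1 - K2\<bar> \<le> (J / l1) * \<bar>K1 / (J / l1) - K2 / (J / l2)\<bar> + \<bar>K2\<bar> * \<bar>(l2 - l1) / l1\<bar>"
    unfolding K using abs_triangle_ineq[of "(J / l1) * (K1 / (J / l1) - K2 / (J / l2))" "K2 * ((l2 - l1) / l1)"] Jpos l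
    by (simp only: abs_mult abs_of_pos divide_pos_pos)
  also have "\<dots> \<le> (4 * B) * (\<epsilon> powr \<gamma> * \<delta> powr (1 - \<gamma>) * c * A * m) + (short_const * m * (4 * B * \<sigma>) * 1) * \<epsilon> powr \<gamma>"
    using J4 cone K2 l12 B Jpos l short_const_nonneg m0 \<sigma>_ge_one by (intro add_mono mult_mono) auto
  finally have 1: "\<bar>K1 - K2\<bar> \<le> (4 * \<delta> powr (1 - \<gamma>) * c * A + 4 * short_const * \<sigma>) * m * B * \<epsilon> powr \<gamma>"
    by (simp add: algebra_simps)
  \<comment> \<open>Remove the arclength correction \<open>s\<close> from the density on the second curve.\<close>
  have hk: "holder_on {x..y} \<beta> (4 * \<Lambda>\<^sup>2 * \<epsilon> powr (1 - \<beta>)) (\<lambda>r. 1 - s r)"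
    unfolding s_def using near len1 \<epsilon> \<epsilon>1 \<beta>_range by (intro near_speed_ratio_holder) auto
  have "seg_int W2 x y f U - K2 = seg_int W2 x y f (\<lambda>r. U r * (1 - s r))"
    unfolding K2_def
    by (subst seg_int_diff[OF seg(2) f cU continuous_on_mult[OF cU cs], symmetric])
       (simp add: algebra_simps)
  also have "\<bar>\<dots>\<bar> \<le> 5 * short_const * m * (2 * (4 * B) * (4 * \<Lambda>\<^sup>2 * \<epsilon> powr (1 - \<beta>))) * (y - x) powr (1/p)"
    by (rule cone_at_stable_short[OF f m seg(2) xy holder_on_mult[OF hUb hk]])
  also have "\<dots> \<le> 5 * short_const * m * (2 * (4 * B) * (4 * \<Lambda>\<^sup>2 * \<epsilon> powr \<gamma>)) * 1"
    using lt len1 p_inverse short_const_nonneg m0 B \<epsilon>_powr_le(2)[OF \<epsilon>(1) \<epsilon>1]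
    by (intro mult_mono mult_left_mono powr_le1) auto
  finally have 2: "\<bar>seg_int W2 x y f U - K2\<bar> \<le> 160 * short_const * \<Lambda>\<^sup>2 * m * B * \<epsilon> powr \<gamma>"
    by (simp add: mult_ac)
  have "\<bar>K1 - seg_int W2 x y f U\<bar> \<le> (4 * \<delta> powr (1 - \<gamma>) * c * A + 4 * short_const * \<sigma>) * m * B * \<epsilon> powr \<gamma>
      + 160 * short_const * \<Lambda>\<^sup>2 * m * B * \<epsilon> powr \<gamma>"
    using 1 2 by linarith
  then show ?thesis by (simp add: K1_def U_def shifted_const_def algebra_simps)
qed

text \<open>Subtracting the estimate for the function 0 from that for \<open>u\<close> removes the shift.\<close>

lemma cone_at_unstable_short:
  assumes f: "curve_continuous f" and m: "cone_at m f" and near: "near \<epsilon> W1 W2 x y"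
    and \<epsilon>: "0 < \<epsilon>" "\<epsilon> \<le> \<delta>" and xy: "\<sigma> * (y - x) \<le> 2 * \<delta>" and u: "holder_on {x..y} \<alpha> B u"
  shows "\<bar>seg_int W1 x y f u - seg_int W2 x y f u\<bar> \<le> 2 * shifted_const * m * B * \<epsilon> powr \<gamma>"
proof -
  have seg: "segment W1 x y" "segment W2 x y" and lt: "x < y" using near by (auto simp: near_def)
  have B0: "0 \<le> B" using holder_on_nonneg[OF u] lt by auto
  show ?thesis
  proof (cases "B = 0")
    case True
    then have "u r = 0" if "r \<in> {x..y}" for r using holder_on_bound[OF u that] by simp
    then have "seg_int W x y f u = 0" for W by (rule seg_int_zero)
    then show ?thesis using True by simp
  next
    case False
    then have B: "0 < B" using B0 by simp
    have cu: "continuous_on {x..y} u" using holder_on_imp_continuous_on[OF u] \<beta>_range by simp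
    have "holder_on {x..y} \<alpha> B (\<lambda>_. 0)" using B by (simp add: holder_on_def)
    from cone_at_unstable_shifted[OF f m near \<epsilon> xy this B] cone_at_unstable_shifted[OF f m near \<epsilon> xy u B]
    show ?thesis
      using seg_int_add[OF seg(1) f cu continuous_on_const, of "3 * B"]
        seg_int_add[OF seg(2) f cu continuous_on_const, of "3 * B"] by simp
  qed
qed

text \<open>The function \<open>g\<close> is half the difference of \<open>g + t\<close> and \<open>- g + t\<close>, whose witnesses have sum at most
  \<open>2 t\<close>. Bisection extends the estimates from short to arbitrary segments. The third cone
  condition says nothing about distances above \<open>\<delta>\<close>; there \<open>\<epsilon>\<^bsup>\<gamma>\<^esup> \<ge> \<delta>\<^bsup>\<gamma>\<^esup>\<close>, and the stable bound
  on each of the two curves is enough.\<close>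

lemma cone_at_imp_bounds:
  "\<exists>C\<ge>0. \<forall>g t m m'. curve_continuous g \<longrightarrow> cone_at m (\<lambda>x. g x + t) \<longrightarrow> cone_at m' (\<lambda>x. - g x + t) \<longrightarrow>
     0 \<le> t \<longrightarrow> stable_bound (C * t) g \<and> unstable_bound (C * t) g"
proof -
  obtain n where n: "R * \<sigma> / (2 * \<delta>) < 2 ^ n" using real_arch_pow[of 2] by auto
  have nR: "R \<le> 2 ^ n * (2 * \<delta> / \<sigma>)" using n constants \<sigma>_ge_one by (simp add: field_simps)
  define C1 where "C1 = 2 ^ n * (5 * short_const)"
  define C2 where "C2 = 2 ^ n * (2 * shifted_const)"
  define C3 where "C3 = 2 * C1 * R * R / \<delta> powr \<gamma>"
  have C: "0 \<le> C1" "0 \<le> C2" "0 \<le> C3"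
    using short_const_nonneg shifted_const_nonneg R(1) by (auto simp: C1_def C2_def C3_def)
  define C where "C = max C1 (max C2 C3)"
  have "stable_bound (C * t) g \<and> unstable_bound (C * t) g"
    if g: "curve_continuous g" and m: "cone_at m (\<lambda>x. g x + t)" "cone_at m' (\<lambda>x. - g x + t)" and t: "0 \<le> t" for g t m m'
  proof -
    define f f' where "f = (\<lambda>x. g x + t)" and "f' = (\<lambda>x. - g x + t)"
    have f: "curve_continuous f" "curve_continuous f'"
      using curve_continuous_add[OF g, of "\<lambda>_. t"]
        curve_continuous_add[OF curve_continuous_cmult[OF g, of "-1"], of "\<lambda>_. t"]
      by (auto simp: f_def f'_def)
    note m' = m[folded f_def f'_def]
    have mm: "m + m' \<le> 2 * t" by (rule cone_at_opposite[OF f m']) (simp add: f_def f'_def)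
    have split: "seg_int W x y g u = (seg_int W x y f u - seg_int W x y f' u) / 2"
      if "segment W x y" "continuous_on {x..y} u" for W x y u
    proof -
      have "seg_int W x y f u = seg_int W x y g u + seg_int W x y (\<lambda>_. t) u"
        unfolding f_def using that g by (intro seg_int_add_left) auto
      moreover have "seg_int W x y f' u = seg_int W x y (\<lambda>x. -1 * g x) u + seg_int W x y (\<lambda>_. t) u"
        unfolding f'_def using seg_int_add_left[OF that(1) curve_continuous_cmult[OF g, of "-1"] _ that(2), of "\<lambda>_. t"] by simp
      moreover have "seg_int W x y (\<lambda>x. -1 * g x) u = - seg_int W x y g u"
        using seg_int_cmult_left[of W x y "-1" g u] by simp
      ultimately show ?thesis by simp
    qed
    have avg: "K * m * X + K * m' * X \<le> 2 * (K * t * X)" if "0 \<le> K" "0 \<le> X" for K X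
      using mult_right_mono[OF mult_left_mono[OF mm that(1)] that(2)] by (simp add: algebra_simps)
    have stable_short: "\<bar>seg_int W x y g u\<bar> \<le> 5 * short_const * t * (B * (y - x) powr (1/p))"
      if seg: "segment W x y" and xy: "\<sigma> * (y - x) \<le> 2 * \<delta>" and u: "holder_on {x..y} \<beta> B u" for W x y B u
    proof -
      have B: "0 \<le> B" using holder_on_nonneg[OF u] segmentD[OF seg] by auto
      have "continuous_on {x..y} u" using holder_on_imp_continuous_on[OF u] \<beta>_range by simp
      note split[OF seg this]
      moreover have "\<bar>seg_int W x y f u\<bar> \<le> 5 * short_const * m * (B * (y - x) powr (1/p))"
        "\<bar>seg_int W x y f' u\<bar> \<le> 5 * short_const * m' * (B * (y - x) powr (1/p))"
        using cone_at_stable_short[OF f(1) m'(1) seg xy u] cone_at_stable_short[OF f(2) m'(2) seg xy u]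
        by (simp_all add: mult_ac)
      ultimately show ?thesis
        using avg[of "5 * short_const" "B * (y - x) powr (1/p)"] short_const_nonneg B by (simp add: abs_le_iff)
    qed
    have unstable_short: "\<bar>seg_int W1 x y g u - seg_int W2 x y g u\<bar> \<le> 2 * shifted_const * t * (B * \<epsilon> powr \<gamma>)"
      if near: "near \<epsilon> W1 W2 x y" and \<epsilon>: "0 < \<epsilon>" "\<epsilon> \<le> \<delta>" and xy: "\<sigma> * (y - x) \<le> 2 * \<delta>"
        and u: "holder_on {x..y} \<alpha> B u" for \<epsilon> W1 W2 x y B u
    proof -
      have seg: "segment W1 x y" "segment W2 x y" and lt: "x < y" using near by (auto simp: near_def)
      have B: "0 \<le> B" using holder_on_nonneg[OF u] lt by auto
      have "continuous_on {x..y} u" using holder_on_imp_continuous_on[OF u] \<beta>_range by simp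
      note split[OF seg(1) this] split[OF seg(2) this]
      moreover have "\<bar>seg_int W1 x y f u - seg_int W2 x y f u\<bar> \<le> 2 * shifted_const * m * (B * \<epsilon> powr \<gamma>)"
        "\<bar>seg_int W1 x y f' u - seg_int W2 x y f' u\<bar> \<le> 2 * shifted_const * m' * (B * \<epsilon> powr \<gamma>)"
        using cone_at_unstable_short[OF f(1) m'(1) near \<epsilon> xy u] cone_at_unstable_short[OF f(2) m'(2) near \<epsilon> xy u]
        by (simp_all add: mult_ac)
      ultimately show ?thesis
        using avg[of "2 * shifted_const" "B * \<epsilon> powr \<gamma>"] shifted_const_nonneg B by (simp add: abs_le_iff field_simps)
    qed
    have small: "\<sigma> * (y - x) \<le> 2 * \<delta>" if "y - x \<le> 2 * \<delta> / \<sigma>" for x y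
      using that \<sigma>_ge_one by (simp add: field_simps)
    have long: "y - x \<le> 2 ^ n * (2 * \<delta> / \<sigma>)" if "segment W x y" for W x y
      using nR R(2)[of W] segmentD[OF that] by simp
    have stable: "\<bar>seg_int W X Y g u\<bar> \<le> C1 * t * B * (Y - X) powr (1/p)"
      if seg: "segment W X Y" and u: "holder_on {X..Y} \<beta> B u" for W X Y B u
    proof -
      have B: "0 \<le> B" using holder_on_nonneg[OF u] segmentD[OF seg] by auto
      have cu: "continuous_on {X..Y} u" using holder_on_imp_continuous_on[OF u] \<beta>_range by simp
      have sub: "segment W x y" if "X \<le> x" "x \<le> y" "y \<le> Y" for x y
        using seg that by (auto simp: segment_def)
      have "\<bar>seg_int W X Y g u\<bar> \<le> 2 ^ n * (5 * short_const * t * (B * (Y - X) powr (1/p)))"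
      proof (rule bisection_bound[where X = X and Y = Y and \<Phi> = "\<lambda>x y. seg_int W x y g u"])
        fix x y z assume "X \<le> x" "x \<le> z" "z \<le> y" "y \<le> Y"
        then show "seg_int W x y g u = seg_int W x z g u + seg_int W z y g u"
          by (intro seg_int_split[OF sub g] continuous_on_subset[OF cu]) auto
      next
        fix x y assume xy: "X \<le> x" "x \<le> y" "y \<le> Y" "y - x \<le> 2 * \<delta> / \<sigma>"
        have "\<bar>seg_int W x y g u\<bar> \<le> 5 * short_const * t * (B * (y - x) powr (1/p))"
          using xy by (intro stable_short sub small holder_on_subset[OF u]) auto
        also have "\<dots> \<le> 5 * short_const * t * (B * (Y - X) powr (1/p))"
          using xy short_const_nonneg t B p_inverse by (intro mult_left_mono powr_mono2) auto
        finally show "\<bar>seg_int W x y g u\<bar> \<le> 5 * short_const * t * (B * (Y - X) powr (1/p))" .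
      qed (use segmentD[OF seg] long[OF seg] in auto)
      then show ?thesis by (simp add: C1_def mult_ac)
    qed
    have unstable: "\<bar>seg_int W1 X Y g u - seg_int W2 X Y g u\<bar> \<le> max C2 C3 * t * B * \<epsilon> powr \<gamma>"
      if near: "near \<epsilon> W1 W2 X Y" and \<epsilon>: "0 < \<epsilon>" and u: "holder_on {X..Y} \<alpha> B u" for \<epsilon> W1 W2 X Y B u
    proof -
      have seg: "segment W1 X Y" "segment W2 X Y" and lt: "X < Y" using near by (auto simp: near_def)
      have B: "0 \<le> B" using holder_on_nonneg[OF u] lt by auto
      have cu: "continuous_on {X..Y} u" using holder_on_imp_continuous_on[OF u] \<beta>_range by simp
      show ?thesis
      proof (cases "\<epsilon> \<le> \<delta>")
        case True
        have sub: "segment W1 x y" "segment W2 x y" if "X \<le> x" "x \<le> y" "y \<le> Y" for x y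
          using seg that by (auto simp: segment_def)
        have s0: "0 \<le> 2 * shifted_const * t * (B * \<epsilon> powr \<gamma>)" using shifted_const_nonneg t B by simp
        have "\<bar>seg_int W1 X Y g u - seg_int W2 X Y g u\<bar> \<le> 2 ^ n * (2 * shifted_const * t * (B * \<epsilon> powr \<gamma>))"
        proof (rule bisection_bound[where X = X and Y = Y and \<Phi> = "\<lambda>x y. seg_int W1 x y g u - seg_int W2 x y g u"])
          fix x y z assume *: "X \<le> x" "x \<le> z" "z \<le> y" "y \<le> Y"
          then have xy: "x \<le> y" and cu': "continuous_on {x..y} u" by (auto intro: continuous_on_subset[OF cu])
          show "seg_int W1 x y g u - seg_int W2 x y g u =
              (seg_int W1 x z g u - seg_int W2 x z g u) + (seg_int W1 z y g u - seg_int W2 z y g u)"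
            using seg_int_split[OF sub(1)[OF *(1) xy *(4)] g cu' *(2,3)]
              seg_int_split[OF sub(2)[OF *(1) xy *(4)] g cu' *(2,3)] by simp
        next
          fix x y assume xy: "X \<le> x" "x \<le> y" "y \<le> Y" "y - x \<le> 2 * \<delta> / \<sigma>"
          show "\<bar>seg_int W1 x y g u - seg_int W2 x y g u\<bar> \<le> 2 * shifted_const * t * (B * \<epsilon> powr \<gamma>)"
          proof (cases "x = y")
            case False
            then show ?thesis
              using xy \<epsilon> True
              by (intro unstable_short small near_shrink[OF near] holder_on_subset[OF u]) auto
          qed (use s0 in simp)
        qed (use lt long[OF seg(1)] in auto)
        also have "\<dots> = C2 * (t * B * \<epsilon> powr \<gamma>)" by (simp add: C2_def mult_ac)
        also have "\<dots> \<le> max C2 C3 * (t * B * \<epsilon> powr \<gamma>)" using t B by (intro mult_right_mono) auto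
        finally show ?thesis by (simp add: mult_ac)
      next
        case False
        have YX: "Y - X \<le> R" using R(2)[of W1] segmentD[OF seg(1)] by simp
        have ub: "holder_on {X..Y} \<beta> (B * R) u"
          using YX R(1) \<beta>_range by (intro holder_on_lower_exponent[OF u]) auto
        have each: "\<bar>seg_int W X Y g u\<bar> \<le> C1 * t * (B * R) * R" if "segment W X Y" for W
        proof -
          have "\<bar>seg_int W X Y g u\<bar> \<le> C1 * t * (B * R) * (Y - X) powr (1/p)" by (rule stable[OF that ub])
          also have "\<dots> \<le> C1 * t * (B * R) * R"
            using C t B R(1) YX lt p_inverse by (intro mult_left_mono powr_le_of_le_one_exponent) auto
          finally show ?thesis .
        qed
        have "\<delta> powr \<gamma> \<le> \<epsilon> powr \<gamma>" using False constants exponents by (intro powr_mono2) auto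
        then have "1 \<le> \<epsilon> powr \<gamma> / \<delta> powr \<gamma>" using constants by simp
        then have "2 * C1 * R * R * (t * B) * 1 \<le> 2 * C1 * R * R * (t * B) * (\<epsilon> powr \<gamma> / \<delta> powr \<gamma>)"
          using C t B R(1) by (intro mult_left_mono) auto
        also have "\<dots> = C3 * (t * B * \<epsilon> powr \<gamma>)" by (simp add: C3_def)
        also have "\<dots> \<le> max C2 C3 * (t * B * \<epsilon> powr \<gamma>)" using t B by (intro mult_right_mono) auto
        finally have "2 * (C1 * t * (B * R) * R) \<le> max C2 C3 * t * B * \<epsilon> powr \<gamma>" by (simp add: mult_ac)
        then show ?thesis using each[OF seg(1)] each[OF seg(2)] by linarith
      qed
    qed
    have mono: "K * t * B * X \<le> C * t * B * X" if "K \<le> C" "0 \<le> B" "0 \<le> X" for K B X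
      using that t by (intro mult_right_mono) auto
    have "stable_bound (C * t) g"
      unfolding stable_bound_def
    proof (intro allI impI)
      fix W x y B u assume seg: "segment W x y" and u: "holder_on {x..y} \<beta> B u"
      have "0 \<le> B" using holder_on_nonneg[OF u] segmentD[OF seg] by auto
      then show "\<bar>seg_int W x y g u\<bar> \<le> C * t * B * (y - x) powr (1/p)"
        using stable[OF seg u] mono[of C1 B "(y - x) powr (1/p)"] by (simp add: C_def)
    qed
    moreover have "unstable_bound (C * t) g"
      unfolding unstable_bound_def
    proof (intro allI impI)
      fix \<epsilon> W1 W2 x y B u
      assume \<epsilon>: "0 < \<epsilon>" "\<epsilon> \<le> \<epsilon>0" and near: "near \<epsilon> W1 W2 x y" and u: "holder_on {x..y} \<alpha> B u"
      have "0 \<le> B" using holder_on_nonneg[OF u] near by (auto simp: near_def)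
      then show "\<bar>seg_int W1 x y g u - seg_int W2 x y g u\<bar> \<le> C * t * B * \<epsilon> powr \<gamma>"
        using unstable[OF near \<epsilon>(1) u] mono[of "max C2 C3" B "\<epsilon> powr \<gamma>"] by (simp add: C_def)
    qed
    ultimately show ?thesis ..
  qed
  moreover have "0 \<le> C" using C by (simp add: C_def)
  ultimately show ?thesis by blast
qed

end

section \<open>The order norm on functions continuous along curves\<close>

context cone_setting
begin

text \<open>For functions that are continuous along curves this means \<open>- t \<preceq> g \<preceq> t\<close>.\<close>

definition between :: "real \<Rightarrow> (pt \<Rightarrow> real) \<Rightarrow> bool" where
  "between t g \<longleftrightarrow> (\<exists>m. cone_at m (\<lambda>x. g x + t)) \<and> (\<exists>m. cone_at m (\<lambda>x. - g x + t))"

lemma curve_continuous_uminus: "curve_continuous g \<Longrightarrow> curve_continuous (\<lambda>x. - g x)"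
  using curve_continuous_cmult[of g "-1"] by simp

lemma curve_continuous_shift: "curve_continuous g \<Longrightarrow> curve_continuous (\<lambda>x. g x + t)"
  by (intro curve_continuous_add curve_continuous_const)

lemma cone_iff_cone_at:
  "curve_continuous f \<Longrightarrow> f \<in> the_cone \<or> (\<forall>x\<in>M. f x = 0) \<longleftrightarrow> (\<exists>m. cone_at m f)"
  using cone_imp_cone_at cone_at_imp_cone by blast

lemma norm_star_eq:
  assumes g: "curve_continuous g"
  shows "norm_star M the_cone g = Inf {ereal t | t. 0 < t \<and> between t g}"
proof -
  have "cone_le M the_cone (\<lambda>_. - t) g \<longleftrightarrow> (\<exists>m. cone_at m (\<lambda>x. g x + t))" for t
    unfolding cone_le_def using cone_iff_cone_at[OF curve_continuous_shift[OF g, of t]] by simp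
  moreover have "cone_le M the_cone g (\<lambda>_. t) \<longleftrightarrow> (\<exists>m. cone_at m (\<lambda>x. - g x + t))" for t
  proof -
    have "(\<lambda>x. t - g x) = (\<lambda>x. - g x + t)" by auto
    then show ?thesis
      unfolding cone_le_def
      using cone_iff_cone_at[OF curve_continuous_shift[OF curve_continuous_uminus[OF g], of t]] by simp
  qed
  ultimately show ?thesis by (simp add: norm_star_def between_def)
qed

lemma between_add:
  assumes "curve_continuous f" "curve_continuous g" "between s f" "between t g"
  shows "between (s + t) (\<lambda>x. f x + g x)"
proof -
  have 1: "(\<lambda>x. f x + s + (g x + t)) = (\<lambda>x. f x + g x + (s + t))"
    "(\<lambda>x. - f x + s + (- g x + t)) = (\<lambda>x. - (f x + g x) + (s + t))" by auto
  obtain m1 m2 m3 m4 where "cone_at m1 (\<lambda>x. f x + s)" "cone_at m2 (\<lambda>x. - f x + s)"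
    "cone_at m3 (\<lambda>x. g x + t)" "cone_at m4 (\<lambda>x. - g x + t)"
    using assms(3,4) by (auto simp: between_def)
  then have "cone_at (m1 + m3) (\<lambda>x. f x + s + (g x + t))" "cone_at (m2 + m4) (\<lambda>x. - f x + s + (- g x + t))"
    using cone_at_add[OF curve_continuous_shift[OF assms(1)] curve_continuous_shift[OF assms(2)]]
      cone_at_add[OF curve_continuous_shift[OF curve_continuous_uminus[OF assms(1)]]
        curve_continuous_shift[OF curve_continuous_uminus[OF assms(2)]]] by auto
  then show ?thesis unfolding between_def 1 by blast
qed

lemma norm_star_triangle:
  assumes f: "curve_continuous f" and g: "curve_continuous g"
    and r: "norm_star M the_cone f = ereal r" and s: "norm_star M the_cone g = ereal s"
  shows "norm_star M the_cone (\<lambda>x. f x + g x) \<le> ereal (r + s)"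
proof (rule ereal_le_epsilon2)
  fix e :: real assume e: "0 < e"
  have approx: "\<exists>t>0. between t h \<and> t < z + e / 2"
    if "curve_continuous h" "norm_star M the_cone h = ereal z" for h z
  proof -
    have "Inf {ereal t | t. 0 < t \<and> between t h} < ereal (z + e / 2)"
      using that(2) e unfolding norm_star_eq[OF that(1)] by simp
    then show ?thesis unfolding Inf_less_iff by auto
  qed
  obtain t where t: "0 < t" "between t f" "t < r + e / 2" using approx[OF f r] by blast
  obtain t' where t': "0 < t'" "between t' g" "t' < s + e / 2" using approx[OF g s] by blast
  have "norm_star M the_cone (\<lambda>x. f x + g x) \<le> ereal (t + t')"
    unfolding norm_star_eq[OF curve_continuous_add[OF f g]]
    using between_add[OF f g t(2) t'(2)] t(1) t'(1) by (intro Inf_lower) auto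
  also have "\<dots> \<le> ereal (r + s) + ereal e" using t(3) t'(3) by simp
  finally show "norm_star M the_cone (\<lambda>x. f x + g x) \<le> ereal (r + s) + ereal e" .
qed

lemma stable_bound_mono:
  assumes "stable_bound b g" "b \<le> b'"
  shows "stable_bound b' g"
  unfolding stable_bound_def
proof (intro allI impI)
  fix W x y B u assume *: "segment W x y" "holder_on {x..y} \<beta> B u"
  have "0 \<le> B" using holder_on_nonneg[OF *(2)] segmentD[OF *(1)] by auto
  then have "b * B * (y - x) powr (1/p) \<le> b' * B * (y - x) powr (1/p)"
    using assms(2) by (intro mult_right_mono) auto
  then show "\<bar>seg_int W x y g u\<bar> \<le> b' * B * (y - x) powr (1/p)"
    using stable_boundD[OF assms(1) *] by linarith
qed

lemma unstable_bound_mono: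
  assumes "unstable_bound b g" "b \<le> b'"
  shows "unstable_bound b' g"
  unfolding unstable_bound_def
proof (intro allI impI)
  fix \<epsilon> W1 W2 x y B u
  assume *: "0 < \<epsilon>" "\<epsilon> \<le> \<epsilon>0" "near \<epsilon> W1 W2 x y" "holder_on {x..y} \<alpha> B u"
  have "0 \<le> B" using holder_on_nonneg[OF *(4)] *(3) by (auto simp: near_def)
  then have "b * B * \<epsilon> powr \<gamma> \<le> b' * B * \<epsilon> powr \<gamma>"
    using assms(2) by (intro mult_right_mono) auto
  then show "\<bar>seg_int W1 x y g u - seg_int W2 x y g u\<bar> \<le> b' * B * \<epsilon> powr \<gamma>"
    using unstable_boundD[OF assms(1) *] by linarith
qed

lemma seg_int_uminus: "seg_int W x y (\<lambda>z. - g z) u = - seg_int W x y g u"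
  using seg_int_cmult_left[of W x y "-1" g u] by simp

lemma bounds_uminus:
  "stable_bound b g \<Longrightarrow> stable_bound b (\<lambda>z. - g z)" "unstable_bound b g \<Longrightarrow> unstable_bound b (\<lambda>z. - g z)"
proof -
  have "\<bar>- p - - q\<bar> = \<bar>p - q\<bar>" for p q :: real by simp
  then show "stable_bound b g \<Longrightarrow> stable_bound b (\<lambda>z. - g z)"
    "unstable_bound b g \<Longrightarrow> unstable_bound b (\<lambda>z. - g z)"
    unfolding stable_bound_def unstable_bound_def seg_int_uminus by simp_all
qed

text \<open>The upper bound for the order norm says that \<open>C b\<close> is admissible in its infimum, the lower bound that
  all admissible \<open>t\<close> satisfy \<open>b \<le> C t\<close>. For \<open>b = 0\<close> the number \<open>C b\<close> is only a limit of admissible ones.\<close>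

lemma norm_star_equivalent:
  "\<exists>C\<ge>1. \<forall>g b. curve_continuous g \<longrightarrow> norm_B H \<W> \<alpha> \<beta> \<gamma> p \<epsilon>0 cu g = ereal b \<longrightarrow> 0 \<le> b \<longrightarrow>
     (\<exists>r. norm_star M the_cone g = ereal r \<and> r \<le> C * b \<and> b \<le> C * r)"
proof -
  obtain C1 where C1: "1 \<le> C1" "\<And>g b t. curve_continuous g \<Longrightarrow> stable_bound b g \<Longrightarrow>
      unstable_bound b g \<Longrightarrow> 0 \<le> b \<Longrightarrow> C1 * b \<le> t \<Longrightarrow> \<exists>m. cone_at m (\<lambda>x. g x + t)"
    using bounds_imp_cone_at by blast
  obtain C2 where C2: "0 \<le> C2" "\<And>g t m m'. curve_continuous g \<Longrightarrow> cone_at m (\<lambda>x. g x + t) \<Longrightarrow>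
      cone_at m' (\<lambda>x. - g x + t) \<Longrightarrow> 0 \<le> t \<Longrightarrow> stable_bound (C2 * t) g \<and> unstable_bound (C2 * t) g"
    using cone_at_imp_bounds by blast
  define k where "k = max (2 * \<sigma>) (2 / cu)"
  have k: "2 * \<sigma> \<le> k" "2 / cu \<le> k" "0 \<le> k" using \<sigma>_ge_one by (auto simp: k_def)
  define k' where "k' = \<sigma> + cu * (5 * \<sigma> * R * max 1 \<epsilon>0)"
  have k': "0 \<le> k'" using \<sigma>_ge_one cu_pos R(1) by (simp add: k'_def)
  define C where "C = max 1 (max (C1 * k) (k' * C2))"
  have C: "1 \<le> C" "C1 * k \<le> C" "k' * C2 \<le> C" by (auto simp: C_def)
  have "\<exists>r. norm_star M the_cone g = ereal r \<and> r \<le> C * b \<and> b \<le> C * r"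
    if g: "curve_continuous g" and nb: "norm_B H \<W> \<alpha> \<beta> \<gamma> p \<epsilon>0 cu g = ereal b" and b: "0 \<le> b" for g b
  proof -
    define T where "T = {ereal t | t. 0 < t \<and> between t g}"
    have N: "norm_star M the_cone g = Inf T" unfolding T_def by (rule norm_star_eq[OF g])
    have "stable_bound (2 * \<sigma> * b) g" "unstable_bound (2 / cu * b) g"
      using norm_B_imp_bounds[of g b] nb by simp_all
    then have bd: "stable_bound (k * b) g" "unstable_bound (k * b) g"
      using mult_right_mono[OF k(1) b] mult_right_mono[OF k(2) b]
      by (blast intro: stable_bound_mono unstable_bound_mono)+
    have kb: "0 \<le> k * b" using k b by simp
    have bt: "between t g" if "C * b \<le> t" for t
    proof -
      have "C1 * (k * b) \<le> t" using mult_right_mono[OF C(2) b] that by simp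
      then show ?thesis
        unfolding between_def
        using C1(2)[OF g bd kb] C1(2)[OF curve_continuous_uminus[OF g] bounds_uminus(1)[OF bd(1)] bounds_uminus(2)[OF bd(2)] kb]
        by blast
    qed
    have up: "Inf T \<le> ereal (C * b)"
    proof (rule ereal_le_epsilon2)
      fix e :: real assume e: "0 < e"
      have "0 \<le> C * b" using C(1) b by simp
      then show "Inf T \<le> ereal (C * b) + ereal e"
        using e bt[of "C * b + e"] by (auto simp: T_def intro!: Inf_lower)
    qed
    have low: "ereal (b / C) \<le> Inf T"
    proof (rule Inf_greatest)
      fix z assume "z \<in> T"
      then obtain t m m' where t: "z = ereal t" "0 < t" "cone_at m (\<lambda>x. g x + t)" "cone_at m' (\<lambda>x. - g x + t)"
        by (auto simp: T_def between_def)
      have "stable_bound (C2 * t) g" "unstable_bound (C2 * t) g" using C2(2)[OF g t(3,4)] t(2) by auto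
      from bounds_imp_norm_B[OF g this] have "b \<le> k' * (C2 * t)"
        using nb C2(1) t(2) by (simp add: k'_def)
      also have "\<dots> \<le> C * t" using mult_right_mono[OF C(3), of t] t(2) by simp
      finally show "ereal (b / C) \<le> z" using C(1) t(1) by (simp add: field_simps)
    qed
    obtain r where r: "Inf T = ereal r" using up low by (cases "Inf T") auto
    have "r \<le> C * b" "b / C \<le> r" using up low by (simp_all add: r)
    then show ?thesis using N r C(1) by (auto simp: field_simps)
  qed
  then show ?thesis using C(1) by blast
qed

end

section \<open>Extension to the completion\<close>

text \<open>By the triangle inequality and the upper bound, \<open>\<nu>\<close> is Lipschitz with respect to the norm of the
  completion. Hence its value depends only on the image under \<open>\<iota>\<close>, and it extends to the closure of
  the image, where both inequalities persist by continuity.\<close>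

lemma extend_equivalent_norm:
  fixes \<iota> :: "(pt \<Rightarrow> real) \<Rightarrow> 'b::banach" and \<nu> :: "(pt \<Rightarrow> real) \<Rightarrow> ereal"
  assumes compl: "is_completion V NB \<iota> X"
    and V: "\<And>f g k. f \<in> V \<Longrightarrow> g \<in> V \<Longrightarrow> (\<lambda>x. f x + k * g x) \<in> V"
    and C: "1 \<le> C"
    and equiv: "\<And>g b. g \<in> V \<Longrightarrow> NB g = ereal b \<Longrightarrow> 0 \<le> b \<Longrightarrow> \<exists>r. \<nu> g = ereal r \<and> r \<le> C * b \<and> b \<le> C * r"
    and triangle: "\<And>f g r s. f \<in> V \<Longrightarrow> g \<in> V \<Longrightarrow> \<nu> f = ereal r \<Longrightarrow> \<nu> g = ereal s \<Longrightarrow>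
      \<nu> (\<lambda>x. f x + g x) \<le> ereal (r + s)"
  shows "\<exists>N. continuous_on X N \<and> (\<forall>g\<in>V. ereal (N (\<iota> g)) = \<nu> g) \<and>
    (\<exists>C\<ge>1. \<forall>b\<in>X. (1/C) * norm b \<le> N b \<and> N b \<le> C * norm b)"
proof -
  have add: "\<iota> (\<lambda>x. f x + g x) = \<iota> f + \<iota> g" if "f \<in> V" "g \<in> V" for f g
    using compl that by (simp add: is_completion_def)
  have scale: "\<iota> (\<lambda>x. c * g x) = c *\<^sub>R \<iota> g" if "g \<in> V" for c g
    using compl that by (simp add: is_completion_def)
  have NB: "NB g = ereal (norm (\<iota> g))" if "g \<in> V" for g
    using compl that by (simp add: is_completion_def)
  have X: "X = closure (\<iota> ` V)" using compl by (simp add: is_completion_def)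
  define \<mu> where "\<mu> = (\<lambda>g. real_of_ereal (\<nu> g))"
  have \<mu>: "\<nu> g = ereal (\<mu> g)" "\<mu> g \<le> C * norm (\<iota> g)" "norm (\<iota> g) \<le> C * \<mu> g" if "g \<in> V" for g
    using equiv[OF that NB[OF that]] by (auto simp: \<mu>_def)
  have lip1: "\<mu> f - \<mu> g \<le> C * norm (\<iota> f - \<iota> g)" if fg: "f \<in> V" "g \<in> V" for f g
  proof -
    define h where "h = (\<lambda>x. f x + (-1) * g x)"
    have h: "h \<in> V" unfolding h_def using fg by (rule V)
    have mg: "(\<lambda>x. (-1) * g x) \<in> V" using V[OF fg(2) fg(2), of "-2"] by (simp add: algebra_simps)
    have "\<iota> h = \<iota> f - \<iota> g" using add[OF fg(1) mg] scale[OF fg(2), of "-1"] by (simp add: h_def)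
    moreover have "\<nu> f \<le> ereal (\<mu> g + \<mu> h)"
      using triangle[OF fg(2) h \<mu>(1)[OF fg(2)] \<mu>(1)[OF h]] by (simp add: h_def)
    ultimately show ?thesis using \<mu>(2)[OF h] by (simp add: \<mu>(1)[OF fg(1)])
  qed
  have lip: "\<bar>\<mu> f - \<mu> g\<bar> \<le> C * norm (\<iota> f - \<iota> g)" if "f \<in> V" "g \<in> V" for f g
    using lip1[OF that] lip1[OF that(2,1)] by (simp add: norm_minus_commute abs_le_iff)
  define N0 where "N0 = (\<lambda>b. \<mu> (SOME g. g \<in> V \<and> \<iota> g = b))"
  have N0: "N0 (\<iota> g) = \<mu> g" if "g \<in> V" for g
  proof -
    define f where "f = (SOME f. f \<in> V \<and> \<iota> f = \<iota> g)"
    have f: "f \<in> V \<and> \<iota> f = \<iota> g" unfolding f_def by (rule someI[of _ g]) (use that in simp)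
    then show ?thesis using lip[of f g] that by (simp add: N0_def f_def[symmetric])
  qed
  have "C-lipschitz_on (\<iota> ` V) N0"
    using lip N0 C by (intro lipschitz_onI) (auto simp: dist_norm)
  then obtain N where N: "C-lipschitz_on X N" "\<And>b. b \<in> \<iota> ` V \<Longrightarrow> N b = N0 b"
    unfolding X using lipschitz_extend_closure[of C "\<iota> ` V" N0] by blast
  have cont: "continuous_on X N" using N(1) by (rule lipschitz_on_continuous_on)
  have Nv: "N (\<iota> g) = \<mu> g" if "g \<in> V" for g using N(2) N0 that by simp
  have cont': "continuous_on (closure (\<iota> ` V)) (\<lambda>b. C * norm b - N b)"
    "continuous_on (closure (\<iota> ` V)) (\<lambda>b. C * N b - norm b)"
    using cont unfolding X by (intro continuous_intros; assumption)+
  have up: "0 \<le> C * norm b - N b" if "b \<in> X" for b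
    by (rule continuous_ge_on_closure[OF cont'(1) that[unfolded X]]) (use \<mu>(2) Nv in auto)
  have low: "0 \<le> C * N b - norm b" if "b \<in> X" for b
    by (rule continuous_ge_on_closure[OF cont'(2) that[unfolded X]]) (use \<mu>(3) Nv in auto)
  show ?thesis
  proof (intro exI[of _ N] conjI exI[of _ C] ballI)
    show "continuous_on X N" by (rule cont)
    show "ereal (N (\<iota> g)) = \<nu> g" if "g \<in> V" for g using Nv[OF that] \<mu>(1)[OF that] by simp
    show "1 \<le> C" by (rule C)
    show "1 / C * norm b \<le> N b" if "b \<in> X" for b using low[OF that] C by (simp add: field_simps)
    show "N b \<le> C * norm b" if "b \<in> X" for b using up[OF that] by simp
  qed
qed

section \<open>Homogeneous stable curves of dispersing billiards\<close>

text \<open>The finite horizon condition excludes a table without scatterers, and the two curvature bounds of a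
  scatterer must leave room for its curvature.\<close>

lemma dispersing_table_facts:
  assumes "dispersing_table n l \<tau> K E B \<Gamma>" "0 < K"
  shows "0 < n" "i < n \<Longrightarrow> 0 < l i" "K < 1 / K"
proof -
  obtain R where R: "\<And>x u. norm u = 1 \<Longrightarrow>
      (\<exists>t\<in>{0..R}. \<exists>i<n. \<exists>w\<in>int_lattice. x + t *\<^sub>R u \<in> (+) w ` B i)"
    using assms(1) unfolding dispersing_table_def by blast
  from R[of 1 0] obtain j where j: "j < n" by auto
  have sc: "scatterer K E (l i) (B i) (\<Gamma> i)" if "i < n" for i
    using assms(1) that by (simp add: dispersing_table_def)
  show "0 < n" using j by simp
  show "i < n \<Longrightarrow> 0 < l i" using sc by (simp add: scatterer_def)
  obtain \<Gamma>1 \<Gamma>2 :: "real \<Rightarrow> complex" where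
    "\<And>s. K < Im (cnj (\<Gamma>1 s) * \<Gamma>2 s) \<and> Im (cnj (\<Gamma>1 s) * \<Gamma>2 s) < 1 / K"
    using sc[OF j] unfolding scatterer_def by blast
  from this[of 0] show "K < 1 / K" by linarith
qed

lemma sub_curve_whole: "sub_curve W (lo W) (hi W) = W"
  by (cases W) (simp add: sub_curve_def)

lemma slope_eq:
  assumes "lo W < hi W" "r \<in> base W" "(height W has_real_derivative d) (at r within base W)"
  shows "slope W r = d"
  using slope_sub_curve[OF assms(3) order_refl assms(1) order_refl] assms(2)
  by (simp add: sub_curve_whole base_def)

lemma stable_curvesD:
  assumes "W \<in> stable_curves n l \<tau> K \<delta>0 \<kappa>" and K: "0 < K" "0 < \<tau>"
  defines "D \<equiv> 1/K + 1/\<tau>"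
  shows "lo W < hi W" "curve_set W \<subseteq> phase_space n l" "curve_len W \<le> \<delta>0"
    and "r \<in> base W \<Longrightarrow> (height W has_real_derivative slope W r) (at r within base W)"
    and "r \<in> base W \<Longrightarrow> \<bar>slope W r\<bar> \<le> D"
    and "r \<in> base W \<Longrightarrow> s \<in> base W \<Longrightarrow>
      \<bar>slope W r - slope W s\<bar> \<le> \<kappa> * (1 + D\<^sup>2) powr (3/2) * \<bar>r - s\<bar>"
proof -
  show lohi: "lo W < hi W" and "curve_set W \<subseteq> phase_space n l" "curve_len W \<le> \<delta>0"
    using assms(1) by (auto simp: stable_curves_def)
  obtain d1 d2 where d: "\<And>r. r \<in> base W \<Longrightarrow>
           (height W has_real_derivative d1 r) (at r within base W) \<and>
           (d1 has_real_derivative d2 r) (at r within base W) \<and>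
           - (1/K) - 1/\<tau> \<le> d1 r \<and> d1 r \<le> - K \<and>
           \<bar>d2 r\<bar> / (1 + (d1 r)\<^sup>2) powr (3/2) \<le> \<kappa>"
    using assms(1) unfolding stable_curves_def by blast
  have sl: "slope W r = d1 r" if "r \<in> base W" for r
    using slope_eq[OF lohi that] d[OF that] by blast
  show "r \<in> base W \<Longrightarrow> (height W has_real_derivative slope W r) (at r within base W)"
    using d sl by simp
  have b1: "\<bar>d1 r\<bar> \<le> D" if "r \<in> base W" for r
    using d[OF that] K by (auto simp: D_def)
  then show "r \<in> base W \<Longrightarrow> \<bar>slope W r\<bar> \<le> D" using sl by simp
  have b2: "\<bar>d2 r\<bar> \<le> \<kappa> * (1 + D\<^sup>2) powr (3/2)" if r: "r \<in> base W" for r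
  proof -
    have "0 < 1 + (d1 r)\<^sup>2" by (simp add: add_pos_nonneg)
    then have pos: "0 < (1 + (d1 r)\<^sup>2) powr (3/2)" by (metis powr_gt_zero less_irrefl)
    have k: "\<bar>d2 r\<bar> / (1 + (d1 r)\<^sup>2) powr (3/2) \<le> \<kappa>" using d[OF r] by blast
    then have k0: "0 \<le> \<kappa>" by (rule order_trans[rotated]) simp
    have "\<bar>d2 r\<bar> \<le> \<kappa> * (1 + (d1 r)\<^sup>2) powr (3/2)" using k pos by (simp add: divide_le_eq)
    also have "\<dots> \<le> \<kappa> * (1 + D\<^sup>2) powr (3/2)"
    proof -
      have "(d1 r)\<^sup>2 \<le> D\<^sup>2" using b1[OF r] by (metis abs_le_square_iff abs_of_nonneg abs_ge_zero order_trans)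
      then show ?thesis using k0 by (intro mult_left_mono powr_mono2) auto
    qed
    finally show ?thesis .
  qed
  assume rs: "r \<in> base W" "s \<in> base W"
  have "norm (d1 r - d1 s) \<le> \<kappa> * (1 + D\<^sup>2) powr (3/2) * norm (r - s)"
    using d b2 rs
    by (intro field_differentiable_bound[of "base W" d1 d2]) (auto simp: base_def)
  then show "\<bar>slope W r - slope W s\<bar> \<le> \<kappa> * (1 + D\<^sup>2) powr (3/2) * \<bar>r - s\<bar>"
    using sl rs by simp
qed

lemma sub_curve_stable:
  assumes W: "W \<in> stable_curves n l \<tau> K \<delta>0 \<kappa>" and K: "0 < K" "0 < \<tau>"
    and xy: "lo W \<le> x" "x < y" "y \<le> hi W"
  shows "sub_curve W x y \<in> stable_curves n l \<tau> K \<delta>0 \<kappa>" "curve_set (sub_curve W x y) \<subseteq> curve_set W"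
proof -
  note D = stable_curvesD[OF W K]
  have sub: "{x..y} \<subseteq> base W" using xy by (auto simp: base_def)
  show cs: "curve_set (sub_curve W x y) \<subseteq> curve_set W"
    using sub unfolding curve_set_def sub_curve_simps by (intro image_mono)
  obtain d1 d2 where d: "\<And>r. r \<in> base W \<Longrightarrow>
           (height W has_real_derivative d1 r) (at r within base W) \<and>
           (d1 has_real_derivative d2 r) (at r within base W) \<and>
           - (1/K) - 1/\<tau> \<le> d1 r \<and> d1 r \<le> - K \<and>
           \<bar>d2 r\<bar> / (1 + (d1 r)\<^sup>2) powr (3/2) \<le> \<kappa>" and cd2: "continuous_on (base W) d2"
    using W unfolding stable_curves_def by blast
  have sl: "slope W r = d1 r" if "r \<in> base W" for r
    using slope_eq[OF D(1) that] d[OF that] by blast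
  have "continuous_on (base W) d1" using d by (intro DERIV_continuous_on) blast
  then have "continuous_on (base W) (\<lambda>r. sqrt (1 + (d1 r)\<^sup>2))" by (intro continuous_intros)
  then have "continuous_on (base W) (speed W)"
    by (rule continuous_on_eq) (simp add: speed_def sl)
  then have int: "speed W integrable_on base W"
    unfolding base_def by (rule integrable_continuous_real)
  have "curve_len (sub_curve W x y) = integral {x..y} (speed W)"
    unfolding curve_len_def sub_curve_simps
    using slope_sub_curve[OF D(4) xy] sub by (intro integral_cong) (auto simp: speed_def)
  also have "\<dots> \<le> integral (base W) (speed W)"
    using sub int by (intro integral_subset_le)
      (auto intro: integrable_on_subinterval order_trans[OF zero_le_one speed_ge_one])
  finally have len: "curve_len (sub_curve W x y) \<le> \<delta>0" using D(3) by (simp add: curve_len_def)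
  have witness: "\<exists>d1 d2. P d1 d2" if "P d1 d2" for P using that by blast
  show "sub_curve W x y \<in> stable_curves n l \<tau> K \<delta>0 \<kappa>"
    unfolding stable_curves_def mem_Collect_eq
  proof (intro conjI witness ballI)
    show "continuous_on (base (sub_curve W x y)) d2"
      using cd2 sub by (simp add: continuous_on_subset)
  next
    fix r assume "r \<in> base (sub_curve W x y)"
    then have r: "r \<in> base W" using sub by auto
    show "(height (sub_curve W x y) has_real_derivative d1 r) (at r within base (sub_curve W x y))"
      using d[OF r] sub by (auto intro: DERIV_subset)
    show "(d1 has_real_derivative d2 r) (at r within base (sub_curve W x y))"
      using d[OF r] sub by (auto intro: DERIV_subset)
    show "- (1/K) - 1/\<tau> \<le> d1 r" "d1 r \<le> - K" "\<bar>d2 r\<bar> / (1 + (d1 r)\<^sup>2) powr (3/2) \<le> \<kappa>"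
      using d[OF r] by auto
  qed (use xy cs D(2) len in auto)
qed

text \<open>Curvature is the second derivative up to the factor \<open>(1 + slope\<^sup>2)\<^bsup>3/2\<^esup>\<close>, so that bounds for slope and
  curvature give a Lipschitz constant for the slope.\<close>

lemma homogeneous_curve_family:
  assumes "0 < K" "0 < \<tau>"
  shows "curve_family H (homogeneous_curves H (stable_curves n l \<tau> K \<delta>0 \<kappa>)) (1/K + 1/\<tau>)
    (max 1 (\<kappa> * (1 + (1/K + 1/\<tau>)\<^sup>2) powr (3/2)))" (is "curve_family H ?\<W> ?D ?\<Lambda>")
proof
  fix W assume "W \<in> ?\<W>"
  then have W: "W \<in> stable_curves n l \<tau> K \<delta>0 \<kappa>" and H: "\<exists>S\<in>H. curve_set W \<subseteq> S"
    by (auto simp: homogeneous_curves_def)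
  note D = stable_curvesD[OF W assms]
  show "lo W < hi W" "\<exists>S\<in>H. curve_set W \<subseteq> S" by fact+
  fix r assume r: "r \<in> base W"
  show "(height W has_real_derivative slope W r) (at r within base W)" "\<bar>slope W r\<bar> \<le> ?D"
    using D r by auto
  fix s assume s: "s \<in> base W"
  have "\<bar>slope W r - slope W s\<bar> \<le> \<kappa> * (1 + ?D\<^sup>2) powr (3/2) * \<bar>r - s\<bar>" using D r s by blast
  also have "\<dots> \<le> ?\<Lambda> * \<bar>r - s\<bar>" by (intro mult_right_mono) auto
  finally show "\<bar>slope W r - slope W s\<bar> \<le> ?\<Lambda> * \<bar>r - s\<bar>" .
next
  fix W x y assume "W \<in> ?\<W>" and xy: "lo W \<le> x" "x < y" "y \<le> hi W"
  then have W: "W \<in> stable_curves n l \<tau> K \<delta>0 \<kappa>" and H: "\<exists>S\<in>H. curve_set W \<subseteq> S"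
    by (auto simp: homogeneous_curves_def)
  show "sub_curve W x y \<in> ?\<W>"
    using sub_curve_stable[OF W assms xy] H by (auto simp: homogeneous_curves_def)
qed simp

text \<open>A straight segment of slope \<open>- K\<close> starting at \<open>\<phi> = 0\<close> lies in the central strip.\<close>

lemma scale_curves_nonempty:
  assumes "0 < n" "0 < K" "K < 1 / K" "0 < \<tau>" "0 < \<kappa>" "1 \<le> k0" "2 \<le> q0"
    and \<delta>: "0 < \<delta>" "\<delta> \<le> 1/2" "\<delta> < l 0" "\<delta> \<le> \<delta>0"
  shows "scale_curves (homogeneous_curves (homogeneity_strips n l q0 k0) (stable_curves n l \<tau> K \<delta>0 \<kappa>)) \<delta> \<noteq> {}"
proof -
  define v where "v = sqrt (1 + K\<^sup>2)"
  have v: "1 \<le> v" "K \<le> v" using assms(2) by (auto simp: v_def intro: real_le_rsqrt)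
  define h where "h = \<delta> / v"
  have h: "0 < h" "h \<le> \<delta>" "K * h \<le> \<delta>"
    using v \<delta>(1) assms(2) by (auto simp: h_def field_simps mult_right_mono)
  define W where "W = Curve 0 0 h (\<lambda>r. - K * r)"
  have W [simp]: "lo W = 0" "hi W = h" "scat W = 0" "height W = (\<lambda>r. - K * r)" "base W = {0..h}"
    by (auto simp: W_def base_def)
  have der: "((\<lambda>r. - K * r) has_real_derivative - K) (at r within {0..h})" for r
    by (auto intro!: derivative_eq_intros)
  have sl: "slope W r = - K" if "r \<in> {0..h}" for r
    using slope_eq[of W r "- K"] der h that by simp
  have len: "curve_len W = \<delta>"
  proof -
    have "curve_len W = integral {0..h} (\<lambda>r. v)"
      unfolding curve_len_def W by (intro integral_cong) (simp add: speed_def sl v_def)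
    then show ?thesis using h v by (simp add: h_def)
  qed
  have k0: "real k0 powr (- q0) \<le> 1"
  proof -
    have "real k0 powr (- q0) \<le> real k0 powr 0" using assms by (intro powr_mono) auto
    then show ?thesis using assms by simp
  qed
  have pt: "K * r \<le> \<delta>" "0 \<le> K * r" if "r \<in> {0..h}" for r
  proof -
    have "K * r \<le> K * h" using that assms(2) by (intro mult_left_mono) auto
    then show "K * r \<le> \<delta>" using h(3) by linarith
    show "0 \<le> K * r" using that assms(2) by simp
  qed
  have range: "(0, r, - K * r) \<in> phase_space n l" "\<bar>- K * r\<bar> \<le> pi/2 - real k0 powr (- q0)" if "r \<in> {0..h}" for r
  proof -
    show "\<bar>- K * r\<bar> \<le> pi/2 - real k0 powr (- q0)" using pt[OF that] k0 \<delta>(2) pi_gt3 by simp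
    show "(0, r, - K * r) \<in> phase_space n l"
      using pt[OF that] that h(2) \<delta> pi_gt3 assms(1) by (simp add: phase_space_def)
  qed
  have witness: "\<exists>d1 d2. P d1 d2" if "P (\<lambda>_. - K) (\<lambda>_. 0)" for P :: "(real \<Rightarrow> real) \<Rightarrow> (real \<Rightarrow> real) \<Rightarrow> bool"
    using that by blast
  have "W \<in> stable_curves n l \<tau> K \<delta>0 \<kappa>"
    unfolding stable_curves_def mem_Collect_eq
  proof (intro conjI witness ballI)
    show "curve_set W \<subseteq> phase_space n l" using range(1) by (auto simp: curve_set_def graph_pt_def)
    have "0 < 1 / \<tau>" using assms(4) by simp
    then show "- (1/K) - 1/\<tau> \<le> - K" using assms(3) by linarith
  qed (use h len \<delta> assms der in auto)
  moreover have "\<exists>S\<in>homogeneity_strips n l q0 k0. curve_set W \<subseteq> S"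
  proof (rule bexI)
    show "curve_set W \<subseteq> {(i, r, \<phi>) \<in> phase_space n l. \<bar>\<phi>\<bar> \<le> pi/2 - real k0 powr (- q0)}"
      using range by (auto simp: curve_set_def graph_pt_def)
    show "{(i, r, \<phi>) \<in> phase_space n l. \<bar>\<phi>\<bar> \<le> pi/2 - real k0 powr (- q0)} \<in> homogeneity_strips n l q0 k0"
      unfolding homogeneity_strips_def by (rule UnI1) (rule singletonI)
  qed
  ultimately have "W \<in> scale_curves (homogeneous_curves (homogeneity_strips n l q0 k0) (stable_curves n l \<tau> K \<delta>0 \<kappa>)) \<delta>"
    using len \<delta>(1) by (simp add: scale_curves_def homogeneous_curves_def)
  then show ?thesis by blast
qed

lemma C1_fun_lincomb:
  assumes "f \<in> C1_fun n l" "g \<in> C1_fun n l"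
  shows "(\<lambda>x. f x + k * g x) \<in> C1_fun n l"
  unfolding C1_fun_def mem_Collect_eq
proof (intro allI impI)
  fix i assume i: "i < n"
  let ?X = "UNIV \<times> {-(pi/2)..pi/2} :: (real \<times> real) set"
  obtain h1 :: "real \<times> real \<Rightarrow> real" and D1 :: "real \<times> real \<Rightarrow> (real \<times> real) \<Rightarrow>\<^sub>L real" where 1:
    "\<forall>r \<phi>. h1 (r + l i, \<phi>) = h1 (r, \<phi>)" "\<forall>r\<in>{0..<l i}. \<forall>\<phi>\<in>{-(pi/2)..pi/2}. f (i, r, \<phi>) = h1 (r, \<phi>)"
    "\<forall>x\<in>?X. (h1 has_derivative blinfun_apply (D1 x)) (at x within ?X)" "continuous_on ?X D1"
    using assms(1) i unfolding C1_fun_def by blast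
  obtain h2 :: "real \<times> real \<Rightarrow> real" and D2 :: "real \<times> real \<Rightarrow> (real \<times> real) \<Rightarrow>\<^sub>L real" where 2:
    "\<forall>r \<phi>. h2 (r + l i, \<phi>) = h2 (r, \<phi>)" "\<forall>r\<in>{0..<l i}. \<forall>\<phi>\<in>{-(pi/2)..pi/2}. g (i, r, \<phi>) = h2 (r, \<phi>)"
    "\<forall>x\<in>?X. (h2 has_derivative blinfun_apply (D2 x)) (at x within ?X)" "continuous_on ?X D2"
    using assms(2) i unfolding C1_fun_def by blast
  show "\<exists>(h :: real \<times> real \<Rightarrow> real) (D :: real \<times> real \<Rightarrow> (real \<times> real) \<Rightarrow>\<^sub>L real).
     (\<forall>r \<phi>. h (r + l i, \<phi>) = h (r, \<phi>)) \<and>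
     (\<forall>r\<in>{0..<l i}. \<forall>\<phi>\<in>{-(pi/2)..pi/2}. f (i, r, \<phi>) + k * g (i, r, \<phi>) = h (r, \<phi>)) \<and>
     (\<forall>x\<in>?X. (h has_derivative blinfun_apply (D x)) (at x within ?X)) \<and> continuous_on ?X D"
  proof (intro exI[of _ "\<lambda>x. h1 x + k * h2 x"] exI[of _ "\<lambda>x. D1 x + k *\<^sub>R D2 x"] conjI ballI allI)
    fix x assume x: "x \<in> ?X"
    have "((\<lambda>x. h1 x + k * h2 x) has_derivative (\<lambda>v. D1 x v + k * D2 x v)) (at x within ?X)"
      using 1(3) 2(3) x by (intro has_derivative_add has_derivative_mult_right) auto
    moreover have "blinfun_apply (D1 x + k *\<^sub>R D2 x) = (\<lambda>v. D1 x v + k * D2 x v)"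
      by (auto simp: blinfun.add_left blinfun.scaleR_left)
    ultimately show "((\<lambda>x. h1 x + k * h2 x) has_derivative blinfun_apply (D1 x + k *\<^sub>R D2 x)) (at x within ?X)"
      by (simp only:)
  next
    show "continuous_on ?X (\<lambda>x. D1 x + k *\<^sub>R D2 x)" using 1(4) 2(4) by (intro continuous_intros)
  qed (use 1(1,2) 2(1,2) in auto)
qed

lemma C1_fun_continuous_on_curve:
  assumes g: "g \<in> C1_fun n l" and W: "curve_set W \<subseteq> phase_space n l" "base W \<noteq> {}"
    and h: "continuous_on (base W) (height W)"
  shows "continuous_on (base W) (\<lambda>r. g (graph_pt W r))"
proof -
  have pt: "scat W < n" "r \<in> {0..<l (scat W)}" "height W r \<in> {-(pi/2)..pi/2}" if "r \<in> base W" for r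
    using W(1) that by (auto simp: curve_set_def graph_pt_def phase_space_def)
  let ?X = "UNIV \<times> {-(pi/2)..pi/2} :: (real \<times> real) set"
  have "scat W < n" using W(2) pt by blast
  then obtain f :: "real \<times> real \<Rightarrow> real" and D :: "real \<times> real \<Rightarrow> (real \<times> real) \<Rightarrow>\<^sub>L real" where f:
    "\<forall>r\<in>{0..<l (scat W)}. \<forall>\<phi>\<in>{-(pi/2)..pi/2}. g (scat W, r, \<phi>) = f (r, \<phi>)"
    "\<forall>x\<in>?X. (f has_derivative blinfun_apply (D x)) (at x within ?X)"
    using g unfolding C1_fun_def by blast
  have "continuous_on ?X f" using f(2) by (intro has_derivative_continuous_on[of ?X f "\<lambda>x. blinfun_apply (D x)"]) blast
  then have "continuous_on (base W) (\<lambda>r. f (r, height W r))"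
    by (rule continuous_on_compose2) (use pt h in \<open>auto intro!: continuous_intros\<close>)
  then show ?thesis
    by (rule continuous_on_eq) (use f(1) pt in \<open>auto simp: graph_pt_def\<close>)
qed

theorem theorem6p1:
  fixes n k0 :: nat and l :: "nat \<Rightarrow> real"
    and \<tau> K E q0 \<delta>0 \<kappa> \<alpha> \<beta> \<gamma> p \<epsilon>0 cu q a c A L :: real
    and M :: "pt set" and H :: "pt set set" and \<W> :: "curve set"
    and \<iota> :: "(pt \<Rightarrow> real) \<Rightarrow> 'b::banach" and \<BB> :: "'b set"
  assumes "\<tau> > 0" "K > 0" "E > 0"
    and table: "\<exists>B \<Gamma>. dispersing_table n l \<tau> K E B \<Gamma>"
    and "q0 \<ge> 2" "k0 \<ge> 1" "\<delta>0 > 0" "\<kappa> > 0"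
    and M: "M = phase_space n l"
    and H: "H = homogeneity_strips n l q0 k0"
    and \<W>: "\<W> = homogeneous_curves H (stable_curves n l \<tau> K \<delta>0 \<kappa>)"
    and "0 < \<alpha>" "\<alpha> \<le> 1 / (q0 + 1)" "p > q0 + 1" "1/p < \<beta>" "\<beta> < \<alpha>"
    and "0 < \<gamma>" "\<gamma> < min (1/p) (\<alpha> - \<beta>)" "\<epsilon>0 > 0" "cu > 0"
    and \<BB>: "is_completion (C1_fun n l) (norm_B H \<W> \<alpha> \<beta> \<gamma> p \<epsilon>0 cu) \<iota> \<BB>"
    and "0 < q" "q < 1/2" "\<gamma> \<le> min (\<alpha> - \<beta>) q"
    and "a > 1" "c > 1" "A > 1" "L > 1"
    and "q = 1/p" "A > 4" "A * c > 1 + sqrt (1 + (1/K + 1/\<tau>)\<^sup>2)" "\<gamma> \<le> 1 / (p + 1)"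
  shows "\<exists>\<delta>1>0. \<forall>\<delta>. 0 < \<delta> \<and> \<delta> \<le> \<delta>1 \<and> 2 * \<delta> \<le> \<delta>0 \<longrightarrow>
    (\<exists>N :: 'b \<Rightarrow> real.
       continuous_on \<BB> N \<and>
       (\<forall>g\<in>C1_fun n l. ereal (N (\<iota> g)) = norm_star M (billiard_cone M H \<W> \<alpha> \<beta> \<gamma> q a c A L \<delta>) g) \<and>
       (\<exists>C\<ge>1. \<forall>b\<in>\<BB>. (1/C) * norm b \<le> N b \<and> N b \<le> C * norm b))"
proof -
  define D where "D = 1/K + 1/\<tau>"
  define \<Lambda> where "\<Lambda> = max 1 (\<kappa> * (1 + D\<^sup>2) powr (3/2))"
  obtain B \<Gamma> where tab: "dispersing_table n l \<tau> K E B \<Gamma>" using table by blast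
  note tab = dispersing_table_facts[OF tab \<open>K > 0\<close>]
  interpret curve_family H \<W> D \<Lambda>
    unfolding \<W> D_def \<Lambda>_def by (rule homogeneous_curve_family[OF \<open>K > 0\<close> \<open>\<tau> > 0\<close>])
  have \<alpha>1: "\<alpha> \<le> 1/3"
  proof -
    have "1 / (q0 + 1) \<le> 1 / 3" using \<open>q0 \<ge> 2\<close> by (intro divide_left_mono) auto
    then show ?thesis using \<open>\<alpha> \<le> 1 / (q0 + 1)\<close> by linarith
  qed
  \<comment> \<open>As \<open>1 - \<alpha> \<ge> 1/2\<close>, the bound on the logarithms of arclength ratios holds once
      \<open>2 \<delta> \<le> 1 / (4 \<Lambda>)\<^sup>2\<close>.\<close>
  define \<delta>1 where "\<delta>1 = min (min (1/2) (\<epsilon>0 / 2)) (min (l 0 / 2) (1 / (2 * (4 * \<Lambda>)\<^sup>2)))"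
  have "0 < \<Lambda>" using \<Lambda>_ge_one by simp
  then have \<delta>1: "0 < \<delta>1" using \<open>\<epsilon>0 > 0\<close> tab(1,2) by (simp add: \<delta>1_def)
  show ?thesis
  proof (intro exI[of _ \<delta>1] conjI allI impI \<delta>1)
    fix \<delta> assume \<delta>': "0 < \<delta> \<and> \<delta> \<le> \<delta>1 \<and> 2 * \<delta> \<le> \<delta>0"
    have "0 < l 0" using tab(1,2) by blast
    then have \<delta>: "0 < \<delta>" "\<delta> \<le> 1/2" "\<delta> < \<epsilon>0" "\<delta> < l 0" "\<delta> \<le> \<delta>0" "\<delta> \<le> 1 / (2 * (4 * \<Lambda>)\<^sup>2)"
      using \<delta>' \<open>\<epsilon>0 > 0\<close> by (auto simp: \<delta>1_def)
    have scale: "scale_curves \<W> \<delta> \<noteq> {}"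
      unfolding \<W> H
      using tab \<delta> \<open>K > 0\<close> \<open>\<tau> > 0\<close> \<open>\<kappa> > 0\<close> \<open>k0 \<ge> 1\<close> \<open>q0 \<ge> 2\<close> by (intro scale_curves_nonempty) auto
    have small: "4 * \<Lambda> * (2 * \<delta>) powr (1 - \<alpha>) \<le> 1"
    proof -
      have "(2 * \<delta>) powr (1 - \<alpha>) \<le> (2 * \<delta>) powr (1/2)" using \<delta> \<alpha>1 by (intro powr_mono') auto
      also have "\<dots> \<le> (1 / (4 * \<Lambda>)\<^sup>2) powr (1/2)" using \<delta> by (intro powr_mono2) auto
      also have "\<dots> = sqrt ((1 / (4 * \<Lambda>))\<^sup>2)" by (simp add: powr_half_sqrt power_one_over)
      also have "\<dots> = 1 / (4 * \<Lambda>)" unfolding real_sqrt_abs using \<open>0 < \<Lambda>\<close> by simp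
      finally show ?thesis using \<open>0 < \<Lambda>\<close> by (simp add: field_simps)
    qed
    have length: "hi W - lo W \<le> max 1 \<delta>0" if "W \<in> \<W>" for W
    proof -
      have "curve_len W \<le> \<delta>0"
        using that stable_curvesD(3) \<open>K > 0\<close> \<open>\<tau> > 0\<close> by (auto simp: \<W> homogeneous_curves_def)
      then show ?thesis using curve_len_bounds(1)[OF that] by simp
    qed
    have in_M: "curve_set W \<subseteq> M" if "W \<in> \<W>" for W
    proof -
      have "W \<in> stable_curves n l \<tau> K \<delta>0 \<kappa>" using that by (simp add: \<W> homogeneous_curves_def)
      then show ?thesis unfolding M by (rule stable_curvesD(2)[OF _ \<open>K > 0\<close> \<open>\<tau> > 0\<close>])
    qed
    have "\<W> \<noteq> {}" using scale by (auto simp: scale_curves_def)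
    moreover have "1 < p" using \<open>p > q0 + 1\<close> \<open>q0 \<ge> 2\<close> by simp
    moreover have "0 < 1 / p" using \<open>1 < p\<close> by simp
    moreover have "1 + \<sigma> < A * c" unfolding \<sigma>_def unfolding D_def by fact
    ultimately interpret cone_setting H \<W> D \<Lambda> "max 1 \<delta>0" \<alpha> \<beta> \<gamma> p \<epsilon>0 cu M a c A L \<delta>
      using \<open>1/p < \<beta>\<close> \<open>\<beta> < \<alpha>\<close> \<open>0 < \<gamma>\<close> \<open>\<gamma> < min (1/p) (\<alpha> - \<beta>)\<close> \<open>\<epsilon>0 > 0\<close> \<open>cu > 0\<close> \<open>a > 1\<close> \<open>A > 4\<close> \<open>L > 1\<close> \<delta> \<alpha>1 small scale length in_M by unfold_locales auto
    have cc: "curve_continuous g" if "g \<in> C1_fun n l" for g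
      unfolding curve_continuous_def
    proof
      fix W assume W: "W \<in> \<W>"
      show "continuous_on (base W) (\<lambda>r. g (graph_pt W r))"
      proof (rule C1_fun_continuous_on_curve[OF that])
        show "curve_set W \<subseteq> phase_space n l" using in_M[OF W] by (simp add: M)
        show "base W \<noteq> {}" using lo_less_hi[OF W] by (simp add: base_def)
        show "continuous_on (base W) (height W)" by (rule DERIV_continuous_on[OF height_deriv[OF W]])
      qed
    qed
    obtain C where C: "1 \<le> C" "\<And>g b. curve_continuous g \<Longrightarrow> norm_B H \<W> \<alpha> \<beta> \<gamma> p \<epsilon>0 cu g = ereal b \<Longrightarrow>
        0 \<le> b \<Longrightarrow> \<exists>r. norm_star M the_cone g = ereal r \<and> r \<le> C * b \<and> b \<le> C * r"
      using norm_star_equivalent by blast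
    show "\<exists>N :: 'b \<Rightarrow> real. continuous_on \<BB> N \<and>
       (\<forall>g\<in>C1_fun n l. ereal (N (\<iota> g)) = norm_star M (billiard_cone M H \<W> \<alpha> \<beta> \<gamma> q a c A L \<delta>) g) \<and>
       (\<exists>C\<ge>1. \<forall>b\<in>\<BB>. (1/C) * norm b \<le> N b \<and> N b \<le> C * norm b)"
      unfolding \<open>q = 1/p\<close>
      using extend_equivalent_norm[where \<nu> = "norm_star M the_cone" and C = C, OF \<BB> C1_fun_lincomb C(1)]
        C(2)[OF cc] norm_star_triangle[OF cc cc] by blast
  qed
qed

end
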